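(* Let $0<\gamma<1$, $T>0$, $b,d>0$, and suppose that either $a<0$, $c=0$, or $a=0$, $c<0$. Let $\mu\ge 1$, and suppose that the 1-periodic initial-value problem for the B/FD system with initial data $(\zeta_0,u_0)$ has a unique solution $(\zeta,u)$ on $[0,T]$ with $\zeta,u\in C([0,T];H^{\mu})$. For an integer $N\ge1$ let $(\zeta_N,u_N)$ be the Fourier-Galerkin semidiscrete approximation in $S_N$. Then there exist $N_0$ and a constant $C$ independent of $N$ such that for all $N\ge N_0$ the semidiscrete solution $(\zeta_N,u_N)$ is defined on $[0,T]$ and $$\max_{0\le t\le T}\left(\|\zeta_N(t)-\zeta(t)\|+\|u_N(t)-u(t)\|\right)\le C N^{-\mu}.$$
   Context: B/FD (Boussinesq/Full dispersion) system, with constants $a=\frac{1-\alpha_1-3\beta}{3}$, $b=\frac{\alpha_1}{3}$, $c=\beta\alpha_2$, $d=\beta(1-\alpha_2)$, where $\alpha_1\ge0$, $\alpha_2\le1$, $\beta\ge0$: $$(1-b\partial_x^2)\zeta_t+\tfrac1\gamma((1-\zeta)u)_x-\tfrac1{\gamma^2}(|D|\coth|D|)u_x+\tfrac1\gamma\left(a-\tfrac1{\gamma^2}\coth^2|D|\right)u_{xxx}=0,$$ $$(1-d\partial_x^2)u_t+(1-\gamma)\zeta_x-\tfrac1\gamma uu_x+c(1-\gamma)\zeta_{xxx}=0,$$ with $D=\frac1i\partial_x$ and real-valued unknowns $\zeta(x,t),u(x,t)$ that are 1-periodic in $x$, with $\zeta(\cdot,0)=\zeta_0$, $u(\cdot,0)=u_0$.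 For a 1-periodic $f$ let $\widehat f(k)=\int_0^1 f(x)e^{-2\pi i kx}dx$, $k\in\mathbb Z$. $\|\cdot\|$ is the norm of $L^2(0,1)$, and $H^s$ is the Sobolev space of 1-periodic functions with norm $\|f\|_s=\left(\sum_{k\in\mathbb Z}(1+k^2)^s|\widehat f(k)|^2\right)^{1/2}$. Put $\kappa=2\pi k$ and $$g(\kappa)=\tfrac1\gamma-\tfrac1{\gamma^2}|\kappa|\coth|\kappa|-\tfrac{a\kappa^2}{\gamma}+\tfrac{\kappa^2}{\gamma^3}\coth^2|\kappa|\quad(\kappa\ne0),$$ extended by continuity to $\kappa=0$ (so $g(0)=\frac1\gamma-\frac1{\gamma^2}+\frac1{\gamma^3}$). In Fourier form the initial-value problem reads, for all $k\in\mathbb Z$, $t\in[0,T]$, $$\widehat\zeta_t+\frac{i\kappa}{1+b\kappa^2}g(\kappa)\widehat u=\frac{i}{\gamma}\frac{\kappa}{1+b\kappa^2}\widehat{\zeta u},\qquad \widehat u_t+i\kappa\frac{(1-\gamma)(1-c\kappa^2)}{1+d\kappa^2}\widehat\zeta=\frac{i}{2\gamma}\frac{\kappa}{1+d\kappa^2}\widehat{u^2},$$ with $\widehat\zeta(k,0)=\widehat{\zeta_0}(k)$, $\widehat u(k,0)=\widehat{u_0}(k)$. $S_N=\mathrm{span}\{e^{2\pi ikx}:k\in\mathbb Z,\ -N\le k\le N\}$. The Fourier-Galerkin semidiscrete approximation is the solution $(\zeta_N(t),u_N(t))\in S_N\times S_N$ of the ODE system obtained by imposing the same Fourier equations for $(\zeta_N,u_N)$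 in place of $(\zeta,u)$ only for $-N\le k\le N$, with $\widehat{\zeta_N}(k,0)=\widehat{\zeta_0}(k)$, $\widehat{u_N}(k,0)=\widehat{u_0}(k)$ for $-N\le k\le N$. *)

theory Defs
  imports "HOL-Analysis.Analysis"
begin

section \<open>Periodic functions, Fourier coefficients and Sobolev spaces\<close>

definition fourier_coeff :: "(real \<Rightarrow> complex) \<Rightarrow> int \<Rightarrow> complex" where
  "fourier_coeff f k =
     (LINT x:{0..1}|lborel. f x * exp (- (2 * of_real pi * \<i> * of_int k * of_real x)))"

definition L2_norm :: "(real \<Rightarrow> complex) \<Rightarrow> real" where
  "L2_norm f = sqrt (LINT x:{0..1}|lborel. (cmod (f x))\<^sup>2)"

text \<open>
  Functions stand for their a.e. classes.  The definition is meant for \<open>s \<ge> 0\<close>, where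
  elements of the Sobolev space are square-integrable functions.
\<close>

definition sobolev :: "real \<Rightarrow> (real \<Rightarrow> complex) set" where
  "sobolev s = {f. (\<forall>x. f (x + 1) = f x) \<and> f \<in> borel_measurable lborel \<and>
     set_integrable lborel {0..1} (\<lambda>x. (cmod (f x))\<^sup>2) \<and>
     (\<lambda>k::int. (1 + (of_int k)\<^sup>2) powr s * (cmod (fourier_coeff f k))\<^sup>2) summable_on UNIV}"

definition sobolev_norm :: "real \<Rightarrow> (real \<Rightarrow> complex) \<Rightarrow> real" where
  "sobolev_norm s f =
     sqrt (\<Sum>\<^sub>\<infinity>k::int. (1 + (of_int k)\<^sup>2) powr s * (cmod (fourier_coeff f k))\<^sup>2)"

text \<open>The space \<open>C([0,T]; H\<^sup>s)\<close>; the first argument of a member is time.\<close>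

definition C_sobolev :: "real \<Rightarrow> real \<Rightarrow> (real \<Rightarrow> real \<Rightarrow> complex) set" where
  "C_sobolev T s = {f. (\<forall>t\<in>{0..T}. f t \<in> sobolev s) \<and>
     (\<forall>t\<in>{0..T}. ((\<lambda>r. sobolev_norm s (\<lambda>x. f r x - f t x)) \<longlongrightarrow> 0) (at t within {0..T}))}"

text \<open>Complex span of the exponentials with wave numbers \<open>-N, \<dots>, N\<close>.\<close>

definition trig_space :: "nat \<Rightarrow> (real \<Rightarrow> complex) set" where
  "trig_space N = {f. \<exists>c :: int \<Rightarrow> complex. f =
     (\<lambda>x. \<Sum>k\<in>{- int N..int N}. c k * exp (2 * of_real pi * \<i> * of_int k * of_real x))}"

section \<open>The B/FD system\<close>

definition coth :: "real \<Rightarrow> real" where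
  "coth x = cosh x / sinh x"

text \<open>The value at \<open>0\<close> is the continuous extension, as \<open>x coth x \<longrightarrow> 1\<close> for \<open>x \<longrightarrow> 0\<close>.\<close>

definition bfd_symbol :: "real \<Rightarrow> real \<Rightarrow> real \<Rightarrow> real" where
  "bfd_symbol \<gamma> a \<kappa> =
     (if \<kappa> = 0 then 1 / \<gamma> - 1 / \<gamma>\<^sup>2 + 1 / \<gamma>^3
      else 1 / \<gamma> - 1 / \<gamma>\<^sup>2 * \<bar>\<kappa>\<bar> * coth \<bar>\<kappa>\<bar> - a * \<kappa>\<^sup>2 / \<gamma> + \<kappa>\<^sup>2 / \<gamma>^3 * (coth \<bar>\<kappa>\<bar>)\<^sup>2)"

text \<open>
  The initial-value problem on \<open>[0,T]\<close> in Fourier form, imposed for the wave numbers in \<open>K\<close>: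
  \<open>K = UNIV\<close> gives the B/FD system, \<open>K = {-N..N}\<close> its Fourier-Galerkin truncation.
  In physical variables the system is
  \<open>(1 - b \<partial>\<^sub>x\<^sup>2) \<zeta>\<^sub>t + 1/\<gamma> ((1 - \<zeta>) u)\<^sub>x - 1/\<gamma>\<^sup>2 (|D| coth |D|) u\<^sub>x
     + 1/\<gamma> (a - 1/\<gamma>\<^sup>2 coth\<^sup>2 |D|) u\<^sub>x\<^sub>x\<^sub>x = 0\<close> and
  \<open>(1 - d \<partial>\<^sub>x\<^sup>2) u\<^sub>t + (1 - \<gamma>) \<zeta>\<^sub>x - 1/\<gamma> u u\<^sub>x + c (1 - \<gamma>) \<zeta>\<^sub>x\<^sub>x\<^sub>x = 0\<close>.
  Time derivatives at the endpoints of \<open>[0,T]\<close> are one-sided.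
\<close>

definition bfd_modes ::
  "real \<Rightarrow> real \<Rightarrow> real \<Rightarrow> real \<Rightarrow> real \<Rightarrow> real \<Rightarrow> int set \<Rightarrow>
   (real \<Rightarrow> complex) \<Rightarrow> (real \<Rightarrow> complex) \<Rightarrow>
   (real \<Rightarrow> real \<Rightarrow> complex) \<Rightarrow> (real \<Rightarrow> real \<Rightarrow> complex) \<Rightarrow> bool" where
  "bfd_modes \<gamma> a b c d T K \<zeta>\<^sub>0 u\<^sub>0 \<zeta> u \<longleftrightarrow>
     (\<forall>k\<in>K. fourier_coeff (\<zeta> 0) k = fourier_coeff \<zeta>\<^sub>0 k \<and>
            fourier_coeff (u 0) k = fourier_coeff u\<^sub>0 k) \<and>
     (\<forall>k\<in>K. \<forall>t\<in>{0..T}. let \<kappa> = 2 * pi * of_int k in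
        ((\<lambda>r. fourier_coeff (\<zeta> r) k) has_vector_derivative
           (\<i> / of_real \<gamma> * of_real (\<kappa> / (1 + b * \<kappa>\<^sup>2)) * fourier_coeff (\<lambda>x. \<zeta> t x * u t x) k
            - \<i> * of_real (\<kappa> / (1 + b * \<kappa>\<^sup>2) * bfd_symbol \<gamma> a \<kappa>) * fourier_coeff (u t) k))
          (at t within {0..T}) \<and>
        ((\<lambda>r. fourier_coeff (u r) k) has_vector_derivative
           (\<i> / (2 * of_real \<gamma>) * of_real (\<kappa> / (1 + d * \<kappa>\<^sup>2)) * fourier_coeff (\<lambda>x. (u t x)\<^sup>2) k
            - \<i> * of_real (\<kappa> * ((1 - \<gamma>) * (1 - c * \<kappa>\<^sup>2)) / (1 + d * \<kappa>\<^sup>2)) * fourier_coeff (\<zeta> t) k))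
          (at t within {0..T}))"

text \<open>The unknowns of the initial-value problem are real-valued, hence the embeddings into
  complex-valued functions.\<close>

definition bfd_solution ::
  "real \<Rightarrow> real \<Rightarrow> real \<Rightarrow> real \<Rightarrow> real \<Rightarrow> real \<Rightarrow> real \<Rightarrow>
   (real \<Rightarrow> real) \<Rightarrow> (real \<Rightarrow> real) \<Rightarrow> (real \<Rightarrow> real \<Rightarrow> real) \<Rightarrow> (real \<Rightarrow> real \<Rightarrow> real) \<Rightarrow> bool" where
  "bfd_solution \<gamma> a b c d T s \<zeta>\<^sub>0 u\<^sub>0 \<zeta> u \<longleftrightarrow>
     (\<lambda>t x. complex_of_real (\<zeta> t x)) \<in> C_sobolev T s \<and>
     (\<lambda>t x. complex_of_real (u t x)) \<in> C_sobolev T s \<and>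
     bfd_modes \<gamma> a b c d T UNIV (\<lambda>x. complex_of_real (\<zeta>\<^sub>0 x)) (\<lambda>x. complex_of_real (u\<^sub>0 x))
       (\<lambda>t x. complex_of_real (\<zeta> t x)) (\<lambda>t x. complex_of_real (u t x))"

text \<open>Uniqueness is up to equality almost everywhere in \<open>x\<close>.\<close>

definition unique_bfd_solution ::
  "real \<Rightarrow> real \<Rightarrow> real \<Rightarrow> real \<Rightarrow> real \<Rightarrow> real \<Rightarrow> real \<Rightarrow>
   (real \<Rightarrow> real) \<Rightarrow> (real \<Rightarrow> real) \<Rightarrow> (real \<Rightarrow> real \<Rightarrow> real) \<Rightarrow> (real \<Rightarrow> real \<Rightarrow> real) \<Rightarrow> bool" where
  "unique_bfd_solution \<gamma> a b c d T s \<zeta>\<^sub>0 u\<^sub>0 \<zeta> u \<longleftrightarrow>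
     bfd_solution \<gamma> a b c d T s \<zeta>\<^sub>0 u\<^sub>0 \<zeta> u \<and>
     (\<forall>\<eta> v. bfd_solution \<gamma> a b c d T s \<zeta>\<^sub>0 u\<^sub>0 \<eta> v \<longrightarrow>
        (\<forall>t\<in>{0..T}. (AE x in lborel. \<eta> t x = \<zeta> t x) \<and> (AE x in lborel. v t x = u t x)))"

text \<open>
  A solution on \<open>[0,T]\<close> of the semidiscrete system in the complex space \<open>S\<^sub>N\<close>.  For real initial
  data it is automatically real-valued, so this is not part of the definition.
\<close>

definition galerkin_solution ::
  "real \<Rightarrow> real \<Rightarrow> real \<Rightarrow> real \<Rightarrow> real \<Rightarrow> real \<Rightarrow> nat \<Rightarrow>
   (real \<Rightarrow> real) \<Rightarrow> (real \<Rightarrow> real) \<Rightarrow>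
   (real \<Rightarrow> real \<Rightarrow> complex) \<Rightarrow> (real \<Rightarrow> real \<Rightarrow> complex) \<Rightarrow> bool" where
  "galerkin_solution \<gamma> a b c d T N \<zeta>\<^sub>0 u\<^sub>0 \<zeta>\<^sub>N u\<^sub>N \<longleftrightarrow>
     (\<forall>t\<in>{0..T}. \<zeta>\<^sub>N t \<in> trig_space N \<and> u\<^sub>N t \<in> trig_space N) \<and>
     bfd_modes \<gamma> a b c d T {- int N..int N}
       (\<lambda>x. complex_of_real (\<zeta>\<^sub>0 x)) (\<lambda>x. complex_of_real (u\<^sub>0 x)) \<zeta>\<^sub>N u\<^sub>N"

end

theory Submission
  imports Defs
begin

text \<open>
  Put \<open>e = \<zeta>\<^sub>N - \<zeta>\<close> and \<open>f = u\<^sub>N - u\<close> and measure the modes \<open>|k| \<le> N\<close> of the error by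
  \<open>E = \<Sum> |e\<^sub>k|\<^sup>2 + w\<^sub>k |f\<^sub>k|\<^sup>2\<close>, where the weight \<open>w\<^sub>k\<close> is the ratio of the two symbols of the
  linear part, so that the linear part drops out of \<open>E'\<close>.  If \<open>c < 0\<close> the weight is bounded above
  and below, and both nonlinear terms gain a factor \<open>1 / (1 + |k|)\<close>, which is square summable: it
  suffices to bound the Fourier coefficients of products uniformly, that is, by the Cauchy-Schwarz
  inequality in \<open>L\<^sup>2\<close>.  If \<open>c = 0\<close> the weight grows like \<open>1 + k\<^sup>2\<close>, so \<open>E\<close> controls \<open>f\<close> in
  \<open>H\<^sup>1\<close> and hence uniformly in \<open>x\<close>, and \<open>u\<^sub>N\<^sup>2 - u\<^sup>2\<close> is estimated in \<open>L\<^sup>2\<close>.  In both cases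
  \<open>E' \<le> C (E + N\<^sup>-\<^sup>2\<^sup>\<mu>)\<close> as long as \<open>E \<le> 1\<close>, and since \<open>E = 0\<close> initially, Gronwall's inequality and
  a continuation argument give \<open>E \<le> C N\<^sup>-\<^sup>2\<^sup>\<mu>\<close> on \<open>[0,T]\<close> for large \<open>N\<close>.  The Galerkin solution
  exists on \<open>[0,T]\<close> because the estimate also holds for the system in which the unknowns are
  projected to a large ball, which has globally Lipschitz right-hand side, and shows that the
  projection is never active.
\<close>

text \<open>The hypotheses speak of Fourier coefficients, the nonlinear terms of functions. Bounds
  return from coefficients to functions because an integrable function with vanishing coefficients
  is zero almost everywhere; since \<mu> \<ge> 1 makes the coefficients absolutely summable, this
  yields both the uniform bound and Parseval's identity that the estimates use. The error is
  compared only on modes where the initial data agree exactly. The truncated remainder of the exact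
  solution enters through the products and the final L2 norm alone, with size N^(-\<mu>); the linear
  operators are diagonal in the modes and never see it, so no power of N is lost. The gain of the
  second equation counts only after multiplication with the weight. For c = 0 the growth of the
  weight consumes the summable gain, but the same growth supplies the H^1 control that replaces it;
  for c < 0 there is no such control, but the gain survives. The threshold E \<le> 1 absorbs the
  quadratic error term, bounds u_N uniformly when c = 0, and keeps the coefficients inside the ball
  of the projection.\<close>

section \<open>Characters and integration on one period\<close>

abbreviation I01 :: "real measure" where
  "I01 \<equiv> restrict_space lborel {0..1}"

definition echar :: "int \<Rightarrow> real \<Rightarrow> complex" where
  "echar k x = exp (2 * of_real pi * \<i> * of_int k * of_real x)"

lemma echar_0 [simp]: "echar 0 x = 1"
  by (simp add: echar_def)

lemma echar_at_0 [simp]: "echar k 0 = 1"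
  by (simp add: echar_def)

lemma echar_mult: "echar k x * echar l x = echar (k + l) x"
  by (simp add: echar_def exp_add [symmetric] algebra_simps)

lemma norm_echar [simp]: "norm (echar k x) = 1"
  unfolding echar_def by (simp add: norm_exp_eq_Re)

lemma cnj_echar: "cnj (echar k x) = echar (- k) x"
  by (simp add: echar_def exp_cnj)

lemma continuous_on_echar [continuous_intros]: "continuous_on S (echar k)"
  unfolding echar_def by (intro continuous_intros)

lemma borel_measurable_echar [measurable]: "echar k \<in> borel_measurable borel"
  by (intro borel_measurable_continuous_onI continuous_on_echar)

lemma space_I01 [simp]: "space I01 = {0..1}"
  by (simp add: space_restrict_space)

lemma finite_measure_I01: "finite_measure I01"
  by (rule finite_measureI) (simp add: emeasure_restrict_space)

lemma measure_I01 [simp]: "measure I01 {0..1} = 1"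
  by (simp add: measure_restrict_space)

lemma borel_measurable_I01: "f \<in> borel_measurable borel \<Longrightarrow> f \<in> borel_measurable I01"
  by (simp add: measurable_restrict_space1)

lemma measurable_echar_I01 [measurable]: "echar k \<in> borel_measurable I01"
  by (intro borel_measurable_I01 borel_measurable_echar)

lemma set_integral_I01:
  fixes f :: "real \<Rightarrow> 'a :: {banach, second_countable_topology}"
  shows "(LINT x:{0..1}|lborel. f x) = (LINT x|I01. f x)"
  by (simp add: set_lebesgue_integral_def integral_restrict_space)

lemma set_integrable_I01:
  fixes f :: "real \<Rightarrow> 'a :: {banach, second_countable_topology}"
  shows "set_integrable lborel {0..1} f \<longleftrightarrow> integrable I01 f"
  by (simp add: set_integrable_def integrable_restrict_space)

lemma fourier_coeff_eq: "fourier_coeff f k = (LINT x|I01. f x * echar (- k) x)"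
  by (simp add: fourier_coeff_def set_integral_I01 echar_def)

lemma integrable_bounded_mult_I01:
  fixes f g :: "real \<Rightarrow> complex"
  assumes "integrable I01 f" "g \<in> borel_measurable I01" "\<And>x. x \<in> {0..1} \<Longrightarrow> norm (g x) \<le> B"
  shows "integrable I01 (\<lambda>x. f x * g x)"
proof (rule Bochner_Integration.integrable_bound[of I01 "\<lambda>x. B * norm (f x)"])
  show "integrable I01 (\<lambda>x. B * norm (f x))"
    using assms(1) by simp
  show "(\<lambda>x. f x * g x) \<in> borel_measurable I01"
    using assms by measurable
  show "AE x in I01. norm (f x * g x) \<le> norm (B * norm (f x))"
  proof (rule AE_I2)
    fix x assume "x \<in> space I01"
    then have "norm (g x) \<le> B" using assms(3) by simp
    then have "norm (f x) * norm (g x) \<le> norm (f x) * \<bar>B\<bar>"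
      by (intro mult_left_mono) auto
    then show "norm (f x * g x) \<le> norm (B * norm (f x))"
      by (simp add: norm_mult abs_mult mult.commute)
  qed
qed

lemma integrable_mult_echar:
  "integrable I01 f \<Longrightarrow> integrable I01 (\<lambda>x. f x * echar k x)"
  by (rule integrable_bounded_mult_I01[of _ _ 1]) auto

lemma integral_echar: "(LINT x|I01. echar k x) = (if k = 0 then 1 else 0)"
proof (cases "k = 0")
  case True
  then show ?thesis by simp
next
  case False
  define w where "w = 2 * of_real pi * \<i> * of_int k"
  have w: "w \<noteq> 0" using False by (simp add: w_def)
  have "(LINT x|I01. echar k x) = integral\<^sup>L lborel (\<lambda>x. indicator {0..1} x *\<^sub>R echar k x)"
    by (simp add: integral_restrict_space)
  also have "\<dots> = echar k 1 / w - echar k 0 / w"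
  proof (rule integral_FTC_atLeastAtMost)
    fix x :: real
    show "((\<lambda>x. echar k x / w) has_vector_derivative echar k x) (at x within {0..1})"
      unfolding echar_def w_def[symmetric]
      using w by (auto intro!: derivative_eq_intros has_vector_derivative_real_field)
  qed (auto intro: continuous_on_echar)
  also have "echar k 1 = 1"
    unfolding echar_def by (simp add: exp_eq_1) 
  finally show ?thesis using False by simp
qed

text \<open>The interval [0,1] covers the circle once except that 0 and 1 meet, so injectivity needs
  one of the two points in the open interval.\<close>

lemma echar_1_eq_imp:
  assumes "echar 1 x = echar 1 y" "x \<in> {0<..<1}" "y \<in> {0..1}"
  shows "x = y"
proof -
  from assms(1) obtain n :: int where
    "2 * of_real pi * \<i> * of_int 1 * of_real x =
      2 * of_real pi * \<i> * of_int 1 * of_real y + (of_int (2 * n) * pi) * \<i>"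
    unfolding echar_def exp_eq by blast
  then have "2 * pi * x = 2 * pi * y + 2 * n * pi"
    by (simp add: complex_eq_iff)
  then have "pi * (x - y - n) = 0" by (simp add: algebra_simps)
  then have *: "x - y = n" by simp
  with assms have "\<bar>of_int n\<bar> < (1::real)" by auto
  then have "n = 0" by linarith
  with * show ?thesis by simp
qed

section \<open>Completeness of the trigonometric system\<close>

text \<open>The functions on the circle that act on the annihilator \<open>V\<close> of the exponentials by
  multiplication form an algebra, to which the Stone-Weierstrass theorem applies.\<close>

lemma integral_continuous_circle_eq_0:
  fixes f :: "real \<Rightarrow> complex" and g :: "complex \<Rightarrow> real"
  assumes f: "integrable I01 f" and f0: "\<And>k. fourier_coeff f k = 0"
    and g: "continuous_on (sphere 0 1) g"
  shows "(LINT x|I01. f x * of_real (g (echar 1 x))) = 0"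
proof -
  define V where "V = {\<phi>. integrable I01 \<phi> \<and> (\<forall>k. (LINT x|I01. \<phi> x * echar k x) = 0)}"
  define P where "P h \<longleftrightarrow> continuous_on (sphere 0 1) h \<and>
      (\<forall>\<phi>\<in>V. (\<lambda>x. \<phi> x * of_real (h (echar 1 x))) \<in> V)" for h :: "complex \<Rightarrow> real"
  have fV: "f \<in> V"
    unfolding V_def using f f0[of "- k" for k] by (simp add: fourier_coeff_eq)
  have meas: "(\<lambda>x. complex_of_real (h (echar 1 x))) \<in> borel_measurable I01"
    if "continuous_on (sphere 0 1) h" for h :: "complex \<Rightarrow> real"
    by (intro borel_measurable_I01 borel_measurable_continuous_onI continuous_on_of_real
        continuous_on_compose2[OF that] continuous_on_echar) auto
  have V_add: "(\<lambda>x. \<phi> x + \<psi> x) \<in> V" if "\<phi> \<in> V" "\<psi> \<in> V" for \<phi> \<psi>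
    using that integrable_mult_echar[of \<phi>] integrable_mult_echar[of \<psi>]
    unfolding V_def by (auto simp: distrib_right)
  have V_cmult: "(\<lambda>x. \<phi> x * c) \<in> V" if "\<phi> \<in> V" for \<phi> c
  proof -
    have "(LINT x|I01. \<phi> x * c * echar k x) = (LINT x|I01. \<phi> x * echar k x) * c" for k
      by (subst integral_mult_left_zero[symmetric]) (simp add: mult_ac)
    then show ?thesis using that unfolding V_def by auto
  qed
  have V_echar: "(\<lambda>x. \<phi> x * echar l x) \<in> V" if "\<phi> \<in> V" for \<phi> l
    using that integrable_mult_echar[of \<phi>] unfolding V_def by (auto simp: mult.assoc echar_mult)
  have P_const: "P (\<lambda>x. c)" for c
    unfolding P_def using V_cmult by auto
  have P_add: "P (\<lambda>x. h1 x + h2 x)" if "P h1 \<and> P h2" for h1 h2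
    using that unfolding P_def by (auto intro!: continuous_intros V_add simp: distrib_left)
  have P_mult: "P (\<lambda>x. h1 x * h2 x)" if "P h1 \<and> P h2" for h1 h2
    unfolding P_def
  proof (intro conjI ballI)
    show "continuous_on (sphere 0 1) (\<lambda>x. h1 x * h2 x)"
      using that by (auto simp: P_def intro!: continuous_intros)
    fix \<phi> assume "\<phi> \<in> V"
    then have "(\<lambda>x. \<phi> x * of_real (h1 (echar 1 x))) \<in> V"
      using that by (simp add: P_def)
    then have "(\<lambda>x. (\<phi> x * of_real (h1 (echar 1 x))) * of_real (h2 (echar 1 x))) \<in> V"
      using that by (simp add: P_def)
    then show "(\<lambda>x. \<phi> x * of_real (h1 (echar 1 x) * h2 (echar 1 x))) \<in> V"
      by (simp add: mult.assoc)
  qed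
  have P_Re: "P Re"
    unfolding P_def
  proof (intro conjI ballI)
    fix \<phi> assume "\<phi> \<in> V"
    then have "(\<lambda>x. \<phi> x * echar 1 x * (1/2) + \<phi> x * echar (-1) x * (1/2)) \<in> V"
      by (intro V_add V_cmult V_echar)
    moreover have "complex_of_real (Re (echar 1 x)) = echar 1 x * (1/2) + echar (-1) x * (1/2)" for x
      by (simp add: cnj_echar[symmetric] complex_eq_iff)
    ultimately show "(\<lambda>x. \<phi> x * of_real (Re (echar 1 x))) \<in> V"
      by (simp add: distrib_left mult.assoc)
  qed (intro continuous_intros)
  have P_Im: "P Im"
    unfolding P_def
  proof (intro conjI ballI)
    fix \<phi> assume "\<phi> \<in> V"
    then have "(\<lambda>x. \<phi> x * echar 1 x * (-\<i>/2) + \<phi> x * echar (-1) x * (\<i>/2)) \<in> V"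
      by (intro V_add V_cmult V_echar)
    moreover have "\<phi> x * complex_of_real (Im (echar 1 x)) =
        \<phi> x * echar 1 x * (-\<i>/2) + \<phi> x * echar (-1) x * (\<i>/2)" for x
      by (simp add: cnj_echar[symmetric] complex_eq_iff field_simps)
    ultimately show "(\<lambda>x. \<phi> x * of_real (Im (echar 1 x))) \<in> V"
      by simp
  qed (intro continuous_intros)
  have int: "integrable I01 (\<lambda>x. f x * of_real (h (echar 1 x)))"
    if h: "continuous_on (sphere 0 1) h" for h
  proof -
    have "compact (h ` sphere 0 1)" using h by (intro compact_continuous_image) auto
    then obtain B where "\<And>z. z \<in> sphere 0 1 \<Longrightarrow> \<bar>h z\<bar> \<le> B"
      using compact_imp_bounded bounded_iff by (metis imageI real_norm_def)
    then show ?thesis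
      by (intro integrable_bounded_mult_I01[OF f meas[OF h], of B]) auto
  qed
  define J where "J = (LINT x|I01. norm (f x))"
  have J: "J \<ge> 0" unfolding J_def by simp
  have "norm (LINT x|I01. f x * of_real (g (echar 1 x))) \<le> 0 + e" if e: "e > 0" for e
  proof -
    \<comment> \<open>The added 1 keeps the quotient meaningful when f vanishes, and
      \<open>e' * J\<close> still stays below \<open>e\<close>.\<close>
    define e' where "e' = e / (J + 1)"
    have e': "e' > 0" using e J by (simp add: e'_def)
    obtain h where h: "P h" "\<And>z. z \<in> sphere 0 1 \<Longrightarrow> \<bar>g z - h z\<bar> < e'"
    proof -
      have "\<exists>h. P h \<and> (\<forall>x\<in>sphere 0 1. \<bar>g x - h x\<bar> < e')"
      proof (rule Stone_Weierstrass_HOL[where P = P])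
        show "compact (sphere (0::complex) 1)" by simp
        show "P (\<lambda>x. c)" for c by (rule P_const)
        show "P h \<Longrightarrow> continuous_on (sphere 0 1) h" for h by (simp add: P_def)
        show "P h1 \<and> P h2 \<Longrightarrow> P (\<lambda>x. h1 x + h2 x)" for h1 h2 by (rule P_add)
        show "P h1 \<and> P h2 \<Longrightarrow> P (\<lambda>x. h1 x * h2 x)" for h1 h2 by (rule P_mult)
        show "x \<in> sphere 0 1 \<and> y \<in> sphere 0 1 \<and> x \<noteq> y \<Longrightarrow> \<exists>h. P h \<and> h x \<noteq> h y" for x y
          using P_Re P_Im by (meson complex_eq_iff)
      qed (use g e' in auto)
      then show ?thesis using that by blast
    qed
    have hc: "continuous_on (sphere 0 1) h" using h(1) by (simp add: P_def)
    have "(\<lambda>x. f x * of_real (h (echar 1 x))) \<in> V"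
      using h(1) fV by (auto simp: P_def)
    \<comment> \<open>Membership in \<open>V\<close>, tested against the constant character.\<close>
    then have "(LINT x|I01. f x * of_real (h (echar 1 x)) * echar 0 x) = 0"
      unfolding V_def by blast
    then have "(LINT x|I01. f x * of_real (g (echar 1 x))) =
      (LINT x|I01. f x * of_real (g (echar 1 x)) - f x * of_real (h (echar 1 x)))"
      by (subst Bochner_Integration.integral_diff) (auto intro!: int g hc)
    also have "norm \<dots> \<le> (LINT x|I01. e' * norm (f x))"
    proof (rule Bochner_Integration.integral_norm_bound_integral)
      show "integrable I01 (\<lambda>x. f x * of_real (g (echar 1 x)) - f x * of_real (h (echar 1 x)))"
        by (intro Bochner_Integration.integrable_diff int g hc)
      show "integrable I01 (\<lambda>x. e' * norm (f x))" using f by simp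
      fix x
      have "\<bar>g (echar 1 x) - h (echar 1 x)\<bar> \<le> e'"
        using h(2)[of "echar 1 x"] by simp
      then have "norm (f x) * norm (complex_of_real (g (echar 1 x) - h (echar 1 x))) \<le> norm (f x) * e'"
        by (intro mult_left_mono) (simp_all del: of_real_diff)
      then show "norm (f x * of_real (g (echar 1 x)) - f x * of_real (h (echar 1 x))) \<le> e' * norm (f x)"
        by (simp add: norm_mult[symmetric] algebra_simps)
    qed
    also have "\<dots> = e' * J" by (simp add: J_def)
    also have "\<dots> \<le> e" using e J by (simp add: e'_def field_simps)
    finally show ?thesis by simp
  qed
  then have "norm (LINT x|I01. f x * of_real (g (echar 1 x))) \<le> 0"
    by (rule field_le_epsilon)
  then show ?thesis by simp
qed

text \<open>Inside the open interval the set corresponds to an open part of the circle. Its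
  indicator is the pointwise limit of the continuous functions min(1, n dist(z, K)), with
  \<open>K\<close> the image of the complement, and dominated convergence carries the vanishing
  integrals over.\<close>

lemma set_integral_open_eq_0:
  fixes f :: "real \<Rightarrow> complex"
  assumes f: "integrable I01 f" and f0: "\<And>k. fourier_coeff f k = 0" and U: "open U"
  shows "(LINT x|I01. indicator (U \<inter> {0<..<1}) x *\<^sub>R f x) = 0"
proof -
  define W where "W = U \<inter> {0<..<1::real}"
  have W: "open W" using U by (auto simp: W_def)
  define K where "K = echar 1 ` ({0..1} - W)"
  have K: "compact K"
    unfolding K_def using W by (intro compact_continuous_image continuous_on_echar compact_diff) auto
  \<comment> \<open>\<open>infdist\<close> to the empty set is 0 by convention, so \<open>K\<close>
    must be nonempty; the removed end point guarantees this.\<close>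
  have "0 \<in> {0..1} - W" by (auto simp: W_def)
  then have K0: "K \<noteq> {}" unfolding K_def by blast
  have mem: "echar 1 x \<in> K \<longleftrightarrow> x \<notin> W" if "x \<in> {0..1}" for x
  proof
    assume "echar 1 x \<in> K"
    then obtain y where y: "echar 1 x = echar 1 y" "y \<in> {0..1} - W" unfolding K_def by auto
    show "x \<notin> W"
    proof
      assume "x \<in> W"
      then have "x = y" using echar_1_eq_imp[OF y(1)] y(2) by (auto simp: W_def)
      with \<open>x \<in> W\<close> y show False by auto
    qed
  qed (use that in \<open>auto simp: K_def\<close>)
  define g where "g n z = min 1 (real n * infdist z K)" for n :: nat and z
  have gc: "continuous_on S (g n)" for n S
    unfolding g_def by (intro continuous_intros)
  have gm: "(\<lambda>x. complex_of_real (g n (echar 1 x))) \<in> borel_measurable I01" for n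
    by (intro borel_measurable_I01 borel_measurable_continuous_onI continuous_on_of_real
        continuous_on_compose2[OF gc[of UNIV]] continuous_on_echar) auto
  have "(\<lambda>n. LINT x|I01. f x * of_real (g n (echar 1 x))) \<longlonglongrightarrow> (LINT x|I01. indicator W x *\<^sub>R f x)"
  proof (rule integral_dominated_convergence[where w = "\<lambda>x. norm (f x)"])
    have "indicator W \<in> borel_measurable I01"
      using W by (intro borel_measurable_I01) auto
    then show "(\<lambda>x. indicator W x *\<^sub>R f x) \<in> borel_measurable I01"
      using f by measurable
    show "(\<lambda>x. f x * of_real (g n (echar 1 x))) \<in> borel_measurable I01" for n
      using f gm by measurable
    show "integrable I01 (\<lambda>x. norm (f x))" using f by simp
    show "AE x in I01. (\<lambda>n. f x * of_real (g n (echar 1 x))) \<longlonglongrightarrow> indicator W x *\<^sub>R f x"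
    proof (rule AE_I2)
      fix x assume "x \<in> space I01"
      then have x: "x \<in> {0..1}" by simp
      have "(\<lambda>n. g n (echar 1 x)) \<longlonglongrightarrow> indicator W x"
      proof (cases "x \<in> W")
        case False
        then have "infdist (echar 1 x) K = 0" using mem[OF x] by simp
        then show ?thesis using False by (simp add: g_def)
      next
        case True
        then have "echar 1 x \<notin> K" using mem[OF x] by simp
        then have pos: "infdist (echar 1 x) K > 0"
          using infdist_pos_not_in_closed K K0 compact_imp_closed by blast
        have "eventually (\<lambda>n. g n (echar 1 x) = 1) sequentially"
        proof (rule eventually_sequentiallyI)
          fix n assume "n \<ge> nat \<lceil>1 / infdist (echar 1 x) K\<rceil>"
          then have "1 / infdist (echar 1 x) K \<le> real n" by linarith
          then show "g n (echar 1 x) = 1" using pos by (simp add: g_def field_simps)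
        qed
        then show ?thesis using True by (simp add: tendsto_eventually)
      qed
      then have "(\<lambda>n. f x * of_real (g n (echar 1 x))) \<longlonglongrightarrow> f x * of_real (indicator W x)"
        by (intro tendsto_intros)
      then show "(\<lambda>n. f x * of_real (g n (echar 1 x))) \<longlonglongrightarrow> indicator W x *\<^sub>R f x"
        by (simp add: scaleR_conv_of_real mult.commute)
    qed
    show "AE x in I01. norm (f x * of_real (g n (echar 1 x))) \<le> norm (f x)" for n
      by (rule AE_I2) (auto simp: g_def norm_mult infdist_nonneg intro!: mult_left_le)
  qed
  moreover have "(LINT x|I01. f x * of_real (g n (echar 1 x))) = 0" for n
    by (intro integral_continuous_circle_eq_0 f f0 gc)
  ultimately have "(\<lambda>n::nat. 0) \<longlonglongrightarrow> (LINT x|I01. indicator W x *\<^sub>R f x)" by simp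
  then show ?thesis unfolding W_def using LIMSEQ_const_iff by metis
qed

text \<open>Dynkin's argument: the Borel sets over which f integrates to 0 are closed under
  complements and countable disjoint unions and contain the open sets, an intersection-stable
  generator. An integrable density whose integral vanishes over every measurable set is zero almost
  everywhere.\<close>

lemma AE_0_if_fourier_coeff_0:
  fixes f :: "real \<Rightarrow> complex"
  assumes f: "integrable I01 f" and f0: "\<And>k. fourier_coeff f k = 0"
  shows "AE x in I01. f x = 0"
proof -
  define P where "P A \<longleftrightarrow> (LINT x|I01. indicator A x *\<^sub>R f x) = 0" for A :: "real set"
  have ends: "AE x in I01. x \<in> {0<..<1::real}"
  proof -
    have "AE x in lborel. x \<noteq> (0::real) \<and> x \<noteq> 1"
      using AE_lborel_singleton[of "0::real"] AE_lborel_singleton[of "1::real"] by eventually_elim simp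
    then have "AE x in lborel. x \<in> {0..1} \<longrightarrow> x \<in> {0<..<1::real}"
      by eventually_elim auto
    then show ?thesis by (subst AE_restrict_space_iff) auto
  qed
  have bm: "A \<in> sets borel \<Longrightarrow> indicator A \<in> borel_measurable I01" for A :: "real set"
    by (intro borel_measurable_I01) auto
  have ind: "integrable I01 (\<lambda>x. indicator A x *\<^sub>R f x)" if "A \<in> sets borel" for A :: "real set"
    using f bm[OF that] by (intro Bochner_Integration.integrable_bound[OF f])
      (auto split: split_indicator intro!: borel_measurable_scaleR)
  have P_borel: "P A" if "A \<in> sets borel" for A
  proof -
    have "Int_stable {S :: real set. open S}" by (auto simp: Int_stable_def)
    moreover have "{S :: real set. open S} \<subseteq> Pow UNIV" by simp
    moreover have "A \<in> sigma_sets UNIV {S. open S}"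
      using that by (simp add: borel_def)
    ultimately show ?thesis
    proof (induction A rule: sigma_sets_induct_disjoint)
      case (basic A)
      then have "open A" by simp
      have "(LINT x|I01. indicator A x *\<^sub>R f x) = (LINT x|I01. indicator (A \<inter> {0<..<1}) x *\<^sub>R f x)"
      proof (rule integral_cong_AE)
        show "(\<lambda>x. indicator A x *\<^sub>R f x) \<in> borel_measurable I01"
          "(\<lambda>x. indicator (A \<inter> {0<..<1}) x *\<^sub>R f x) \<in> borel_measurable I01"
          using \<open>open A\<close> f bm[of A] bm[of "A \<inter> {0<..<1}"] by (auto intro!: borel_measurable_scaleR)
        show "AE x in I01. indicator A x *\<^sub>R f x = indicator (A \<inter> {0<..<1}) x *\<^sub>R f x"
          using ends by eventually_elim (auto simp: indicator_def)
      qed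
      then show ?case
        unfolding P_def using set_integral_open_eq_0[OF f f0 \<open>open A\<close>] by simp
    next
      case empty then show ?case by (simp add: P_def)
    next
      case (compl A)
      then have A: "A \<in> sets borel" by (simp add: borel_def)
      have iA: "integrable I01 (\<lambda>x. indicator A x *\<^sub>R f x)"
        by (rule ind[OF A])
      have "(LINT x|I01. indicator (UNIV - A) x *\<^sub>R f x) = (LINT x|I01. f x - indicator A x *\<^sub>R f x)"
        by (intro Bochner_Integration.integral_cong) (auto simp: indicator_def)
      also have "\<dots> = (LINT x|I01. f x) - (LINT x|I01. indicator A x *\<^sub>R f x)"
        using f iA by (intro Bochner_Integration.integral_diff)
      \<comment> \<open>The complement step needs the total integral, which is the coefficient at
        0.\<close>
      also have "(LINT x|I01. f x) = 0" using f0[of 0] by (simp add: fourier_coeff_eq)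
      finally show ?case using compl by (simp add: P_def)
    next
      case (union A)
      then have A: "\<And>i. A i \<in> sets borel" by (auto simp: borel_def)
      have iA: "integrable I01 (\<lambda>x. indicator (\<Union>i. A i) x *\<^sub>R f x)"
        using A by (intro ind) auto
      \<comment> \<open>Countable additivity is applied in the restricted space, whose measurable
        sets lie in [0,1].\<close>
      define B where "B i = A i \<inter> {0..1}" for i
      have B: "B i \<in> sets I01" for i
        using A by (auto simp: B_def sets_restrict_space Int_commute)
      have "set_lebesgue_integral I01 (\<Union>i. B i) f = (\<Sum>i. set_lebesgue_integral I01 (B i) f)"
      proof (rule lebesgue_integral_countable_add)
        show "\<And>i. B i \<in> sets I01" by (rule B)
        show "\<And>i j. i \<noteq> j \<Longrightarrow> B i \<inter> B j = {}"
          using union(1) by (auto simp: disjoint_family_on_def B_def)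
        show "set_integrable I01 (\<Union>i. B i) f"
          unfolding set_integrable_def using B
          by (intro integrable_mult_indicator f) auto
      qed
      moreover have "set_lebesgue_integral I01 (B i) f = 0" for i
      proof -
        have "set_lebesgue_integral I01 (B i) f = (LINT x|I01. indicator (A i) x *\<^sub>R f x)"
          unfolding set_lebesgue_integral_def
          by (intro Bochner_Integration.integral_cong) (auto simp: B_def indicator_def)
        then show ?thesis using union(3)[of i] by (simp add: P_def)
      qed
      moreover have "set_lebesgue_integral I01 (\<Union>i. B i) f = (LINT x|I01. indicator (\<Union>i. A i) x *\<^sub>R f x)"
        unfolding set_lebesgue_integral_def
        by (intro Bochner_Integration.integral_cong) (auto simp: B_def indicator_def)
      ultimately show ?case by (simp add: P_def)
    qed
  qed
  have "set_lebesgue_integral I01 A f = 0" if "A \<in> sets I01" for A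
  proof -
    from that obtain A' where A': "A' \<in> sets borel" "A = {0..1} \<inter> A'"
      by (auto simp: sets_restrict_space)
    have "set_lebesgue_integral I01 A f = (LINT x|I01. indicator A' x *\<^sub>R f x)"
      unfolding set_lebesgue_integral_def A'(2)
      by (intro Bochner_Integration.integral_cong) (auto simp: indicator_def)
    then show ?thesis using P_borel[OF A'(1)] by (simp add: P_def)
  qed
  then show ?thesis
    using sigma_finite_measure.density_zero[OF finite_measure.axioms(1)[OF finite_measure_I01] f] by blast
qed

section \<open>Square-integrable functions on the unit interval\<close>

definition square_integrable :: "(real \<Rightarrow> complex) \<Rightarrow> bool" where
  "square_integrable f \<longleftrightarrow> f \<in> borel_measurable I01 \<and> integrable I01 (\<lambda>x. (cmod (f x))\<^sup>2)"

lemma square_integrable_measurable [measurable_dest]: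
  "square_integrable f \<Longrightarrow> f \<in> borel_measurable I01"
  by (simp add: square_integrable_def)

lemma L2_norm_eq: "L2_norm f = sqrt (LINT x|I01. (cmod (f x))\<^sup>2)"
  by (simp add: L2_norm_def set_integral_I01)

lemma L2_norm_nonneg: "L2_norm f \<ge> 0"
  by (simp add: L2_norm_eq)

lemma L2_norm_power2: "(L2_norm f)\<^sup>2 = (LINT x|I01. (cmod (f x))\<^sup>2)"
  by (simp add: L2_norm_eq)

lemma square_integrable_bound:
  assumes "f \<in> borel_measurable I01" "integrable I01 h" "AE x in I01. (cmod (f x))\<^sup>2 \<le> h x"
  shows "square_integrable f"
  unfolding square_integrable_def
proof
  show "integrable I01 (\<lambda>x. (cmod (f x))\<^sup>2)"
  proof (rule Bochner_Integration.integrable_bound[OF assms(2)])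
    show "AE x in I01. norm ((cmod (f x))\<^sup>2) \<le> norm (h x)"
      using assms(3) by eventually_elim auto
  qed (use assms(1) in measurable)
qed (rule assms(1))

lemma square_integrable_bounded:
  assumes "f \<in> borel_measurable I01" "AE x in I01. cmod (f x) \<le> B"
  shows "square_integrable f"
proof (rule square_integrable_bound[OF assms(1), of "\<lambda>x. B\<^sup>2"])
  show "integrable I01 (\<lambda>x. B\<^sup>2)"
    using finite_measure.integrable_const[OF finite_measure_I01] by blast
  show "AE x in I01. (cmod (f x))\<^sup>2 \<le> B\<^sup>2"
    using assms(2) by eventually_elim (auto intro: power_mono)
qed

lemma square_integrable_bounded_mult:
  assumes "square_integrable f" "g \<in> borel_measurable I01" "AE x in I01. cmod (g x) \<le> B"
  shows "square_integrable (\<lambda>x. f x * g x)"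
proof (rule square_integrable_bound[of _ "\<lambda>x. B\<^sup>2 * (cmod (f x))\<^sup>2"])
  show "(\<lambda>x. f x * g x) \<in> borel_measurable I01" using assms by measurable
  show "integrable I01 (\<lambda>x. B\<^sup>2 * (cmod (f x))\<^sup>2)"
    using assms(1) by (simp add: square_integrable_def)
  show "AE x in I01. (cmod (f x * g x))\<^sup>2 \<le> B\<^sup>2 * (cmod (f x))\<^sup>2"
    using assms(3)
  proof eventually_elim
    case (elim x)
    then have "(cmod (g x))\<^sup>2 \<le> B\<^sup>2" by (intro power_mono) auto
    then have "(cmod (g x))\<^sup>2 * (cmod (f x))\<^sup>2 \<le> B\<^sup>2 * (cmod (f x))\<^sup>2"
      by (rule mult_right_mono) simp
    then show ?case by (simp add: norm_mult power_mult_distrib mult.commute)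
  qed
qed

lemma square_integrable_add:
  assumes "square_integrable f" "square_integrable g"
  shows "square_integrable (\<lambda>x. f x + g x)"
proof (rule square_integrable_bound[of _ "\<lambda>x. 2 * (cmod (f x))\<^sup>2 + 2 * (cmod (g x))\<^sup>2"])
  show "(\<lambda>x. f x + g x) \<in> borel_measurable I01" using assms by measurable
  show "integrable I01 (\<lambda>x. 2 * (cmod (f x))\<^sup>2 + 2 * (cmod (g x))\<^sup>2)"
    using assms by (simp add: square_integrable_def)
  show "AE x in I01. (cmod (f x + g x))\<^sup>2 \<le> 2 * (cmod (f x))\<^sup>2 + 2 * (cmod (g x))\<^sup>2"
  proof (rule AE_I2)
    fix x
    have "(cmod (f x + g x))\<^sup>2 \<le> (cmod (f x) + cmod (g x))\<^sup>2"
      by (intro power_mono norm_triangle_ineq) simp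
    also have "\<dots> \<le> 2 * (cmod (f x))\<^sup>2 + 2 * (cmod (g x))\<^sup>2"
      using sum_squares_bound[of "cmod (f x)" "cmod (g x)"] by (simp add: power2_sum)
    finally show "(cmod (f x + g x))\<^sup>2 \<le> 2 * (cmod (f x))\<^sup>2 + 2 * (cmod (g x))\<^sup>2" .
  qed
qed

lemma square_integrable_cmult:
  assumes "square_integrable f"
  shows "square_integrable (\<lambda>x. c * f x)"
  using square_integrable_bounded_mult[OF assms, of "\<lambda>x. c" "cmod c"] by (simp add: mult.commute)

lemma square_integrable_diff:
  assumes "square_integrable f" "square_integrable g"
  shows "square_integrable (\<lambda>x. f x - g x)"
  using square_integrable_add[OF assms(1) square_integrable_cmult[OF assms(2), of "-1"]] by simp

lemma integrable_mult_square_integrable: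
  assumes "square_integrable f" "square_integrable g"
  shows "integrable I01 (\<lambda>x. f x * g x)"
proof (rule Bochner_Integration.integrable_bound)
  show "integrable I01 (\<lambda>x. (cmod (f x))\<^sup>2 + (cmod (g x))\<^sup>2)"
    using assms by (simp add: square_integrable_def)
  show "(\<lambda>x. f x * g x) \<in> borel_measurable I01" using assms by measurable
  show "AE x in I01. norm (f x * g x) \<le> norm ((cmod (f x))\<^sup>2 + (cmod (g x))\<^sup>2)"
  proof (rule AE_I2)
    fix x
    show "norm (f x * g x) \<le> norm ((cmod (f x))\<^sup>2 + (cmod (g x))\<^sup>2)"
      using sum_squares_bound[of "cmod (f x)" "cmod (g x)"]
        zero_le_power2[of "cmod (f x)"] zero_le_power2[of "cmod (g x)"]
        mult_nonneg_nonneg[of "cmod (f x)" "cmod (g x)"]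
      unfolding norm_mult real_norm_def by linarith
  qed
qed

lemma square_integrable_integrable:
  assumes "square_integrable f"
  shows "integrable I01 f"
  using integrable_mult_square_integrable[OF assms square_integrable_bounded[of "\<lambda>x. 1" 1]] by simp

text \<open>Integrating 0 \<le> (r |f| - |g|)^2 gives a quadratic inequality in r, for which r = X /
  P^2 is the optimal choice.\<close>

lemma integral_mult_le_L2_norm:
  assumes f: "square_integrable f" and g: "square_integrable g"
  shows "(LINT x|I01. cmod (f x * g x)) \<le> L2_norm f * L2_norm g"
proof -
  define X where "X = (LINT x|I01. cmod (f x * g x))"
  define P where "P = L2_norm f" define Q where "Q = L2_norm g"
  have X: "X \<ge> 0" by (simp add: X_def)
  have P: "P \<ge> 0" and Q: "Q \<ge> 0" by (simp_all add: P_def Q_def L2_norm_nonneg)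
  have iX: "integrable I01 (\<lambda>x. cmod (f x * g x))"
    using integrable_mult_square_integrable[OF f g] by simp
  have *: "2 * r * X \<le> r\<^sup>2 * P\<^sup>2 + Q\<^sup>2" for r
  proof -
    have "2 * r * X = (LINT x|I01. 2 * r * cmod (f x * g x))"
      unfolding X_def by simp
    also have "\<dots> \<le> (LINT x|I01. r\<^sup>2 * (cmod (f x))\<^sup>2 + (cmod (g x))\<^sup>2)"
    proof (rule integral_mono)
      show "integrable I01 (\<lambda>x. 2 * r * cmod (f x * g x))" using iX by simp
      show "integrable I01 (\<lambda>x. r\<^sup>2 * (cmod (f x))\<^sup>2 + (cmod (g x))\<^sup>2)"
        using f g by (simp add: square_integrable_def)
      show "2 * r * cmod (f x * g x) \<le> r\<^sup>2 * (cmod (f x))\<^sup>2 + (cmod (g x))\<^sup>2" for x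
        using sum_squares_bound[of "r * cmod (f x)" "cmod (g x)"]
        by (simp add: norm_mult power_mult_distrib mult_ac)
    qed
    also have "\<dots> = r\<^sup>2 * P\<^sup>2 + Q\<^sup>2"
      using f g by (simp add: square_integrable_def P_def Q_def L2_norm_power2)
    finally show ?thesis .
  qed
  show ?thesis
  proof (cases "P = 0")
    case True
    have "X = 0"
    proof (rule ccontr)
      assume "X \<noteq> 0"
      \<comment> \<open>For \<open>P = 0\<close> the inequality reads 2 r X \<le> Q^2 for every r;
        this r makes the left side too large.\<close>
      then have "2 * ((Q\<^sup>2 + 1) / (2 * X)) * X = Q\<^sup>2 + 1" by simp
      then show False using *[of "(Q\<^sup>2 + 1) / (2 * X)"] True by simp
    qed
    then show ?thesis using True by (simp add: X_def P_def)
  next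
    case False
    then have "P > 0" using P by simp
    with *[of "X / P\<^sup>2"] have "X\<^sup>2 \<le> P\<^sup>2 * Q\<^sup>2"
      by (simp add: field_simps power2_eq_square)
    then have "X\<^sup>2 \<le> (P * Q)\<^sup>2" by (simp add: power_mult_distrib)
    then have "X \<le> P * Q" using P Q by (rule_tac power2_le_imp_le) auto
    then show ?thesis by (simp add: X_def P_def Q_def)
  qed
qed

lemma norm_fourier_coeff_le:
  assumes "integrable I01 f"
  shows "cmod (fourier_coeff f k) \<le> (LINT x|I01. cmod (f x))"
proof -
  have "cmod (fourier_coeff f k) \<le> (LINT x|I01. cmod (f x * echar (- k) x))"
    unfolding fourier_coeff_eq by (rule integral_norm_bound)
  then show ?thesis by (simp add: norm_mult)
qed

lemma fourier_coeff_diff: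
  assumes "integrable I01 f" "integrable I01 g"
  shows "fourier_coeff (\<lambda>x. f x - g x) k = fourier_coeff f k - fourier_coeff g k"
  unfolding fourier_coeff_eq left_diff_distrib
  by (intro Bochner_Integration.integral_diff integrable_mult_echar assms)

section \<open>Trigonometric polynomials and Fourier series\<close>

text \<open>The index set is arbitrary so that the difference of two partial sums is again of this
  form.\<close>

definition trig_poly :: "int set \<Rightarrow> (int \<Rightarrow> complex) \<Rightarrow> real \<Rightarrow> complex" where
  "trig_poly K c x = (\<Sum>k\<in>K. c k * echar k x)"

lemma trig_space_iff: "f \<in> trig_space N \<longleftrightarrow> (\<exists>c. f = trig_poly {- int N..int N} c)"
  by (simp add: trig_space_def trig_poly_def[abs_def] echar_def)

lemma norm_trig_poly_le: "cmod (trig_poly K c x) \<le> (\<Sum>k\<in>K. cmod (c k))"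
  unfolding trig_poly_def by (rule order_trans[OF norm_sum]) (simp add: norm_mult)

lemma measurable_trig_poly [measurable]: "trig_poly K c \<in> borel_measurable I01"
  unfolding trig_poly_def[abs_def] by measurable

lemma square_integrable_trig_poly: "square_integrable (trig_poly K c)"
  by (rule square_integrable_bounded[OF measurable_trig_poly]) (use norm_trig_poly_le in blast)

lemma fourier_coeff_trig_poly:
  assumes "finite K"
  shows "fourier_coeff (trig_poly K c) k = (if k \<in> K then c k else 0)"
proof -
  have "fourier_coeff (trig_poly K c) k = (LINT x|I01. (\<Sum>l\<in>K. c l * echar (l - k) x))"
    unfolding fourier_coeff_eq trig_poly_def sum_distrib_right
    by (simp add: mult.assoc echar_mult)
  also have "\<dots> = (\<Sum>l\<in>K. (LINT x|I01. c l * echar (l - k) x))"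
  proof (rule Bochner_Integration.integral_sum)
    fix l
    have "integrable I01 (\<lambda>x. (c l) * echar (l - k) x)"
      by (rule integrable_mult_echar) (rule finite_measure.integrable_const[OF finite_measure_I01])
    then show "integrable I01 (\<lambda>x. c l * echar (l - k) x)" .
  qed
  also have "\<dots> = (\<Sum>l\<in>K. if l = k then c l else 0)"
    by (intro sum.cong refl) (simp add: integral_echar)
  also have "\<dots> = (if k \<in> K then c k else 0)"
    using assms by (simp add: sum.delta)
  finally show ?thesis .
qed

lemma integral_mult_cnj_trig_poly:
  assumes f: "integrable I01 f"
  shows "(LINT x|I01. f x * cnj (trig_poly K c x)) = (\<Sum>k\<in>K. fourier_coeff f k * cnj (c k))"
proof -
  have "(LINT x|I01. f x * cnj (trig_poly K c x)) =
      (LINT x|I01. (\<Sum>k\<in>K. (f x * echar (- k) x) * cnj (c k)))"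
    unfolding trig_poly_def by (simp add: sum_distrib_left cnj_echar mult_ac)
  also have "\<dots> = (\<Sum>k\<in>K. (LINT x|I01. (f x * echar (- k) x) * cnj (c k)))"
    by (intro Bochner_Integration.integral_sum integrable_mult_left integrable_mult_echar f)
  also have "\<dots> = (\<Sum>k\<in>K. fourier_coeff f k * cnj (c k))"
    by (simp add: fourier_coeff_eq)
  finally show ?thesis .
qed

lemma trig_poly_cong:
  "(\<And>k. k \<in> I \<Longrightarrow> c k = d k) \<Longrightarrow> trig_poly I c = trig_poly I d"
  by (auto simp: trig_poly_def[abs_def] fun_eq_iff intro!: sum.cong)

text \<open>Exhibits the quadratic terms of the truncated system as polynomials in the unknown
  coefficients, the form from which Lipschitz bounds are read off.\<close>

lemma fourier_coeff_mult_trig_poly: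
  assumes "finite I"
  shows "fourier_coeff (\<lambda>x. trig_poly I c x * trig_poly I d x) k =
    (\<Sum>i\<in>I. \<Sum>j\<in>I. if i + j = k then c i * d j else 0)"
proof -
  have int: "integrable I01 (\<lambda>x. C * echar l x)" for C l
    by (rule integrable_mult_echar) (rule finite_measure.integrable_const[OF finite_measure_I01])
  have eq: "trig_poly I c x * trig_poly I d x * echar (- k) x =
      (\<Sum>i\<in>I. \<Sum>j\<in>I. (c i * d j) * echar (i + j - k) x)" for x
  proof -
    have "echar (i + j - k) x = echar i x * echar j x * echar (- k) x" for i j
      by (simp add: echar_mult)
    then show ?thesis
      unfolding trig_poly_def sum_product
      by (subst sum_distrib_right, intro sum.cong refl, subst sum_distrib_right) (simp add: mult_ac)
  qed
  have "fourier_coeff (\<lambda>x. trig_poly I c x * trig_poly I d x) k =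
      (\<Sum>i\<in>I. \<Sum>j\<in>I. LINT x|I01. (c i * d j) * echar (i + j - k) x)"
    unfolding fourier_coeff_eq eq
    by (subst Bochner_Integration.integral_sum; (intro sum.cong refl Bochner_Integration.integral_sum)?)
      (auto intro!: Bochner_Integration.integrable_sum int)
  also have "\<dots> = (\<Sum>i\<in>I. \<Sum>j\<in>I. if i + j = k then c i * d j else 0)"
    by (intro sum.cong refl) (simp add: integral_echar)
  finally show ?thesis .
qed

text \<open>When the square is expanded, the mixed term and the square of the polynomial both
  integrate to the sum of |f_k|^2, by orthogonality. Nonnegativity of the left side is Bessel's
  inequality; its convergence to 0 for growing \<open>K\<close> is Parseval's identity.\<close>

lemma integral_diff_trig_poly:
  assumes f: "square_integrable f" and K: "finite K"
  shows "(LINT x|I01. (cmod (f x - trig_poly K (fourier_coeff f) x))\<^sup>2) =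
    (LINT x|I01. (cmod (f x))\<^sup>2) - (\<Sum>k\<in>K. (cmod (fourier_coeff f k))\<^sup>2)"
proof -
  define P where "P = trig_poly K (fourier_coeff f)"
  have P: "square_integrable P" by (simp add: P_def square_integrable_trig_poly)
  have cP: "square_integrable (\<lambda>x. cnj (P x))"
    using P unfolding square_integrable_def by (auto intro: measurable_compose[OF _ borel_measurable_continuous_onI[OF continuous_on_cnj[OF continuous_on_id]]])
  have d: "square_integrable (\<lambda>x. f x - P x)" by (rule square_integrable_diff[OF f P])
  have R: "(LINT x|I01. f x * cnj (P x)) = of_real (\<Sum>k\<in>K. (cmod (fourier_coeff f k))\<^sup>2)"
    unfolding P_def integral_mult_cnj_trig_poly[OF square_integrable_integrable[OF f]]
    by (simp add: complex_norm_square del: of_real_power)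
  have Q: "(LINT x|I01. P x * cnj (P x)) = of_real (\<Sum>k\<in>K. (cmod (fourier_coeff f k))\<^sup>2)"
  proof -
    have "(LINT x|I01. P x * cnj (P x)) = (\<Sum>k\<in>K. fourier_coeff P k * cnj (fourier_coeff f k))"
      using integral_mult_cnj_trig_poly[OF square_integrable_integrable[OF P]] by (simp add: P_def)
    also have "\<dots> = (\<Sum>k\<in>K. fourier_coeff f k * cnj (fourier_coeff f k))"
      unfolding P_def by (intro sum.cong refl) (simp add: fourier_coeff_trig_poly K)
    finally show ?thesis by (simp add: complex_norm_square del: of_real_power)
  qed
  have I: "integrable I01 (\<lambda>x. f x * cnj (P x))" "integrable I01 (\<lambda>x. P x * cnj (P x))"
    by (intro integrable_mult_square_integrable f P cP)+
  have Ir: "integrable I01 (\<lambda>x. Re (f x * cnj (P x)))" "integrable I01 (\<lambda>x. Re (P x * cnj (P x)))"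
    by (intro integrable_Re I)+
  have pt: "(cmod (f x - P x))\<^sup>2 = (cmod (f x))\<^sup>2 - 2 * Re (f x * cnj (P x)) + Re (P x * cnj (P x))" for x
    unfolding cmod_power2 by (simp add: algebra_simps power2_eq_square)
  have "(LINT x|I01. (cmod (f x - P x))\<^sup>2) =
     (LINT x|I01. (cmod (f x))\<^sup>2) - 2 * (LINT x|I01. Re (f x * cnj (P x))) + (LINT x|I01. Re (P x * cnj (P x)))"
    unfolding pt using f Ir unfolding square_integrable_def by (simp del: times_complex.sel)
  also have "(LINT x|I01. Re (f x * cnj (P x))) = (\<Sum>k\<in>K. (cmod (fourier_coeff f k))\<^sup>2)"
    by (subst integral_Re[OF I(1)]) (simp add: R)
  also have "(LINT x|I01. Re (P x * cnj (P x))) = (\<Sum>k\<in>K. (cmod (fourier_coeff f k))\<^sup>2)"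
    by (subst integral_Re[OF I(2)]) (simp add: Q)
  finally show ?thesis by (simp add: P_def)
qed

lemma bessel_inequality:
  assumes "square_integrable f" "finite K"
  shows "(\<Sum>k\<in>K. (cmod (fourier_coeff f k))\<^sup>2) \<le> (L2_norm f)\<^sup>2"
proof -
  have "0 \<le> (LINT x|I01. (cmod (f x - trig_poly K (fourier_coeff f) x))\<^sup>2)"
    by simp
  then show ?thesis using integral_diff_trig_poly[OF assms] by (simp add: L2_norm_power2)
qed

text \<open>The partial sums are uniformly Cauchy, and their limit \<open>F\<close> has the
  coefficients of \<open>f\<close>, so completeness identifies the two almost everywhere. The
  uniform bound and the uniform rate of convergence then pass from \<open>F\<close> to
  \<open>f\<close>.\<close>

lemma absolutely_summable_fourier_series:
  assumes f: "square_integrable f"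
    and bd: "\<And>F. finite F \<Longrightarrow> (\<Sum>k\<in>F. cmod (fourier_coeff f k)) \<le> \<Lambda>"
  shows "AE x in I01. cmod (f x) \<le> \<Lambda>"
    and "(\<lambda>n. \<Sum>k\<in>{- int n..int n}. (cmod (fourier_coeff f k))\<^sup>2) \<longlonglongrightarrow> (L2_norm f)\<^sup>2"
proof -
  define K where "K n = {- int n..int n}" for n
  define s where "s n = (\<Sum>k\<in>K n. cmod (fourier_coeff f k))" for n
  define P where "P n = trig_poly (K n) (fourier_coeff f)" for n
  have K_mono: "K m \<subseteq> K n" if "m \<le> n" for m n using that by (auto simp: K_def)
  have s_le: "s n \<le> \<Lambda>" for n unfolding s_def by (rule bd) (simp add: K_def)
  have s_mono: "mono s"
    unfolding s_def mono_def by (auto intro!: sum_mono2 K_mono) (auto simp: K_def)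
  obtain S where S: "s \<longlonglongrightarrow> S" "\<And>i. s i \<le> S"
    using incseq_convergent[of s \<Lambda>] s_mono s_le by auto
  have S_le: "S \<le> \<Lambda>" by (rule LIMSEQ_le_const2[OF S(1)]) (use s_le in auto)
  have diff: "cmod (P n x - P m x) \<le> s n - s m" if "m \<le> n" for m n x
  proof -
    have "P n x - P m x = trig_poly (K n - K m) (fourier_coeff f) x"
      unfolding P_def trig_poly_def using K_mono[OF that] by (subst sum_diff) (auto simp: K_def)
    also have "cmod \<dots> \<le> (\<Sum>k\<in>K n - K m. cmod (fourier_coeff f k))" by (rule norm_trig_poly_le)
    also have "\<dots> = s n - s m"
      unfolding s_def using K_mono[OF that] by (subst sum_diff) (auto simp: K_def)
    finally show ?thesis .
  qed
  have "Cauchy (\<lambda>n. P n x)" for x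
  proof (rule metric_CauchyI)
    fix e :: real assume "e > 0"
    have "Cauchy s" using S(1) by (rule LIMSEQ_imp_Cauchy)
    then obtain M where M: "\<And>m n. m \<ge> M \<Longrightarrow> n \<ge> M \<Longrightarrow> dist (s m) (s n) < e"
      using \<open>e > 0\<close> metric_CauchyD by metis
    have "dist (P m x) (P n x) < e" if "m \<ge> M" "n \<ge> M" for m n
    proof (cases "m \<le> n")
      case True
      then show ?thesis using diff[OF True, of x] M[OF that] by (simp add: dist_norm norm_minus_commute)
    next
      case False
      then have "n \<le> m" by simp
      then show ?thesis using diff[OF \<open>n \<le> m\<close>, of x] M[OF that] by (simp add: dist_norm)
    qed
    then show "\<exists>M. \<forall>m\<ge>M. \<forall>n\<ge>M. dist (P m x) (P n x) < e" by blast
  qed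
  then have "\<forall>x. \<exists>l. (\<lambda>n. P n x) \<longlonglongrightarrow> l" using Cauchy_convergent convergent_def by blast
  then obtain F where F: "\<And>x. (\<lambda>n. P n x) \<longlonglongrightarrow> F x" by metis
  have FP: "cmod (F x - P m x) \<le> S - s m" for x m
  proof (rule LIMSEQ_le)
    show "(\<lambda>n. cmod (P n x - P m x)) \<longlonglongrightarrow> cmod (F x - P m x)" by (intro tendsto_intros F)
    show "(\<lambda>n. s n - s m) \<longlonglongrightarrow> S - s m" by (intro tendsto_intros S)
    show "\<exists>N. \<forall>n\<ge>N. cmod (P n x - P m x) \<le> s n - s m" using diff by blast
  qed
  have Pm: "P n \<in> borel_measurable I01" for n by (simp add: P_def)
  have Fm: "F \<in> borel_measurable I01"
    by (rule borel_measurable_LIMSEQ_metric[OF Pm F])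
  have Fb: "cmod (F x) \<le> S" for x
  proof -
    have "cmod (F x) \<le> cmod (F x - P 0 x) + cmod (P 0 x)" by (metis diff_add_cancel norm_triangle_ineq)
    also have "\<dots> \<le> (S - s 0) + s 0"
      using FP[of x 0] norm_trig_poly_le[of "K 0" "fourier_coeff f" x]
      unfolding P_def s_def by (intro add_mono) auto
    finally show ?thesis by simp
  qed
  have F2: "square_integrable F" using Fm Fb by (intro square_integrable_bounded) auto
  have P2: "square_integrable (P n)" for n by (simp add: P_def square_integrable_trig_poly)
  have coeff: "fourier_coeff F k = fourier_coeff f k" for k
  proof -
    have "cmod (fourier_coeff F k - fourier_coeff f k) \<le> S - s m" if "m \<ge> nat \<bar>k\<bar>" for m
    proof -
      have "k \<in> K m" using that by (auto simp: K_def)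
      then have "fourier_coeff (P m) k = fourier_coeff f k"
        by (simp add: P_def fourier_coeff_trig_poly K_def)
      then have "fourier_coeff F k - fourier_coeff f k = fourier_coeff (\<lambda>x. F x - P m x) k"
        by (simp add: fourier_coeff_diff square_integrable_integrable F2 P2)
      also have "cmod \<dots> \<le> (LINT x|I01. cmod (F x - P m x))"
        by (intro norm_fourier_coeff_le square_integrable_integrable square_integrable_diff F2 P2)
      also have "\<dots> \<le> (LINT x|I01. S - s m)"
        using finite_measure.integrable_const[OF finite_measure_I01, of "S - s m"]
        by (intro integral_mono FP integrable_norm square_integrable_integrable square_integrable_diff F2 P2) auto
      finally show ?thesis by simp
    qed
    moreover have "(\<lambda>m. S - s m) \<longlonglongrightarrow> S - S" by (intro tendsto_intros S)
    ultimately have "cmod (fourier_coeff F k - fourier_coeff f k) \<le> S - S"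
      by (intro LIMSEQ_le_const) auto
    then show ?thesis by simp
  qed
  have "AE x in I01. f x - F x = 0"
    by (rule AE_0_if_fourier_coeff_0)
      (auto simp: fourier_coeff_diff coeff square_integrable_integrable f F2)
  then have fF: "AE x in I01. f x = F x" by simp
  show "AE x in I01. cmod (f x) \<le> \<Lambda>"
    using fF by eventually_elim (use Fb S_le order_trans in auto)
  \<comment> \<open>Almost everywhere the remainder is at most \<open>S - s n\<close>, and the
    interval has measure 1.\<close>
  have le: "(L2_norm f)\<^sup>2 - (\<Sum>k\<in>K n. (cmod (fourier_coeff f k))\<^sup>2) \<le> (S - s n)\<^sup>2" for n
  proof -
    have "(L2_norm f)\<^sup>2 - (\<Sum>k\<in>K n. (cmod (fourier_coeff f k))\<^sup>2) = (LINT x|I01. (cmod (f x - P n x))\<^sup>2)"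
      unfolding P_def by (subst integral_diff_trig_poly) (auto simp: f K_def L2_norm_power2)
    also have "\<dots> \<le> (LINT x|I01. (S - s n)\<^sup>2)"
    proof (rule integral_mono_AE)
      show "integrable I01 (\<lambda>x. (cmod (f x - P n x))\<^sup>2)"
        using square_integrable_diff[OF f P2] by (simp add: square_integrable_def)
      show "integrable I01 (\<lambda>x. (S - s n)\<^sup>2)"
        using finite_measure.integrable_const[OF finite_measure_I01] by blast
      show "AE x in I01. (cmod (f x - P n x))\<^sup>2 \<le> (S - s n)\<^sup>2"
        using fF by eventually_elim (use FP power_mono[OF FP] in auto)
    qed
    finally show ?thesis by simp
  qed
  have "(\<lambda>n. (L2_norm f)\<^sup>2 - (\<Sum>k\<in>K n. (cmod (fourier_coeff f k))\<^sup>2)) \<longlonglongrightarrow> 0"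
  proof (rule tendsto_sandwich)
    show "\<forall>\<^sub>F n in sequentially. 0 \<le> (L2_norm f)\<^sup>2 - (\<Sum>k\<in>K n. (cmod (fourier_coeff f k))\<^sup>2)"
      using bessel_inequality[OF f] by (auto simp: K_def)
    show "\<forall>\<^sub>F n in sequentially. (L2_norm f)\<^sup>2 - (\<Sum>k\<in>K n. (cmod (fourier_coeff f k))\<^sup>2) \<le> (S - s n)\<^sup>2"
      using le by simp
    have "(\<lambda>n. (S - s n)\<^sup>2) \<longlonglongrightarrow> (S - S)\<^sup>2" by (intro tendsto_intros S)
    then show "(\<lambda>n. (S - s n)\<^sup>2) \<longlonglongrightarrow> 0" by simp
  qed simp
  then have "(\<lambda>n. (L2_norm f)\<^sup>2 - ((L2_norm f)\<^sup>2 - (\<Sum>k\<in>K n. (cmod (fourier_coeff f k))\<^sup>2))) \<longlonglongrightarrow> (L2_norm f)\<^sup>2 - 0"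
    by (intro tendsto_intros)
  then show "(\<lambda>n. \<Sum>k\<in>{- int n..int n}. (cmod (fourier_coeff f k))\<^sup>2) \<longlonglongrightarrow> (L2_norm f)\<^sup>2"
    by (simp add: K_def)
qed

section \<open>Sobolev spaces\<close>

text \<open>The 2 on the left accounts for the pair of integers of modulus m in the sum below; the
  right side telescopes.\<close>

lemma inverse_square_telescope:
  fixes m :: real
  assumes "m > 0"
  shows "2 / (1 + m\<^sup>2) \<le> 4 / m - 4 / (m + 1)"
proof -
  have "0 \<le> (m - 1 / 2)\<^sup>2" by simp
  then have "m \<le> m\<^sup>2 + 1/4" by (simp add: power2_eq_square algebra_simps)
  then have "2 * (m * (m + 1)) \<le> 4 * (1 + m\<^sup>2)"
    by (simp add: power2_eq_square algebra_simps)
  moreover have "1 + m\<^sup>2 > 0" by (simp add: add_pos_nonneg)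
  ultimately have "2 / (1 + m\<^sup>2) \<le> 4 / (m * (m + 1))"
    using assms by (simp add: divide_simps mult.commute)
  also have "\<dots> = 4 / m - 4 / (m + 1)"
    using assms by (simp add: field_simps)
  finally show ?thesis .
qed

text \<open>The value 5 is 1 for k = 0 plus at most 4 from the telescoping series over the other
  integers, which is why the induction carries the deficit 4 / (n + 1).\<close>

lemma sum_inverse_square_le:
  assumes "finite F"
  shows "(\<Sum>k\<in>F. 1 / (1 + (real_of_int k)\<^sup>2)) \<le> 5"
proof -
  have *: "(\<Sum>k\<in>{- int n..int n}. 1 / (1 + (real_of_int k)\<^sup>2)) \<le> 5 - 4 / (real n + 1)" for n
  proof (induction n)
    case (Suc n)
    have "{- int (Suc n)..int (Suc n)} = insert (int (Suc n)) (insert (- int (Suc n)) {- int n..int n})"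
      by auto
    then have "(\<Sum>k\<in>{- int (Suc n)..int (Suc n)}. 1 / (1 + (real_of_int k)\<^sup>2)) =
      2 / (1 + (real n + 1)\<^sup>2) + (\<Sum>k\<in>{- int n..int n}. 1 / (1 + (real_of_int k)\<^sup>2))"
      by (simp add: power2_eq_square algebra_simps)
    also have "\<dots> \<le> (4 / (real n + 1) - 4 / (real n + 1 + 1)) + (5 - 4 / (real n + 1))"
      using Suc inverse_square_telescope[of "real n + 1"] by (intro add_mono) auto
    finally show ?case by (simp add: add.commute)
  qed simp
  obtain n where "F \<subseteq> {- int n..int n}"
  proof -
    have "F \<subseteq> {- int (nat (Max (insert 0 (abs ` F))))..int (nat (Max (insert 0 (abs ` F))))}"
    proof
      fix k assume "k \<in> F"
      then have "\<bar>k\<bar> \<le> Max (insert 0 (abs ` F))" using assms by (intro Max_ge) auto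
      then show "k \<in> {- int (nat (Max (insert 0 (abs ` F))))..int (nat (Max (insert 0 (abs ` F))))}"
        by auto
    qed
    then show ?thesis using that by blast
  qed
  then have "(\<Sum>k\<in>F. 1 / (1 + (real_of_int k)\<^sup>2)) \<le> (\<Sum>k\<in>{- int n..int n}. 1 / (1 + (real_of_int k)\<^sup>2))"
    by (intro sum_mono2) auto
  also have "\<dots> \<le> 5" using *[of n] by (smt (verit) divide_nonneg_nonneg of_nat_0_le_iff)
  finally show ?thesis .
qed

lemma Cauchy_Schwarz_sum_sqrt:
  fixes f g :: "'i \<Rightarrow> real"
  shows "(\<Sum>i\<in>I. f i * g i) \<le> sqrt (\<Sum>i\<in>I. (f i)\<^sup>2) * sqrt (\<Sum>i\<in>I. (g i)\<^sup>2)"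
proof -
  have "(\<Sum>i\<in>I. f i * g i) \<le> \<bar>\<Sum>i\<in>I. f i * g i\<bar>" by simp
  also have "\<dots> = sqrt ((\<Sum>i\<in>I. f i * g i)\<^sup>2)" by simp
  also have "\<dots> \<le> sqrt ((\<Sum>i\<in>I. (f i)\<^sup>2) * (\<Sum>i\<in>I. (g i)\<^sup>2))"
    by (intro real_sqrt_le_mono Cauchy_Schwarz_ineq_sum)
  finally show ?thesis by (simp add: real_sqrt_mult)
qed

text \<open>For the coefficients of a member of H^s this bounds the squared Sobolev norm by M.
  Finite partial sums replace the infinite sum, whose default value 0 in the divergent case would
  make a bound meaningless.\<close>

definition coeff_bounded :: "real \<Rightarrow> real \<Rightarrow> (int \<Rightarrow> complex) \<Rightarrow> bool" where
  "coeff_bounded s M c \<longleftrightarrow>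
     (\<forall>F. finite F \<longrightarrow> (\<Sum>k\<in>F. (1 + (of_int k)\<^sup>2) powr s * (cmod (c k))\<^sup>2) \<le> M)"

lemma sobolev_square_integrable: "f \<in> sobolev s \<Longrightarrow> square_integrable f"
  unfolding sobolev_def square_integrable_def by (auto simp: set_integrable_I01 intro: measurable_restrict_space1)

lemma sobolev_norm_power2:
  "(sobolev_norm s f)\<^sup>2 = (\<Sum>\<^sub>\<infinity>k::int. (1 + (of_int k)\<^sup>2) powr s * (cmod (fourier_coeff f k))\<^sup>2)"
  unfolding sobolev_norm_def by (intro real_sqrt_pow2 infsum_nonneg) auto

text \<open>Stands in for the triangle inequality and follows mode by mode from |x + y|^2 \<le> 2
  |x|^2 + 2 |y|^2; only boundedness is at stake, so the factor 2 is harmless.\<close>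

lemma sobolev_norm_power2_le:
  assumes f: "f \<in> sobolev s" and g: "g \<in> sobolev s"
  shows "(sobolev_norm s f)\<^sup>2 \<le> 2 * (sobolev_norm s (\<lambda>x. f x - g x))\<^sup>2 + 2 * (sobolev_norm s g)\<^sup>2"
proof -
  define w where "w k = (1 + (real_of_int k)\<^sup>2) powr s" for k
  define F where "F = fourier_coeff f"
  define G where "G = fourier_coeff g"
  have sF: "(\<lambda>k. w k * (cmod (F k))\<^sup>2) summable_on UNIV" and sG: "(\<lambda>k. w k * (cmod (G k))\<^sup>2) summable_on UNIV"
    using f g by (auto simp: sobolev_def w_def F_def G_def)
  have d: "fourier_coeff (\<lambda>x. f x - g x) k = F k - G k" for k
    unfolding F_def G_def
    by (intro fourier_coeff_diff square_integrable_integrable sobolev_square_integrable[OF f] sobolev_square_integrable[OF g])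
  have sq: "(cmod (x + y))\<^sup>2 \<le> 2 * (cmod x)\<^sup>2 + 2 * (cmod y)\<^sup>2" for x y
  proof -
    have "(cmod (x + y))\<^sup>2 \<le> (cmod x + cmod y)\<^sup>2" by (intro power_mono norm_triangle_ineq) simp
    then show ?thesis using sum_squares_bound[of "cmod x" "cmod y"] by (simp add: power2_sum)
  qed
  have w: "w k \<ge> 0" for k by (simp add: w_def)
  \<comment> \<open>An unsummable family has \<open>infsum\<close> 0, so summability of the
    difference comes before the comparison.\<close>
  have sD: "(\<lambda>k. w k * (cmod (F k - G k))\<^sup>2) summable_on UNIV"
  proof (rule summable_on_comparison_test)
    show "(\<lambda>k. 2 * (w k * (cmod (F k))\<^sup>2) + 2 * (w k * (cmod (G k))\<^sup>2)) summable_on UNIV"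
      by (intro summable_on_add summable_on_cmult_right sF sG)
    show "w k * (cmod (F k - G k))\<^sup>2 \<le> 2 * (w k * (cmod (F k))\<^sup>2) + 2 * (w k * (cmod (G k))\<^sup>2)" for k
      using mult_left_mono[OF sq[of "F k" "- G k"] w[of k]] by (simp add: algebra_simps)
  qed (use w in auto)
  have "(\<Sum>\<^sub>\<infinity>k. w k * (cmod (F k))\<^sup>2) \<le> (\<Sum>\<^sub>\<infinity>k. 2 * (w k * (cmod (F k - G k))\<^sup>2) + 2 * (w k * (cmod (G k))\<^sup>2))"
  proof (rule infsum_mono)
    show "(\<lambda>k. w k * (cmod (F k))\<^sup>2) summable_on UNIV" by (rule sF)
    show "(\<lambda>k. 2 * (w k * (cmod (F k - G k))\<^sup>2) + 2 * (w k * (cmod (G k))\<^sup>2)) summable_on UNIV"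
      by (intro summable_on_add summable_on_cmult_right sD sG)
    show "w k * (cmod (F k))\<^sup>2 \<le> 2 * (w k * (cmod (F k - G k))\<^sup>2) + 2 * (w k * (cmod (G k))\<^sup>2)" for k
      using mult_left_mono[OF sq[of "F k - G k" "G k"] w[of k]] by (simp add: algebra_simps)
  qed
  also have "\<dots> = 2 * (\<Sum>\<^sub>\<infinity>k. w k * (cmod (F k - G k))\<^sup>2) + 2 * (\<Sum>\<^sub>\<infinity>k. w k * (cmod (G k))\<^sup>2)"
    by (subst infsum_add) (auto intro!: summable_on_cmult_right sD sG simp: infsum_cmult_right')
  finally show ?thesis
    unfolding sobolev_norm_power2 d unfolding w_def F_def G_def .
qed

text \<open>Continuity in time bounds the norm near each instant, and compactness of [0,T] leaves
  finitely many such bounds.\<close>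

lemma C_sobolev_bounded:
  assumes "f \<in> C_sobolev T s"
  obtains M where "\<And>t. t \<in> {0..T} \<Longrightarrow> coeff_bounded s M (fourier_coeff (f t))"
proof -
  define S where "S t = (sobolev_norm s (f t))\<^sup>2" for t
  have f: "f t \<in> sobolev s" if "t \<in> {0..T}" for t
    using assms that by (simp add: C_sobolev_def)
  have "\<exists>U. open U \<and> t \<in> U \<and> (\<forall>r\<in>U \<inter> {0..T}. S r \<le> 2 + 2 * S t)" if t: "t \<in> {0..T}" for t
  proof -
    have "((\<lambda>r. sobolev_norm s (\<lambda>x. f r x - f t x)) \<longlongrightarrow> 0) (at t within {0..T})"
      using assms t by (simp add: C_sobolev_def)
    then have "\<forall>\<^sub>F r in at t within {0..T}. sobolev_norm s (\<lambda>x. f r x - f t x) < 1"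
      by (rule order_tendstoD) simp
    then obtain U where U: "open U" "t \<in> U"
      "\<And>r. r \<in> U \<Longrightarrow> r \<noteq> t \<Longrightarrow> r \<in> {0..T} \<Longrightarrow> sobolev_norm s (\<lambda>x. f r x - f t x) < 1"
      by (auto simp: eventually_at_topological)
    have "S r \<le> 2 + 2 * S t" if r: "r \<in> U \<inter> {0..T}" for r
    \<comment> \<open>The filter \<open>at t within {0..T}\<close> says nothing about the time t
      itself.\<close>
    proof (cases "r = t")
      case True
      then show ?thesis by (simp add: S_def add_nonneg_nonneg)
    next
      case False
      have "0 \<le> sobolev_norm s (\<lambda>x. f r x - f t x)"
        unfolding sobolev_norm_def by (auto intro!: infsum_nonneg)
      moreover have "sobolev_norm s (\<lambda>x. f r x - f t x) \<le> 1" using U(3)[of r] r False by auto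
      ultimately have "(sobolev_norm s (\<lambda>x. f r x - f t x))\<^sup>2 \<le> 1" by (simp add: power_le_one)
      then show ?thesis
        using sobolev_norm_power2_le[OF f f, of r t] r t by (simp add: S_def)
    qed
    with U show ?thesis by blast
  qed
  then obtain U where U: "\<And>t. t \<in> {0..T} \<Longrightarrow> open (U t)" "\<And>t. t \<in> {0..T} \<Longrightarrow> t \<in> U t"
    "\<And>t r. t \<in> {0..T} \<Longrightarrow> r \<in> U t \<Longrightarrow> r \<in> {0..T} \<Longrightarrow> S r \<le> 2 + 2 * S t"
    by (metis IntI)
  obtain D where D: "D \<subseteq> {0..T}" "finite D" "{0..T} \<subseteq> (\<Union>t\<in>D. U t)"
  proof (rule compactE_image[of "{0..T}" "{0..T}" U])
    show "{0..T} \<subseteq> (\<Union>t\<in>{0..T}. U t)" using U(2) by blast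
  qed (use U(1) in auto)
  \<comment> \<open>The sum dominates each of its nonnegative terms and, unlike a maximum, is also
    defined for empty \<open>D\<close>.\<close>
  define M where "M = (\<Sum>t\<in>D. 2 + 2 * S t)"
  have "coeff_bounded s M (fourier_coeff (f r))" if r: "r \<in> {0..T}" for r
  proof -
    obtain t where t: "t \<in> D" "r \<in> U t" using D(3) r by auto
    have "S r \<le> 2 + 2 * S t" using U(3)[of t r] t D(1) r by auto
    also have "\<dots> \<le> M"
      unfolding M_def using t D(2) by (intro member_le_sum) (auto simp: S_def)
    finally have SM: "S r \<le> M" .
    show ?thesis
      unfolding coeff_bounded_def
    proof (intro allI impI)
      fix F :: "int set" assume "finite F"
      then have "(\<Sum>k\<in>F. (1 + (of_int k)\<^sup>2) powr s * (cmod (fourier_coeff (f r) k))\<^sup>2) \<le> S r"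
        unfolding S_def sobolev_norm_power2
        using f[OF r] by (intro finite_sum_le_infsum) (auto simp: sobolev_def)
      then show "(\<Sum>k\<in>F. (1 + (of_int k)\<^sup>2) powr s * (cmod (fourier_coeff (f r) k))\<^sup>2) \<le> M"
        using SM by simp
    qed
  qed
  then show ?thesis using that by blast
qed

section \<open>Consequences of weighted coefficient bounds\<close>

lemma coeff_bounded_mono: "coeff_bounded s M c \<Longrightarrow> M \<le> M' \<Longrightarrow> coeff_bounded s M' c"
  unfolding coeff_bounded_def using order_trans by blast

lemma coeff_bounded_weight:
  assumes "s \<ge> 1" shows "1 + (real_of_int k)\<^sup>2 \<le> (1 + (of_int k)\<^sup>2) powr s"
  using powr_mono[of 1 s "1 + (real_of_int k)\<^sup>2"] assms by simp

lemma coeff_bounded_sum_squares: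
  assumes "coeff_bounded s M c" "s \<ge> 1" "finite F"
  shows "(\<Sum>k\<in>F. (1 + (of_int k)\<^sup>2) * (cmod (c k))\<^sup>2) \<le> M"
proof -
  have "(\<Sum>k\<in>F. (1 + (of_int k)\<^sup>2) * (cmod (c k))\<^sup>2) \<le> (\<Sum>k\<in>F. (1 + (of_int k)\<^sup>2) powr s * (cmod (c k))\<^sup>2)"
    by (intro sum_mono mult_right_mono coeff_bounded_weight assms) auto
  then show ?thesis using assms unfolding coeff_bounded_def by force
qed

text \<open>Cauchy-Schwarz against the summable weights 1 / (1 + k^2): an H^1 bound makes the
  coefficients absolutely summable, which bounds the function uniformly.\<close>

lemma weighted_sum_norm_le:
  assumes "finite F" "(\<Sum>k\<in>F. (1 + (of_int k)\<^sup>2) * (cmod (c k))\<^sup>2) \<le> M"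
  shows "(\<Sum>k\<in>F. cmod (c k)) \<le> sqrt 5 * sqrt M"
proof -
  have pos: "1 + (real_of_int k)\<^sup>2 > 0" for k by (simp add: add_pos_nonneg)
  have "(\<Sum>k\<in>F. cmod (c k)) = (\<Sum>k\<in>F. sqrt (1 / (1 + (real_of_int k)\<^sup>2)) * (sqrt (1 + (real_of_int k)\<^sup>2) * cmod (c k)))"
    using pos by (intro sum.cong refl) (simp add: real_sqrt_divide less_imp_neq[symmetric])
  also have "\<dots> \<le> sqrt (\<Sum>k\<in>F. (sqrt (1 / (1 + (real_of_int k)\<^sup>2)))\<^sup>2) * sqrt (\<Sum>k\<in>F. (sqrt (1 + (real_of_int k)\<^sup>2) * cmod (c k))\<^sup>2)"
    by (rule Cauchy_Schwarz_sum_sqrt)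
  also have "\<dots> = sqrt (\<Sum>k\<in>F. 1 / (1 + (real_of_int k)\<^sup>2)) * sqrt (\<Sum>k\<in>F. (1 + (of_int k)\<^sup>2) * (cmod (c k))\<^sup>2)"
    by (simp add: power_mult_distrib)
  also have "\<dots> \<le> sqrt 5 * sqrt M"
    using sum_inverse_square_le[OF assms(1)] assms(2) by (intro mult_mono real_sqrt_le_mono real_sqrt_ge_zero sum_nonneg) auto
  finally show ?thesis .
qed

lemma coeff_bounded_sum_norm:
  assumes "coeff_bounded s M c" "s \<ge> 1" "finite F"
  shows "(\<Sum>k\<in>F. cmod (c k)) \<le> sqrt 5 * sqrt M"
  using assms by (intro weighted_sum_norm_le coeff_bounded_sum_squares)

lemma coeff_bounded_l2:
  assumes "coeff_bounded s M c" "s \<ge> 1" "finite F"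
  shows "(\<Sum>k\<in>F. (cmod (c k))\<^sup>2) \<le> M"
proof -
  have "(\<Sum>k\<in>F. 1 * (cmod (c k))\<^sup>2) \<le> (\<Sum>k\<in>F. (1 + (of_int k)\<^sup>2) * (cmod (c k))\<^sup>2)"
    by (intro sum_mono mult_right_mono) auto
  then show ?thesis using coeff_bounded_sum_squares[OF assms] by simp
qed

text \<open>The source of the convergence rate: beyond the modes of S_N the Sobolev weight is at
  least N^(2s).\<close>

lemma coeff_bounded_tail:
  assumes "coeff_bounded s M c" "s \<ge> 1" "finite F" "N \<ge> 1" "\<And>k. k \<in> F \<Longrightarrow> \<bar>k\<bar> > int N"
  shows "(\<Sum>k\<in>F. (cmod (c k))\<^sup>2) \<le> M * (real N powr (- s))\<^sup>2"
proof -
  have w: "(real N powr s)\<^sup>2 \<le> (1 + (real_of_int k)\<^sup>2) powr s" if "k \<in> F" for k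
  proof -
    have "real N \<le> \<bar>real_of_int k\<bar>" using assms(5)[OF that] by linarith
    then have "(real N)\<^sup>2 \<le> (real_of_int k)\<^sup>2" by (simp add: abs_le_square_iff[symmetric])
    then have "((real N)\<^sup>2) powr s \<le> (1 + (real_of_int k)\<^sup>2) powr s"
      using assms by (intro powr_mono2) auto
    then show ?thesis using assms(4) by (simp add: power2_eq_square powr_mult)
  qed
  have "(real N powr s)\<^sup>2 * (\<Sum>k\<in>F. (cmod (c k))\<^sup>2) \<le> (\<Sum>k\<in>F. (1 + (of_int k)\<^sup>2) powr s * (cmod (c k))\<^sup>2)"
    unfolding sum_distrib_left using w by (intro sum_mono mult_right_mono) auto
  also have "\<dots> \<le> M" using assms unfolding coeff_bounded_def by blast
  finally have "(\<Sum>k\<in>F. (cmod (c k))\<^sup>2) \<le> M / (real N powr s)\<^sup>2"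
    using assms(4) by (simp add: field_simps)
  then show ?thesis by (simp add: powr_minus power_inverse divide_inverse)
qed

section \<open>The symbols of the linear part\<close>

text \<open>Arguments from 1 on suffice since nonzero wave numbers are multiples of 2 pi. The upper
  bound amounts to exp (2 x) \<ge> 3.\<close>

lemma coth_bounds:
  assumes "x \<ge> 1"
  shows "1 \<le> coth x" "coth x \<le> 2"
proof -
  have s: "sinh x > 0" using assms by simp
  have "sinh x \<le> cosh x" by (simp add: sinh_def cosh_def)
  then show "1 \<le> coth x" using s by (simp add: coth_def)
  have "3 \<le> exp (2 * x)" using exp_ge_add_one_self[of "2 * x"] assms by linarith
  then have "3 * exp (- x) \<le> exp (2 * x) * exp (- x)" by (intro mult_right_mono) auto
  also have "\<dots> = exp x" by (simp add: exp_add[symmetric])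
  finally have "cosh x \<le> 2 * sinh x" by (simp add: sinh_def cosh_def)
  then show "coth x \<le> 2" using s by (simp add: coth_def field_simps)
qed

text \<open>With s = |\<kappa>| coth |\<kappa>| / \<gamma>, read as 1 / \<gamma> at \<kappa> = 0,
  the symbol is (1 - s + s^2) / \<gamma> - a \<kappa>^2 / \<gamma>. Since 1 - s + s^2 \<ge> (1 +
  s^2) / 2 and s \<ge> |\<kappa>|, it is positive of order 2 even for a = 0.\<close>

lemma bfd_symbol_bounds:
  assumes \<gamma>: "0 < \<gamma>" "\<gamma> < 1" and a: "a \<le> 0" and \<kappa>: "\<kappa> = 0 \<or> \<bar>\<kappa>\<bar> \<ge> 1"
  shows "1 / (2 * \<gamma>) * (1 + \<kappa>\<^sup>2) \<le> bfd_symbol \<gamma> a \<kappa>"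
    and "bfd_symbol \<gamma> a \<kappa> \<le> (1 / \<gamma> + \<bar>a\<bar> / \<gamma> + 4 / \<gamma>^3) * (1 + \<kappa>\<^sup>2)"
proof -
  have "1 / (2 * \<gamma>) * (1 + \<kappa>\<^sup>2) \<le> bfd_symbol \<gamma> a \<kappa> \<and>
    bfd_symbol \<gamma> a \<kappa> \<le> (1 / \<gamma> + \<bar>a\<bar> / \<gamma> + 4 / \<gamma>^3) * (1 + \<kappa>\<^sup>2)"
  proof (cases "\<kappa> = 0")
    case True
    have g: "bfd_symbol \<gamma> a \<kappa> = (1 / \<gamma>) * (1 - 1 / \<gamma> + (1 / \<gamma>)\<^sup>2)"
      using \<gamma> True by (simp add: bfd_symbol_def field_simps power2_eq_square power3_eq_cube)
    have half: "1/2 \<le> 1 - x + x\<^sup>2" for x :: real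
      using zero_le_power2[of "1 - x"] zero_le_power2[of x]
      unfolding power2_eq_square left_diff_distrib right_diff_distrib by linarith
    have "1/2 \<le> 1 - 1 / \<gamma> + (1 / \<gamma>)\<^sup>2" by (rule half)
    then have "(1 / \<gamma>) * (1 / 2) \<le> bfd_symbol \<gamma> a \<kappa>"
      unfolding g using \<gamma> by (intro mult_left_mono) auto
    moreover have "bfd_symbol \<gamma> a \<kappa> \<le> 1 / \<gamma> + 4 / \<gamma>^3"
      using True \<gamma> by (simp add: bfd_symbol_def divide_right_mono)
        (smt (verit) divide_right_mono zero_le_divide_1_iff zero_le_power2 zero_le_power)
    moreover have "0 \<le> \<bar>a\<bar> / \<gamma>" using \<gamma> by simp
    ultimately show ?thesis using True by simp
  next
    case False
    define C where "C = coth \<bar>\<kappa>\<bar>"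
    have C: "1 \<le> C" "C \<le> 2" using coth_bounds[of "\<bar>\<kappa>\<bar>"] \<kappa> False by (auto simp: C_def)
    define s where "s = \<bar>\<kappa>\<bar> * C / \<gamma>"
    have g: "bfd_symbol \<gamma> a \<kappa> = (1 / \<gamma>) * (1 - s + s\<^sup>2) + (- a) * \<kappa>\<^sup>2 / \<gamma>"
      using False \<gamma>
      by (simp add: bfd_symbol_def s_def C_def[symmetric] power_mult_distrib power_divide field_simps power2_eq_square power3_eq_cube)
    have s_ge: "\<bar>\<kappa>\<bar> \<le> s"
    proof -
      have "\<bar>\<kappa>\<bar> * \<gamma> \<le> \<bar>\<kappa>\<bar> * C" using C \<gamma> by (intro mult_left_mono) auto
      then show ?thesis using \<gamma> by (simp add: s_def field_simps)
    qed
    then have "\<bar>\<kappa>\<bar>\<^sup>2 \<le> s\<^sup>2" by (intro power_mono) auto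
    then have sk: "\<kappa>\<^sup>2 \<le> s\<^sup>2" by simp
    have "0 \<le> (1 - s)\<^sup>2" by simp
    then have "(1 + \<kappa>\<^sup>2) / 2 \<le> 1 - s + s\<^sup>2" using sk by (simp add: power2_diff)
    then have "(1 / \<gamma>) * ((1 + \<kappa>\<^sup>2) / 2) \<le> (1 / \<gamma>) * (1 - s + s\<^sup>2)"
      using \<gamma> by (intro mult_left_mono) auto
    moreover have "0 \<le> (- a) * \<kappa>\<^sup>2 / \<gamma>"
      using a \<gamma> by (intro divide_nonneg_pos mult_nonneg_nonneg) auto
    ultimately have lower: "1 / (2 * \<gamma>) * (1 + \<kappa>\<^sup>2) \<le> bfd_symbol \<gamma> a \<kappa>"
      unfolding g by simp
    have "C\<^sup>2 \<le> 2\<^sup>2" using C by (intro power_mono) auto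
    then have "\<kappa>\<^sup>2 * C\<^sup>2 \<le> \<kappa>\<^sup>2 * 4" by (intro mult_left_mono) auto
    then have "s\<^sup>2 \<le> 4 * \<kappa>\<^sup>2 / \<gamma>\<^sup>2"
      using \<gamma> by (simp add: s_def power_mult_distrib power_divide divide_right_mono)
    then have "1 - s + s\<^sup>2 \<le> 1 + 4 * \<kappa>\<^sup>2 / \<gamma>\<^sup>2" using s_ge by simp
    then have "(1 / \<gamma>) * (1 - s + s\<^sup>2) \<le> (1 / \<gamma>) * (1 + 4 * \<kappa>\<^sup>2 / \<gamma>\<^sup>2)"
      using \<gamma> by (intro mult_left_mono) auto
    then have "bfd_symbol \<gamma> a \<kappa> \<le> (1 / \<gamma>) * (1 + 4 * \<kappa>\<^sup>2 / \<gamma>\<^sup>2) + \<bar>a\<bar> * \<kappa>\<^sup>2 / \<gamma>"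
      unfolding g using a by simp
    also have "\<dots> = 1 / \<gamma> + 4 / \<gamma>^3 * \<kappa>\<^sup>2 + \<bar>a\<bar> / \<gamma> * \<kappa>\<^sup>2"
      using \<gamma> by (simp add: field_simps power2_eq_square power3_eq_cube)
    also have "\<dots> \<le> (1 / \<gamma> + \<bar>a\<bar> / \<gamma> + 4 / \<gamma>^3) * (1 + \<kappa>\<^sup>2)"
    proof -
      have "0 \<le> 1 / \<gamma> * \<kappa>\<^sup>2" "0 \<le> \<bar>a\<bar> / \<gamma>" "0 \<le> 4 / \<gamma>^3" using \<gamma> by auto
      then show ?thesis unfolding distrib_left distrib_right by linarith
    qed
    finally show ?thesis using lower by simp
  qed
  then show "1 / (2 * \<gamma>) * (1 + \<kappa>\<^sup>2) \<le> bfd_symbol \<gamma> a \<kappa>"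
    "bfd_symbol \<gamma> a \<kappa> \<le> (1 / \<gamma> + \<bar>a\<bar> / \<gamma> + 4 / \<gamma>^3) * (1 + \<kappa>\<^sup>2)" by auto
qed

lemma one_plus_mult_bounds:
  fixes p y :: real
  assumes "p \<ge> 0" "y \<ge> 0"
  shows "min 1 p * (1 + y) \<le> 1 + p * y" "1 + p * y \<le> (1 + p) * (1 + y)"
proof -
  have "min 1 p * y \<le> p * y" using assms by (intro mult_right_mono) auto
  then show "min 1 p * (1 + y) \<le> 1 + p * y" by (simp add: distrib_left)
  show "1 + p * y \<le> (1 + p) * (1 + y)" using assms by (simp add: algebra_simps)
qed

text \<open>The ratio of the two off-diagonal symbols of the linear part: weighting the modes of the
  second unknown with it makes the linear part skew-adjoint.\<close>

definition energy_weight :: "real \<Rightarrow> real \<Rightarrow> real \<Rightarrow> real \<Rightarrow> real \<Rightarrow> real \<Rightarrow> real" where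
  "energy_weight \<gamma> a b c d \<kappa> =
     bfd_symbol \<gamma> a \<kappa> * (1 + d * \<kappa>\<^sup>2) / ((1 + b * \<kappa>\<^sup>2) * ((1 - \<gamma>) * (1 - c * \<kappa>\<^sup>2)))"

lemma square_smoothing_le:
  fixes b \<kappa> :: real
  assumes "b > 0"
  shows "(\<kappa> / (1 + b * \<kappa>\<^sup>2))\<^sup>2 \<le> 1 / (min 1 b)\<^sup>2 / (1 + \<kappa>\<^sup>2)"
proof -
  define X where "X = 1 + \<kappa>\<^sup>2"
  have X: "X \<ge> 1" unfolding X_def using zero_le_power2[of \<kappa>] by linarith
  have m: "min 1 b > 0" using assms by simp
  have "min 1 b * X \<le> 1 + b * \<kappa>\<^sup>2"
    unfolding X_def using assms by (intro one_plus_mult_bounds) auto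
  then have "(min 1 b * X)\<^sup>2 \<le> (1 + b * \<kappa>\<^sup>2)\<^sup>2" using m X by (intro power_mono) auto
  moreover have "\<kappa>\<^sup>2 \<le> X" by (simp add: X_def)
  ultimately have "\<kappa>\<^sup>2 / (1 + b * \<kappa>\<^sup>2)\<^sup>2 \<le> X / (min 1 b * X)\<^sup>2"
    using m X by (intro frac_le) auto
  also have "\<dots> = 1 / (min 1 b)\<^sup>2 / X" using X by (simp add: power_mult_distrib power2_eq_square)
  finally show ?thesis by (simp add: power_divide X_def)
qed

text \<open>The symbol and the factors 1 + b \<kappa>^2 and 1 + d \<kappa>^2 are all comparable to 1
  + \<kappa>^2. What remains is the quotient (1 + \<kappa>^2) / (1 - c \<kappa>^2), which grows
  quadratically for c = 0 and is bounded for c < 0.\<close>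

lemma energy_weight_bounds:
  assumes \<gamma>: "0 < \<gamma>" "\<gamma> < 1" and b: "b > 0" and d: "d > 0"
    and ac: "(a < 0 \<and> c = 0) \<or> (a = 0 \<and> c < 0)"
  obtains s Q where "s > 0" "Q > 0"
    "\<And>\<kappa>. \<kappa> = 0 \<or> \<bar>\<kappa>\<bar> \<ge> 1 \<Longrightarrow> s * ((1 + \<kappa>\<^sup>2) / (1 - c * \<kappa>\<^sup>2)) \<le> energy_weight \<gamma> a b c d \<kappa>"
    "\<And>\<kappa>. \<kappa> = 0 \<or> \<bar>\<kappa>\<bar> \<ge> 1 \<Longrightarrow> energy_weight \<gamma> a b c d \<kappa> \<le> Q * ((1 + \<kappa>\<^sup>2) / (1 - c * \<kappa>\<^sup>2))"
proof -
  have a: "a \<le> 0" and c: "c \<le> 0" using ac by auto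
  define G where "G = 1 / \<gamma> + \<bar>a\<bar> / \<gamma> + 4 / \<gamma>^3"
  have G: "G > 0" using \<gamma> by (simp add: G_def add_pos_nonneg add_nonneg_pos)
  define s where "s = 1 / (2 * \<gamma>) * min 1 d / ((1 + b) * (1 - \<gamma>))"
  define Q where "Q = G * (1 + d) / (min 1 b * (1 - \<gamma>))"
  have s: "s > 0" and Q: "Q > 0" using \<gamma> b d G by (auto simp: s_def Q_def)
  have bounds: "s * ((1 + \<kappa>\<^sup>2) / (1 - c * \<kappa>\<^sup>2)) \<le> energy_weight \<gamma> a b c d \<kappa> \<and>
      energy_weight \<gamma> a b c d \<kappa> \<le> Q * ((1 + \<kappa>\<^sup>2) / (1 - c * \<kappa>\<^sup>2))"
    if \<kappa>: "\<kappa> = 0 \<or> \<bar>\<kappa>\<bar> \<ge> 1" for \<kappa>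
  proof -
    define X where "X = 1 + \<kappa>\<^sup>2"
    define g where "g = bfd_symbol \<gamma> a \<kappa>"
    define q where "q = 1 - c * \<kappa>\<^sup>2"
    have X: "X \<ge> 1" by (simp add: X_def)
    have q: "q > 0" using c by (simp add: q_def mult_nonpos_nonneg add_pos_nonneg)
      (smt (verit) mult_nonpos_nonneg zero_le_power2)
    have g1: "1 / (2 * \<gamma>) * X \<le> g" and g2: "g \<le> G * X"
      using bfd_symbol_bounds[OF \<gamma> a \<kappa>] by (auto simp: X_def G_def g_def)
    have d1: "min 1 d * X \<le> 1 + d * \<kappa>\<^sup>2" and d2: "1 + d * \<kappa>\<^sup>2 \<le> (1 + d) * X"
      unfolding X_def using d by (intro one_plus_mult_bounds; simp)+
    have b1: "min 1 b * X \<le> 1 + b * \<kappa>\<^sup>2" and b2: "1 + b * \<kappa>\<^sup>2 \<le> (1 + b) * X"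
      unfolding X_def using b by (intro one_plus_mult_bounds; simp)+
    have g0: "g > 0" using g1 X \<gamma> by (smt (verit) mult_pos_pos zero_less_divide_1_iff)
    have b0: "1 + b * \<kappa>\<^sup>2 > 0" "1 + d * \<kappa>\<^sup>2 > 0" using b d by (auto intro: add_pos_nonneg)
    have w: "energy_weight \<gamma> a b c d \<kappa> = g * (1 + d * \<kappa>\<^sup>2) / ((1 + b * \<kappa>\<^sup>2) * ((1 - \<gamma>) * q))"
      by (simp add: energy_weight_def g_def q_def)
    have "s * (X / q) = (1 / (2 * \<gamma>) * X) * (min 1 d * X) / (((1 + b) * X) * ((1 - \<gamma>) * q))"
      using X by (simp add: s_def)
    also have "\<dots> \<le> g * (1 + d * \<kappa>\<^sup>2) / ((1 + b * \<kappa>\<^sup>2) * ((1 - \<gamma>) * q))"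
      using g1 d1 b2 g0 b0 q \<gamma> X d by (intro frac_le mult_mono mult_right_mono mult_pos_pos mult_nonneg_nonneg) auto
    finally have "s * (X / q) \<le> energy_weight \<gamma> a b c d \<kappa>" by (simp add: w)
    moreover have "g * (1 + d * \<kappa>\<^sup>2) / ((1 + b * \<kappa>\<^sup>2) * ((1 - \<gamma>) * q)) \<le>
        (G * X) * ((1 + d) * X) / ((min 1 b * X) * ((1 - \<gamma>) * q))"
      using g2 d2 b1 g0 b0 q \<gamma> X b d G by (intro frac_le mult_mono mult_right_mono mult_pos_pos mult_nonneg_nonneg) auto
    moreover have "(G * X) * ((1 + d) * X) / ((min 1 b * X) * ((1 - \<gamma>) * q)) = Q * (X / q)"
      using X by (simp add: Q_def)
    ultimately show ?thesis by (simp add: w X_def q_def)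
  qed
  show ?thesis by (rule that[OF s Q]) (use bounds in auto)
qed

text \<open>The final disjunction is what later remains of the case distinction: its first branch
  comes from c < 0, its second from c = 0. A single pair s, R serves all bounds.\<close>

lemma energy_weight_estimates:
  assumes \<gamma>: "0 < \<gamma>" "\<gamma> < 1" and b: "b > 0" and d: "d > 0"
    and ac: "(a < 0 \<and> c = 0) \<or> (a = 0 \<and> c < 0)"
  obtains s R where "s > 0" "R > 0"
    "\<And>\<kappa>. \<kappa> = 0 \<or> \<bar>\<kappa>\<bar> \<ge> 1 \<Longrightarrow> s \<le> energy_weight \<gamma> a b c d \<kappa>"
    "\<And>\<kappa>. (\<kappa> / (1 + b * \<kappa>\<^sup>2))\<^sup>2 \<le> R / (1 + \<kappa>\<^sup>2)"
    "(\<forall>\<kappa>. \<kappa> = 0 \<or> \<bar>\<kappa>\<bar> \<ge> 1 \<longrightarrow>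
        energy_weight \<gamma> a b c d \<kappa> * (\<kappa> / (1 + d * \<kappa>\<^sup>2))\<^sup>2 \<le> R / (1 + \<kappa>\<^sup>2)) \<or>
     (\<forall>\<kappa>. \<kappa> = 0 \<or> \<bar>\<kappa>\<bar> \<ge> 1 \<longrightarrow>
        energy_weight \<gamma> a b c d \<kappa> * (\<kappa> / (1 + d * \<kappa>\<^sup>2))\<^sup>2 \<le> R \<and>
        s * (1 + \<kappa>\<^sup>2) \<le> energy_weight \<gamma> a b c d \<kappa>)"
proof -
  obtain s Q where s: "s > 0" and Q: "Q > 0"
    and lo: "\<And>\<kappa>. \<kappa> = 0 \<or> \<bar>\<kappa>\<bar> \<ge> 1 \<Longrightarrow> s * ((1 + \<kappa>\<^sup>2) / (1 - c * \<kappa>\<^sup>2)) \<le> energy_weight \<gamma> a b c d \<kappa>"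
    and up: "\<And>\<kappa>. \<kappa> = 0 \<or> \<bar>\<kappa>\<bar> \<ge> 1 \<Longrightarrow> energy_weight \<gamma> a b c d \<kappa> \<le> Q * ((1 + \<kappa>\<^sup>2) / (1 - c * \<kappa>\<^sup>2))"
    using energy_weight_bounds[OF assms] by blast
  define Rb where "Rb = 1 / (min 1 b)\<^sup>2"
  define Rd where "Rd = 1 / (min 1 d)\<^sup>2"
  have R: "Rb > 0" "Rd > 0" using b d by (auto simp: Rb_def Rd_def)
  have eb: "(\<kappa> / (1 + b * \<kappa>\<^sup>2))\<^sup>2 \<le> Rb / (1 + \<kappa>\<^sup>2)" for \<kappa>
    unfolding Rb_def by (rule square_smoothing_le[OF b])
  have ed: "(\<kappa> / (1 + d * \<kappa>\<^sup>2))\<^sup>2 \<le> Rd / (1 + \<kappa>\<^sup>2)" for \<kappa>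
    unfolding Rd_def by (rule square_smoothing_le[OF d])
  have X: "1 + \<kappa>\<^sup>2 > 0" for \<kappa> :: real by (simp add: add_pos_nonneg)
  from ac show ?thesis
  proof
    assume "a < 0 \<and> c = 0"
    then have c: "c = 0" by simp
    show ?thesis
    proof (rule that[of s "max Rb (Q * Rd)"])
      fix \<kappa> :: real assume k: "\<kappa> = 0 \<or> \<bar>\<kappa>\<bar> \<ge> 1"
      have "s * 1 \<le> s * (1 + \<kappa>\<^sup>2)" using s by (intro mult_left_mono) auto
      then show "s \<le> energy_weight \<gamma> a b c d \<kappa>" using lo[OF k] c by simp
    next
      fix \<kappa> :: real
      show "(\<kappa> / (1 + b * \<kappa>\<^sup>2))\<^sup>2 \<le> max Rb (Q * Rd) / (1 + \<kappa>\<^sup>2)"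
        using eb[of \<kappa>] divide_right_mono[of Rb "max Rb (Q * Rd)" "1 + \<kappa>\<^sup>2"] X[of \<kappa>] by linarith
    next
      have "energy_weight \<gamma> a b c d \<kappa> * (\<kappa> / (1 + d * \<kappa>\<^sup>2))\<^sup>2 \<le> max Rb (Q * Rd) \<and>
          s * (1 + \<kappa>\<^sup>2) \<le> energy_weight \<gamma> a b c d \<kappa>" if k: "\<kappa> = 0 \<or> \<bar>\<kappa>\<bar> \<ge> 1" for \<kappa>
      proof -
        have "energy_weight \<gamma> a b c d \<kappa> * (\<kappa> / (1 + d * \<kappa>\<^sup>2))\<^sup>2 \<le> (Q * (1 + \<kappa>\<^sup>2)) * (Rd / (1 + \<kappa>\<^sup>2))"
          using up[OF k] c ed[of \<kappa>] Q X[of \<kappa>] by (intro mult_mono) auto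
        also have "\<dots> = Q * Rd" using X[of \<kappa>] by simp
        finally show ?thesis using lo[OF k] c by simp
      qed
      then show "(\<forall>\<kappa>. \<kappa> = 0 \<or> \<bar>\<kappa>\<bar> \<ge> 1 \<longrightarrow>
          energy_weight \<gamma> a b c d \<kappa> * (\<kappa> / (1 + d * \<kappa>\<^sup>2))\<^sup>2 \<le> max Rb (Q * Rd) / (1 + \<kappa>\<^sup>2)) \<or>
        (\<forall>\<kappa>. \<kappa> = 0 \<or> \<bar>\<kappa>\<bar> \<ge> 1 \<longrightarrow>
          energy_weight \<gamma> a b c d \<kappa> * (\<kappa> / (1 + d * \<kappa>\<^sup>2))\<^sup>2 \<le> max Rb (Q * Rd) \<and>
          s * (1 + \<kappa>\<^sup>2) \<le> energy_weight \<gamma> a b c d \<kappa>)" by blast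
    qed (use s R in auto)
  next
    assume "a = 0 \<and> c < 0"
    then have c: "- c > 0" by simp
    define p where "p = - c"
    have p: "p > 0" using c by (simp add: p_def)
    \<comment> \<open>The quotient (1 + \<kappa>^2) / (1 + p \<kappa>^2) is at most 1 / min 1 p, so
      \<open>Q'\<close> bounds the weight itself.\<close>
    define Q' where "Q' = Q / min 1 p"
    have Q': "Q' > 0" using Q p by (simp add: Q'_def)
    have pc: "1 - c * \<kappa>\<^sup>2 = 1 + p * \<kappa>\<^sup>2" for \<kappa> by (simp add: p_def)
    have px: "1 + p * \<kappa>\<^sup>2 > 0" for \<kappa> :: real using p by (auto intro: add_pos_nonneg)
    show ?thesis
    proof (rule that[of "s / (1 + p)" "max Rb (Q' * Rd)"])
      fix \<kappa> :: real assume k: "\<kappa> = 0 \<or> \<bar>\<kappa>\<bar> \<ge> 1"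
      have "1 + p * \<kappa>\<^sup>2 \<le> (1 + p) * (1 + \<kappa>\<^sup>2)" using p by (intro one_plus_mult_bounds) auto
      then have "1 / (1 + p) \<le> (1 + \<kappa>\<^sup>2) / (1 + p * \<kappa>\<^sup>2)"
        using p px[of \<kappa>] by (simp add: divide_simps mult.commute)
      then have "s * (1 / (1 + p)) \<le> s * ((1 + \<kappa>\<^sup>2) / (1 + p * \<kappa>\<^sup>2))"
        using s by (intro mult_left_mono) auto
      then show "s / (1 + p) \<le> energy_weight \<gamma> a b c d \<kappa>" using lo[OF k] by (simp add: pc)
    next
      fix \<kappa> :: real
      show "(\<kappa> / (1 + b * \<kappa>\<^sup>2))\<^sup>2 \<le> max Rb (Q' * Rd) / (1 + \<kappa>\<^sup>2)"
        using eb[of \<kappa>] divide_right_mono[of Rb "max Rb (Q' * Rd)" "1 + \<kappa>\<^sup>2"] X[of \<kappa>] by linarith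
    next
      have "energy_weight \<gamma> a b c d \<kappa> * (\<kappa> / (1 + d * \<kappa>\<^sup>2))\<^sup>2 \<le> max Rb (Q' * Rd) / (1 + \<kappa>\<^sup>2)"
        if k: "\<kappa> = 0 \<or> \<bar>\<kappa>\<bar> \<ge> 1" for \<kappa>
      proof -
        have "min 1 p * (1 + \<kappa>\<^sup>2) \<le> 1 + p * \<kappa>\<^sup>2" using p by (intro one_plus_mult_bounds) auto
        then have "(1 + \<kappa>\<^sup>2) / (1 + p * \<kappa>\<^sup>2) \<le> 1 / min 1 p"
          using p px[of \<kappa>] by (simp add: divide_simps mult.commute)
        then have "Q * ((1 + \<kappa>\<^sup>2) / (1 + p * \<kappa>\<^sup>2)) \<le> Q * (1 / min 1 p)"
          using Q by (intro mult_left_mono) auto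
        then have "energy_weight \<gamma> a b c d \<kappa> \<le> Q'" using up[OF k] by (simp add: pc Q'_def)
        then have "energy_weight \<gamma> a b c d \<kappa> * (\<kappa> / (1 + d * \<kappa>\<^sup>2))\<^sup>2 \<le> Q' * (Rd / (1 + \<kappa>\<^sup>2))"
          using ed[of \<kappa>] Q' by (intro mult_mono) auto
        then show ?thesis
          using divide_right_mono[of "Q' * Rd" "max Rb (Q' * Rd)" "1 + \<kappa>\<^sup>2"] X[of \<kappa>] by simp
      qed
      then show "(\<forall>\<kappa>. \<kappa> = 0 \<or> \<bar>\<kappa>\<bar> \<ge> 1 \<longrightarrow>
          energy_weight \<gamma> a b c d \<kappa> * (\<kappa> / (1 + d * \<kappa>\<^sup>2))\<^sup>2 \<le> max Rb (Q' * Rd) / (1 + \<kappa>\<^sup>2)) \<or>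
        (\<forall>\<kappa>. \<kappa> = 0 \<or> \<bar>\<kappa>\<bar> \<ge> 1 \<longrightarrow>
          energy_weight \<gamma> a b c d \<kappa> * (\<kappa> / (1 + d * \<kappa>\<^sup>2))\<^sup>2 \<le> max Rb (Q' * Rd) \<and>
          s / (1 + p) * (1 + \<kappa>\<^sup>2) \<le> energy_weight \<gamma> a b c d \<kappa>)" by blast
    qed (use s R p in auto)
  qed
qed

lemma wave_number_bounds:
  fixes k :: int
  shows "2 * pi * of_int k = 0 \<or> \<bar>2 * pi * of_int k\<bar> \<ge> (1::real)"
    and "1 + (real_of_int k)\<^sup>2 \<le> 1 + (2 * pi * of_int k)\<^sup>2"
proof -
  have pi: "2 * pi \<ge> 1" using pi_gt3 by simp
  then have "1 * \<bar>real_of_int k\<bar> \<le> 2 * pi * \<bar>real_of_int k\<bar>" by (rule mult_right_mono) simp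
  then have *: "\<bar>real_of_int k\<bar> \<le> \<bar>2 * pi * of_int k\<bar>" by (simp add: abs_mult)
  have "k \<noteq> 0 \<Longrightarrow> 1 \<le> \<bar>real_of_int k\<bar>" by linarith
  then show "2 * pi * of_int k = 0 \<or> \<bar>2 * pi * of_int k\<bar> \<ge> (1::real)" using * by force
  show "1 + (real_of_int k)\<^sup>2 \<le> 1 + (2 * pi * of_int k)\<^sup>2"
    using * by (simp add: abs_le_square_iff del: power_mult_distrib)
qed

section \<open>A continuation argument\<close>

text \<open>The function (E + r) exp (-K t) has nonpositive derivative; the mean value theorem asks
  for this only in the interior.\<close>

lemma gronwall_bound:
  fixes E E' :: "real \<Rightarrow> real"
  assumes S: "S \<ge> 0" and K: "K \<ge> 0"
    and E0: "E 0 = 0" and cont: "continuous_on {0..S} E"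
    and deriv: "\<And>t. t \<in> {0<..<S} \<Longrightarrow> (E has_real_derivative E' t) (at t)"
    and le: "\<And>t. t \<in> {0<..<S} \<Longrightarrow> E' t \<le> K * (E t + r)"
  shows "E S + r \<le> r * exp (K * S)"
proof -
  define G where "G t = (E t + r) * exp (- K * t)" for t
  have DG: "(G has_real_derivative (E' t - K * (E t + r)) * exp (- K * t)) (at t)" if "t \<in> {0<..<S}" for t
    unfolding G_def using deriv[OF that]
    by (auto intro!: derivative_eq_intros simp: algebra_simps)
  have "G S \<le> G 0"
  proof (cases "S = 0")
    case False
    then have "0 < S" using S by simp
    moreover have "continuous_on {0..S} G" unfolding G_def by (intro continuous_intros cont)
    moreover have "G differentiable (at t)" if "0 < t" "t < S" for t
      using DG[of t] that real_differentiable_def by auto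
    ultimately obtain l t where t: "0 < t" "t < S" "(G has_real_derivative l) (at t)" "G S - G 0 = (S - 0) * l"
      using MVT[of 0 S G] by auto
    then have l: "l = (E' t - K * (E t + r)) * exp (- K * t)"
      using DERIV_unique[OF t(3) DG] by simp
    have "l \<le> 0"
      unfolding l using le[of t] t by (intro mult_nonpos_nonneg) auto
    then have "(S - 0) * l \<le> 0" using S by (simp add: mult_nonneg_nonpos)
    then show ?thesis using t(4) by linarith
  qed simp
  then have "(E S + r) * exp (- K * S) * exp (K * S) \<le> r * exp (K * S)"
    by (intro mult_right_mono) (auto simp: G_def E0)
  then show ?thesis by (simp add: mult.assoc exp_add[symmetric])
qed

lemma first_time_reached:
  fixes E :: "real \<Rightarrow> real"
  assumes cont: "continuous_on {0..S} E" and t: "t \<in> {0..S}" "E t \<ge> c"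
  obtains \<tau> where "\<tau> \<in> {0..S}" "E \<tau> \<ge> c" "\<And>r. r \<in> {0..<\<tau>} \<Longrightarrow> E r < c"
proof -
  define A where "A = {t \<in> {0..S}. c \<le> E t}"
  have "closed A"
    unfolding A_def using continuous_closed_preimage[OF cont closed_atLeastAtMost closed_atLeast, of c]
    by (simp add: vimage_def Int_def)
  then have "compact A" unfolding compact_eq_bounded_closed by (auto simp: A_def intro: bounded_subset[of "{0..S}"])
  moreover have "A \<noteq> {}" using t by (auto simp: A_def)
  ultimately obtain \<tau> where \<tau>: "\<tau> \<in> A" "\<And>s. s \<in> A \<Longrightarrow> \<tau> \<le> s"
    using compact_attains_inf by metis
  show ?thesis
  proof (rule that[of \<tau>])
    show "E r < c" if "r \<in> {0..<\<tau>}" for r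
    proof (rule ccontr)
      assume "\<not> E r < c"
      then have "r \<in> A" using that \<tau>(1) by (auto simp: A_def)
      then show False using \<tau>(2)[of r] that by auto
    qed
  qed (use \<tau> in \<open>auto simp: A_def\<close>)
qed

text \<open>The differential inequality is available only while E \<le> 1. At a first time with E
  \<ge> 1, Gronwall's inequality would give 1 + r \<le> r exp (K T), which the strict hypothesis on
  r excludes.\<close>

lemma gronwall_continuation:
  fixes E E' :: "real \<Rightarrow> real"
  assumes K: "K \<ge> 0" and r: "r * exp (K * T) < 1 + r" "r \<ge> 0" "S \<le> T"
    and E0: "E 0 = 0"
    and deriv: "\<And>t. t \<in> {0..S} \<Longrightarrow> (E has_real_derivative E' t) (at t within {0..S})"
    and le: "\<And>t. t \<in> {0..S} \<Longrightarrow> E t \<le> 1 \<Longrightarrow> E' t \<le> K * (E t + r)"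
    and t: "t \<in> {0..S}"
  shows "E t + r \<le> r * exp (K * T)"
proof -
  have cont: "continuous_on {0..S} E"
    using deriv DERIV_continuous by (fastforce simp: continuous_on_eq_continuous_within)
  have bound: "E \<tau> + r \<le> r * exp (K * T)" if \<tau>: "\<tau> \<in> {0..S}" and small: "\<And>s. s \<in> {0..<\<tau>} \<Longrightarrow> E s < 1" for \<tau>
  proof -
    have "E \<tau> + r \<le> r * exp (K * \<tau>)"
    proof (rule gronwall_bound[where E' = E'])
      show "continuous_on {0..\<tau>} E" using cont \<tau> by (auto intro: continuous_on_subset)
      show "(E has_real_derivative E' t) (at t)" if "t \<in> {0<..<\<tau>}" for t
      proof -
        have "at t within {0..S} = at t"
          using that \<tau> by (intro at_within_Icc_at) auto
        then show ?thesis using deriv[of t] that \<tau> by auto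
      qed
      show "E' t \<le> K * (E t + r)" if "t \<in> {0<..<\<tau>}" for t
        using le[of t] small[of t] that \<tau> by auto
    qed (use \<tau> K E0 in auto)
    also have "\<dots> \<le> r * exp (K * T)"
      using \<tau> r K by (intro mult_left_mono) (auto intro: mult_left_mono)
    finally show ?thesis .
  qed
  have "E s < 1" if s: "s \<in> {0..S}" for s
  proof (rule ccontr)
    assume "\<not> E s < 1"
    then obtain \<tau> where \<tau>: "\<tau> \<in> {0..S}" "E \<tau> \<ge> 1" "\<And>r. r \<in> {0..<\<tau>} \<Longrightarrow> E r < 1"
      using first_time_reached[OF cont s, of 1] by auto
    then show False using bound[of \<tau>] r by auto
  qed
  then show ?thesis using bound[OF t] t by auto
qed

section \<open>Global solutions of Lipschitz differential equations\<close>

text \<open>The Picard operator is written for \<open>z t = exp (- \<rho> t) x t\<close> with \<open>\<rho> > L\<close>, which makes it a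
  contraction on the whole interval.\<close>

lemma lipschitz_ode_global:
  fixes G :: "'a::banach \<Rightarrow> 'a"
  assumes L: "L \<ge> 0" and Lip: "\<And>x y. dist (G x) (G y) \<le> L * dist x y" and T: "T \<ge> 0"
  shows "\<exists>x. x 0 = x0 \<and> (\<forall>t\<in>{0..T}. (x has_vector_derivative G (x t)) (at t within {0..T}))"
proof -
  \<comment> \<open>Makes the contraction constant \<open>L / \<rho>\<close> at most 1/2 and stays
    positive for \<open>L = 0\<close>.\<close>
  define \<rho> where "\<rho> = 2 * L + 1"
  have \<rho>: "\<rho> > 0" using L by (simp add: \<rho>_def)
  \<comment> \<open>Clamping time to [0,T] extends a continuous function on the interval to a
    bounded continuous one on the line, so that the fixed point theorem applies in that complete
    space.\<close>
  define cl where "cl t = max 0 (min T t)" for t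
  have cl_mem: "cl t \<in> {0..T}" for t using T by (auto simp: cl_def)
  have cl_id: "t \<in> {0..T} \<Longrightarrow> cl t = t" for t by (auto simp: cl_def)
  have cl_cont: "continuous_on UNIV cl" unfolding cl_def by (intro continuous_intros)
  have Gc: "continuous_on UNIV G"
    by (rule lipschitz_on_continuous_on[OF lipschitz_onI[of _ _ L]]) (use Lip L in auto)
  define h where "h z s = G (exp (\<rho> * s) *\<^sub>R z s)" for z :: "real \<Rightarrow> 'a" and s
  have hc: "continuous_on {0..t} (h (apply_bcontfun z))" for z t
    unfolding h_def by (intro continuous_on_compose2[OF Gc] continuous_intros continuous_on_apply_bcontfun) auto
  define \<phi> where "\<phi> z t = exp (- \<rho> * t) *\<^sub>R (x0 + integral {0..t} (h (apply_bcontfun z)))" for z t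
  have \<phi>c: "continuous_on {0..T} (\<phi> z)" for z
    unfolding \<phi>_def
    by (intro continuous_intros indefinite_integral_continuous_1 integrable_continuous_real hc)
  have mem: "(\<lambda>t. \<phi> z (cl t)) \<in> bcontfun" for z
  proof -
    have "continuous_on UNIV (\<lambda>t. \<phi> z (cl t))"
      using cl_mem by (intro continuous_on_compose2[OF \<phi>c cl_cont]) auto
    moreover have "bounded (\<phi> z ` {0..T})"
      by (intro compact_imp_bounded compact_continuous_image \<phi>c) auto
    then have "bounded (range (\<lambda>t. \<phi> z (cl t)))"
      by (rule bounded_subset) (use cl_mem in auto)
    ultimately show ?thesis by (simp add: bcontfun_def)
  qed
  define \<Phi> where "\<Phi> z = Bcontfun (\<lambda>t. \<phi> z (cl t))" for z
  have \<Phi>: "apply_bcontfun (\<Phi> z) t = \<phi> z (cl t)" for z t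
    unfolding \<Phi>_def using Bcontfun_inverse[OF mem[of z]] by simp
  have contr: "dist (\<Phi> z) (\<Phi> w) \<le> (1/2) * dist z w" for z w
  proof (rule dist_bound)
    fix r
    define t where "t = cl r"
    have t: "t \<ge> 0" using cl_mem[of r] by (simp add: t_def)
    define D where "D = dist z w"
    have hi: "((\<lambda>s. L * D * exp (\<rho> * s)) has_integral (L * D * exp (\<rho> * t) / \<rho> - L * D * exp (\<rho> * 0) / \<rho>)) {0..t}"
      using t \<rho>
      by (intro fundamental_theorem_of_calculus)
        (auto intro!: derivative_eq_intros simp: has_real_derivative_iff_has_vector_derivative[symmetric])
    have "norm (integral {0..t} (\<lambda>s. h z s - h w s)) \<le> integral {0..t} (\<lambda>s. L * D * exp (\<rho> * s))"
    proof (rule Henstock_Kurzweil_Integration.integral_norm_bound_integral)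
      show "(\<lambda>s. h z s - h w s) integrable_on {0..t}"
        by (intro integrable_continuous_real continuous_on_diff hc)
      show "(\<lambda>s. L * D * exp (\<rho> * s)) integrable_on {0..t}"
        by (intro integrable_continuous_real continuous_intros)
      fix s
      have "norm (h z s - h w s) \<le> L * dist (exp (\<rho> * s) *\<^sub>R z s) (exp (\<rho> * s) *\<^sub>R w s)"
        using Lip by (simp add: h_def dist_norm)
      also have "\<dots> = L * (exp (\<rho> * s) * dist (z s) (w s))"
        by (simp add: dist_norm scaleR_diff_right[symmetric])
      also have "\<dots> \<le> L * (exp (\<rho> * s) * D)"
        using L by (intro mult_left_mono) (auto simp: D_def dist_bounded)
      finally show "norm (h z s - h w s) \<le> L * D * exp (\<rho> * s)" by (simp add: mult_ac)
    qed
    also have "integral {0..t} (\<lambda>s. L * D * exp (\<rho> * s)) = L * D * exp (\<rho> * t) / \<rho> - L * D * exp (\<rho> * 0) / \<rho>"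
      by (rule integral_unique) (rule hi)
    also have "\<dots> \<le> L * D * exp (\<rho> * t) / \<rho>" using L \<rho> by (simp add: D_def)
    also have "\<dots> \<le> (1/2) * D * exp (\<rho> * t)"
    proof -
      have "L / \<rho> \<le> 1/2" using \<rho> by (simp add: \<rho>_def field_simps)
      then have "L / \<rho> * (D * exp (\<rho> * t)) \<le> 1/2 * (D * exp (\<rho> * t))"
        by (rule mult_right_mono) (simp add: D_def)
      then show ?thesis by simp
    qed
    finally have *: "norm (integral {0..t} (\<lambda>s. h z s - h w s)) \<le> (1/2) * D * exp (\<rho> * t)" .
    have "dist (\<Phi> z r) (\<Phi> w r) = exp (- \<rho> * t) * norm (integral {0..t} (h z) - integral {0..t} (h w))"
      unfolding \<Phi> t_def[symmetric] \<phi>_def by (simp add: dist_norm scaleR_diff_right[symmetric])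
    also have "integral {0..t} (h z) - integral {0..t} (h w) = integral {0..t} (\<lambda>s. h z s - h w s)"
      by (intro Henstock_Kurzweil_Integration.integral_diff[symmetric] integrable_continuous_real hc)
    also have "exp (- \<rho> * t) * norm \<dots> \<le> exp (- \<rho> * t) * ((1/2) * D * exp (\<rho> * t))"
      using * by (intro mult_left_mono) auto
    also have "\<dots> = (1/2) * D" by (simp add: exp_minus)
    finally show "dist (\<Phi> z r) (\<Phi> w r) \<le> (1/2) * dist z w" by (simp add: D_def)
  qed
  have "\<exists>!z. \<Phi> z = z"
    by (rule banach_fix_type[of "1/2"]) (use contr in auto)
  then obtain z where z: "\<Phi> z = z" by blast
  define x where "x t = x0 + integral {0..t} (h (apply_bcontfun z))" for t
  have xz: "exp (\<rho> * t) *\<^sub>R z t = x t" if "t \<in> {0..T}" for t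
  proof -
    have "z t = exp (- \<rho> * t) *\<^sub>R x t"
      using \<Phi>[of z t] z cl_id[OF that] by (simp add: \<phi>_def x_def)
    then show ?thesis by (simp add: exp_minus)
  qed
  have "(x has_vector_derivative G (x t)) (at t within {0..T})" if t: "t \<in> {0..T}" for t
  proof -
    have "((\<lambda>u. integral {0..u} (h (apply_bcontfun z))) has_vector_derivative h (apply_bcontfun z) t) (at t within {0..T})"
      by (rule integral_has_vector_derivative[OF hc t])
    then have "(x has_vector_derivative (0 + h (apply_bcontfun z) t)) (at t within {0..T})"
      unfolding x_def by (intro has_vector_derivative_add has_vector_derivative_const)
    then show ?thesis by (simp add: h_def xz[OF t])
  qed
  moreover have "x 0 = x0" by (simp add: x_def)
  ultimately show ?thesis by blast
qed

instance bcontfun :: (metric_space, banach) banach ..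

text \<open>The set of active wave numbers varies and cannot be a type, so the state space consists of
  bounded continuous functions on the reals, whose values at the integers are the unknowns.\<close>

lemma lipschitz_ode_system_global:
  fixes H :: "int \<Rightarrow> (int \<Rightarrow> 'b::banach) \<Rightarrow> 'b"
  assumes I: "finite I" and T: "T \<ge> 0"
    and Lip: "\<And>k. k \<in> I \<Longrightarrow>
      \<exists>L. \<forall>v w B. (\<forall>j. norm (v j - w j) \<le> B) \<longrightarrow> norm (H k v - H k w) \<le> L * B"
  shows "\<exists>x. \<forall>k\<in>I. x 0 k = y k \<and>
    (\<forall>t\<in>{0..T}. ((\<lambda>r. x r k) has_vector_derivative H k (x t)) (at t within {0..T}))"
proof -
  \<comment> \<open>Tent functions: interpolation at the integers embeds families over
    \<open>I\<close> into the state space.\<close>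
  define hat where "hat k x = max 0 (1 - \<bar>x - real_of_int k\<bar>)" for k x
  have hat: "0 \<le> hat k x" "hat k x \<le> 1" for k x by (auto simp: hat_def)
  have hat_int: "hat k (of_int l) = (if l = k then 1 else 0)" for k l
  proof -
    have "l \<noteq> k \<Longrightarrow> \<bar>real_of_int l - real_of_int k\<bar> \<ge> 1" by linarith
    then show ?thesis by (auto simp: hat_def)
  qed
  define spread where "spread g = (\<lambda>x. \<Sum>k\<in>I. hat k x *\<^sub>R g k)" for g :: "int \<Rightarrow> 'b"
  have norm_spread: "norm (spread g x) \<le> (\<Sum>k\<in>I. norm (g k))" for g x
    unfolding spread_def
    by (intro order_trans[OF norm_sum] sum_mono) (use hat in \<open>auto intro: mult_left_le_one_le\<close>)
  have "spread g \<in> bcontfun" for g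
    by (rule bcontfun_normI[OF _ norm_spread]) (auto simp: spread_def hat_def intro!: continuous_intros)
  then have app: "apply_bcontfun (Bcontfun (spread g)) = spread g" for g
    by (rule Bcontfun_inverse)
  have spread_int: "spread g (of_int k) = g k" if "k \<in> I" for g k
    unfolding spread_def hat_int using that I by (simp add: if_distrib[of "\<lambda>c. c *\<^sub>R _"] sum.delta cong: if_cong)
  from Lip have "\<forall>k\<in>I. \<exists>L. \<forall>v w B. (\<forall>j. norm (v j - w j) \<le> B) \<longrightarrow> norm (H k v - H k w) \<le> L * B"
    by blast
  then obtain L where L: "\<And>k v w B. k \<in> I \<Longrightarrow> (\<And>j. norm (v j - w j) \<le> B) \<Longrightarrow> norm (H k v - H k w) \<le> L k * B"
    by metis
  define \<Lambda> where "\<Lambda> = (\<Sum>k\<in>I. \<bar>L k\<bar>)"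
  have \<Lambda>: "\<Lambda> \<ge> 0" by (simp add: \<Lambda>_def sum_nonneg)
  define G where "G v = Bcontfun (spread (\<lambda>k. H k (\<lambda>j. apply_bcontfun v (of_int j))))" for v :: "real \<Rightarrow>\<^sub>C 'b"
  have "dist (G v) (G w) \<le> \<Lambda> * dist v w" for v w
  proof (rule dist_bound)
    fix x
    have "dist (G v x) (G w x) =
      norm (spread (\<lambda>k. H k (\<lambda>j. v (of_int j)) - H k (\<lambda>j. w (of_int j))) x)"
      unfolding G_def app by (simp add: dist_norm spread_def scaleR_diff_right sum_subtractf)
    also have "\<dots> \<le> (\<Sum>k\<in>I. norm (H k (\<lambda>j. v (of_int j)) - H k (\<lambda>j. w (of_int j))))"
      by (rule norm_spread)
    also have "\<dots> \<le> (\<Sum>k\<in>I. \<bar>L k\<bar> * dist v w)"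
    proof (rule sum_mono)
      fix k assume "k \<in> I"
      then have "norm (H k (\<lambda>j. v (of_int j)) - H k (\<lambda>j. w (of_int j))) \<le> L k * dist v w"
        by (rule L) (simp add: dist_bounded dist_norm[symmetric])
      also have "\<dots> \<le> \<bar>L k\<bar> * dist v w" by (intro mult_right_mono) auto
      finally show "norm (H k (\<lambda>j. v (of_int j)) - H k (\<lambda>j. w (of_int j))) \<le> \<bar>L k\<bar> * dist v w" .
    qed
    finally show "dist (G v x) (G w x) \<le> \<Lambda> * dist v w" by (simp add: \<Lambda>_def sum_distrib_right)
  qed
  from lipschitz_ode_global[OF \<Lambda> this T, of "Bcontfun (spread y)"]
  obtain X where X: "X 0 = Bcontfun (spread y)"
    "\<And>t. t \<in> {0..T} \<Longrightarrow> (X has_vector_derivative G (X t)) (at t within {0..T})"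
    by blast
  \<comment> \<open>Evaluation at an integer is bounded linear, so it commutes with the time
    derivative.\<close>
  have bl: "bounded_linear (\<lambda>v. apply_bcontfun v (of_int k))" for k and v :: "real \<Rightarrow>\<^sub>C 'b"
    by (rule bounded_linear_intro[of _ 1]) (auto simp: norm_bounded)
  have "apply_bcontfun (X 0) (of_int k) = y k \<and>
     (\<forall>t\<in>{0..T}. ((\<lambda>r. apply_bcontfun (X r) (of_int k)) has_vector_derivative
        H k (\<lambda>j. apply_bcontfun (X t) (of_int j))) (at t within {0..T}))"
    if "k \<in> I" for k
    using bounded_linear.has_vector_derivative[OF bl X(2), of _ k] that
    by (auto simp: G_def X(1) app spread_int)
  then show ?thesis by (intro exI[of _ "\<lambda>t j. apply_bcontfun (X t) (of_int j)"]) blast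
qed

section \<open>Bounded Lipschitz functionals of coefficient families\<close>

text \<open>Boundedness is part of the notion because a product of unbounded Lipschitz functionals
  need not be Lipschitz. The Lipschitz condition refers to the supremum distance, expressed through
  an upper bound B since families over the integers carry no norm.\<close>

definition bounded_lipschitz :: "((int \<Rightarrow> 'a::real_normed_vector) \<Rightarrow> complex) \<Rightarrow> bool" where
  "bounded_lipschitz \<phi> \<longleftrightarrow> (\<exists>M. \<forall>v. cmod (\<phi> v) \<le> M) \<and>
     (\<exists>L. \<forall>v w B. (\<forall>j. norm (v j - w j) \<le> B) \<longrightarrow> cmod (\<phi> v - \<phi> w) \<le> L * B)"

lemma bounded_lipschitz_const: "bounded_lipschitz (\<lambda>v. c)"
  unfolding bounded_lipschitz_def by (auto intro: exI[of _ 0])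

lemma bounded_lipschitz_add:
  assumes "bounded_lipschitz \<phi>" "bounded_lipschitz \<psi>"
  shows "bounded_lipschitz (\<lambda>v. \<phi> v + \<psi> v)"
proof -
  obtain M1 L1 where 1: "\<And>v. cmod (\<phi> v) \<le> M1"
    "\<And>v w B. (\<And>j. norm (v j - w j) \<le> B) \<Longrightarrow> cmod (\<phi> v - \<phi> w) \<le> L1 * B"
    using assms(1) unfolding bounded_lipschitz_def by metis
  obtain M2 L2 where 2: "\<And>v. cmod (\<psi> v) \<le> M2"
    "\<And>v w B. (\<And>j. norm (v j - w j) \<le> B) \<Longrightarrow> cmod (\<psi> v - \<psi> w) \<le> L2 * B"
    using assms(2) unfolding bounded_lipschitz_def by metis
  have "cmod (\<phi> v + \<psi> v) \<le> M1 + M2" for v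
    using 1(1)[of v] 2(1)[of v] norm_triangle_ineq[of "\<phi> v" "\<psi> v"] by linarith
  moreover have "cmod (\<phi> v + \<psi> v - (\<phi> w + \<psi> w)) \<le> (L1 + L2) * B" if "\<And>j. norm (v j - w j) \<le> B" for v w B
    using 1(2)[of v w B, OF that] 2(2)[of v w B, OF that] norm_triangle_ineq[of "\<phi> v - \<phi> w" "\<psi> v - \<psi> w"]
    by (simp add: algebra_simps)
  ultimately show ?thesis unfolding bounded_lipschitz_def by blast
qed

lemma bounded_lipschitz_mult:
  assumes "bounded_lipschitz \<phi>" "bounded_lipschitz \<psi>"
  shows "bounded_lipschitz (\<lambda>v. \<phi> v * \<psi> v)"
proof -
  obtain M1 L1 where 1: "\<And>v. cmod (\<phi> v) \<le> M1"
    "\<And>v w B. (\<And>j. norm (v j - w j) \<le> B) \<Longrightarrow> cmod (\<phi> v - \<phi> w) \<le> L1 * B"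
    using assms(1) unfolding bounded_lipschitz_def by metis
  obtain M2 L2 where 2: "\<And>v. cmod (\<psi> v) \<le> M2"
    "\<And>v w B. (\<And>j. norm (v j - w j) \<le> B) \<Longrightarrow> cmod (\<psi> v - \<psi> w) \<le> L2 * B"
    using assms(2) unfolding bounded_lipschitz_def by metis
  have M: "M1 \<ge> 0" "M2 \<ge> 0" using order_trans[OF norm_ge_zero 1(1)] order_trans[OF norm_ge_zero 2(1)] by auto
  have "cmod (\<phi> v * \<psi> v) \<le> M1 * M2" for v
    using 1(1)[of v] 2(1)[of v] M by (simp add: norm_mult mult_mono)
  moreover have "cmod (\<phi> v * \<psi> v - \<phi> w * \<psi> w) \<le> (L1 * M2 + M1 * L2) * B" if le: "\<And>j. norm (v j - w j) \<le> B" for v w B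
  proof -
    have "\<phi> v * \<psi> v - \<phi> w * \<psi> w = (\<phi> v - \<phi> w) * \<psi> v + \<phi> w * (\<psi> v - \<psi> w)"
      by (simp add: algebra_simps)
    also have "cmod \<dots> \<le> cmod (\<phi> v - \<phi> w) * cmod (\<psi> v) + cmod (\<phi> w) * cmod (\<psi> v - \<psi> w)"
      by (metis norm_mult norm_triangle_ineq)
    also have "\<dots> \<le> (L1 * B) * M2 + M1 * (L2 * B)"
      using 1(1)[of w] 2(1)[of v] 1(2)[of v w B, OF le] 2(2)[of v w B, OF le] M order_trans[OF norm_ge_zero 1(2)[of v w B, OF le]]
      by (intro add_mono mult_mono) auto
    finally show ?thesis by (simp add: algebra_simps)
  qed
  ultimately show ?thesis unfolding bounded_lipschitz_def by blast
qed

lemma bounded_lipschitz_diff: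
  assumes "bounded_lipschitz \<phi>" "bounded_lipschitz \<psi>"
  shows "bounded_lipschitz (\<lambda>v. \<phi> v - \<psi> v)"
  using bounded_lipschitz_add[OF assms(1) bounded_lipschitz_mult[OF bounded_lipschitz_const[of "-1"] assms(2)]]
  by simp

lemma bounded_lipschitz_sum:
  "(\<And>i. i \<in> I \<Longrightarrow> bounded_lipschitz (\<phi> i)) \<Longrightarrow> bounded_lipschitz (\<lambda>v. \<Sum>i\<in>I. \<phi> i v)"
  by (induction I rule: infinite_finite_induct) (auto intro: bounded_lipschitz_const bounded_lipschitz_add)

text \<open>Projection to a closed convex set does not increase distances, and its values stay in
  the ball. The map f is meant for the two coordinates of a pair.\<close>

lemma bounded_lipschitz_closest_point:
  fixes f :: "'a::euclidean_space \<Rightarrow> complex"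
  assumes f: "\<And>x. cmod (f x) \<le> norm x" "\<And>x y. f (x - y) = f x - f y" and R: "R \<ge> 0"
  shows "bounded_lipschitz (\<lambda>v. f (closest_point (cball 0 R) (v j)))"
proof -
  have ne: "cball 0 R \<noteq> ({} :: 'a set)" using R by auto
  have "cmod (f (closest_point (cball 0 R) (v j))) \<le> R" for v :: "int \<Rightarrow> 'a"
    using f(1)[of "closest_point (cball 0 R) (v j)"] closest_point_in_set[OF closed_cball ne, of "v j"]
    by (simp add: dist_norm)
  moreover have "cmod (f (closest_point (cball 0 R) (v j)) - f (closest_point (cball 0 R) (w j))) \<le> 1 * B"
    if "\<forall>j. norm (v j - w j) \<le> B" for v w :: "int \<Rightarrow> 'a" and B
  proof -
    have "cmod (f (closest_point (cball 0 R) (v j)) - f (closest_point (cball 0 R) (w j))) \<le>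
      dist (closest_point (cball 0 R) (v j)) (closest_point (cball 0 R) (w j))"
      unfolding f(2)[symmetric] dist_norm by (rule f(1))
    also have "\<dots> \<le> dist (v j) (w j)" by (rule closest_point_lipschitz[OF convex_cball closed_cball ne])
    finally show ?thesis using that by (simp add: dist_norm) (meson order_trans)
  qed
  ultimately show ?thesis unfolding bounded_lipschitz_def by blast
qed

lemma bounded_lipschitz_Pair:
  assumes "bounded_lipschitz \<phi>" "bounded_lipschitz \<psi>"
  shows "\<exists>L. \<forall>v w B. (\<forall>j. norm (v j - w j) \<le> B) \<longrightarrow> norm ((\<phi> v, \<psi> v) - (\<phi> w, \<psi> w)) \<le> L * B"
proof -
  obtain L1 where 1: "\<And>v w B. (\<And>j. norm (v j - w j) \<le> B) \<Longrightarrow> cmod (\<phi> v - \<phi> w) \<le> L1 * B"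
    using assms(1) unfolding bounded_lipschitz_def by metis
  obtain L2 where 2: "\<And>v w B. (\<And>j. norm (v j - w j) \<le> B) \<Longrightarrow> cmod (\<psi> v - \<psi> w) \<le> L2 * B"
    using assms(2) unfolding bounded_lipschitz_def by metis
  have "norm ((\<phi> v, \<psi> v) - (\<phi> w, \<psi> w)) \<le> (L1 + L2) * B" if "\<And>j. norm (v j - w j) \<le> B" for v w B
    using norm_Pair_le[of "\<phi> v - \<phi> w" "\<psi> v - \<psi> w"] 1[of v w B, OF that] 2[of v w B, OF that]
    by (simp add: algebra_simps)
  then show ?thesis by blast
qed

lemma bounded_lipschitz_fourier_coeff_mult:
  assumes "finite I" "\<And>j. bounded_lipschitz (\<lambda>v. p v j)" "\<And>j. bounded_lipschitz (\<lambda>v. q v j)"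
  shows "bounded_lipschitz (\<lambda>v. fourier_coeff (\<lambda>x. trig_poly I (p v) x * trig_poly I (q v) x) k)"
  unfolding fourier_coeff_mult_trig_poly[OF assms(1)]
proof (intro bounded_lipschitz_sum)
  fix i j
  show "bounded_lipschitz (\<lambda>v. if i + j = k then p v i * q v j else 0)"
    by (cases "i + j = k") (simp_all add: bounded_lipschitz_mult bounded_lipschitz_const assms)
qed

section \<open>The right-hand side of the system\<close>

definition bfd_rhs1 ::
  "real \<Rightarrow> real \<Rightarrow> real \<Rightarrow> (real \<Rightarrow> complex) \<Rightarrow> (real \<Rightarrow> complex) \<Rightarrow> int \<Rightarrow> complex" where
  "bfd_rhs1 \<gamma> a b f g k = (let \<kappa> = 2 * pi * of_int k in
     \<i> / of_real \<gamma> * of_real (\<kappa> / (1 + b * \<kappa>\<^sup>2)) * fourier_coeff (\<lambda>x. f x * g x) k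
     - \<i> * of_real (\<kappa> / (1 + b * \<kappa>\<^sup>2) * bfd_symbol \<gamma> a \<kappa>) * fourier_coeff g k)"

definition bfd_rhs2 ::
  "real \<Rightarrow> real \<Rightarrow> real \<Rightarrow> (real \<Rightarrow> complex) \<Rightarrow> (real \<Rightarrow> complex) \<Rightarrow> int \<Rightarrow> complex" where
  "bfd_rhs2 \<gamma> c d f g k = (let \<kappa> = 2 * pi * of_int k in
     \<i> / (2 * of_real \<gamma>) * of_real (\<kappa> / (1 + d * \<kappa>\<^sup>2)) * fourier_coeff (\<lambda>x. (g x)\<^sup>2) k
     - \<i> * of_real (\<kappa> * ((1 - \<gamma>) * (1 - c * \<kappa>\<^sup>2)) / (1 + d * \<kappa>\<^sup>2)) * fourier_coeff f k)"

lemma bfd_modes_iff: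
  "bfd_modes \<gamma> a b c d T K f\<^sub>0 g\<^sub>0 f g \<longleftrightarrow>
    (\<forall>k\<in>K. fourier_coeff (f 0) k = fourier_coeff f\<^sub>0 k \<and> fourier_coeff (g 0) k = fourier_coeff g\<^sub>0 k) \<and>
    (\<forall>k\<in>K. \<forall>t\<in>{0..T}.
      ((\<lambda>r. fourier_coeff (f r) k) has_vector_derivative bfd_rhs1 \<gamma> a b (f t) (g t) k) (at t within {0..T}) \<and>
      ((\<lambda>r. fourier_coeff (g r) k) has_vector_derivative bfd_rhs2 \<gamma> c d (f t) (g t) k) (at t within {0..T}))"
  unfolding bfd_modes_def bfd_rhs1_def bfd_rhs2_def Let_def ..

lemma has_real_derivative_cmod_power2:
  assumes "(f has_vector_derivative f') (at t within S)"
  shows "((\<lambda>r. (cmod (f r))\<^sup>2) has_real_derivative 2 * Re (f' * cnj (f t))) (at t within S)"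
proof -
  show ?thesis
    unfolding cmod_power2
    using DERIV_add[OF DERIV_power[OF has_field_derivative_Re[OF assms], of 2]
        DERIV_power[OF has_field_derivative_Im[OF assms], of 2]]
    by (simp add: algebra_simps)
qed

text \<open>Parseval's identity splits the squared error: modes in \<open>I\<close> give the
  coefficient differences, the others only the tail of z, which the Sobolev bound makes of size
  N^(-2\<mu>).\<close>

lemma L2_norm_trig_poly_diff_le:
  assumes z: "square_integrable z" and M: "coeff_bounded \<mu> M (fourier_coeff z)" and \<mu>: "\<mu> \<ge> 1"
    and N: "N \<ge> 1" and I: "I = {- int N..int N}"
  shows "(L2_norm (\<lambda>x. trig_poly I c x - z x))\<^sup>2 \<le>
    (\<Sum>k\<in>I. (cmod (c k - fourier_coeff z k))\<^sup>2) + M * (real N powr (- \<mu>))\<^sup>2"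
proof -
  define g where "g x = trig_poly I c x - z x" for x
  have fI: "finite I" by (simp add: I)
  have g: "square_integrable g"
    unfolding g_def by (intro square_integrable_diff square_integrable_trig_poly z)
  have gc: "fourier_coeff g k = (if k \<in> I then c k else 0) - fourier_coeff z k" for k
    unfolding g_def
    by (simp add: fourier_coeff_diff square_integrable_integrable square_integrable_trig_poly z
        fourier_coeff_trig_poly fI)
  have "(\<Sum>k\<in>F. cmod (fourier_coeff g k)) \<le> (\<Sum>k\<in>I. cmod (c k)) + sqrt 5 * sqrt M" if F: "finite F" for F
  proof -
    have "(\<Sum>k\<in>F. cmod (fourier_coeff g k)) \<le>
        (\<Sum>k\<in>F. cmod (if k \<in> I then c k else 0) + cmod (fourier_coeff z k))"
      unfolding gc by (intro sum_mono norm_triangle_ineq4)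
    also have "\<dots> = (\<Sum>k\<in>F. cmod (if k \<in> I then c k else 0)) + (\<Sum>k\<in>F. cmod (fourier_coeff z k))"
      by (rule sum.distrib)
    also have "(\<Sum>k\<in>F. cmod (if k \<in> I then c k else 0)) = (\<Sum>k\<in>F \<inter> I. cmod (c k))"
      using F by (simp add: sum.inter_restrict if_distrib[of cmod] cong: if_cong)
    also have "\<dots> \<le> (\<Sum>k\<in>I. cmod (c k))" using fI by (intro sum_mono2) auto
    finally show ?thesis using coeff_bounded_sum_norm[OF M \<mu> F] by linarith
  qed
  then have lim: "(\<lambda>n. \<Sum>k\<in>{- int n..int n}. (cmod (fourier_coeff g k))\<^sup>2) \<longlonglongrightarrow> (L2_norm g)\<^sup>2"
    by (rule absolutely_summable_fourier_series(2)[OF g])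
  have "(\<Sum>k\<in>{- int n..int n}. (cmod (fourier_coeff g k))\<^sup>2) \<le>
    (\<Sum>k\<in>I. (cmod (c k - fourier_coeff z k))\<^sup>2) + M * (real N powr (- \<mu>))\<^sup>2" if n: "n \<ge> N" for n
  proof -
    have sub: "I \<subseteq> {- int n..int n}" using n by (auto simp: I)
    have "(\<Sum>k\<in>{- int n..int n}. (cmod (fourier_coeff g k))\<^sup>2) =
      (\<Sum>k\<in>{- int n..int n} - I. (cmod (fourier_coeff g k))\<^sup>2) + (\<Sum>k\<in>I. (cmod (fourier_coeff g k))\<^sup>2)"
      by (rule sum.subset_diff[OF sub]) simp
    also have "(\<Sum>k\<in>{- int n..int n} - I. (cmod (fourier_coeff g k))\<^sup>2) =
      (\<Sum>k\<in>{- int n..int n} - I. (cmod (fourier_coeff z k))\<^sup>2)"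
      by (intro sum.cong) (auto simp: gc)
    also have "\<dots> \<le> M * (real N powr (- \<mu>))\<^sup>2"
      by (rule coeff_bounded_tail[OF M \<mu> _ N]) (auto simp: I)
    also have "(\<Sum>k\<in>I. (cmod (fourier_coeff g k))\<^sup>2) = (\<Sum>k\<in>I. (cmod (c k - fourier_coeff z k))\<^sup>2)"
      by (intro sum.cong) (auto simp: gc)
    finally show ?thesis by simp
  qed
  then have "(L2_norm g)\<^sup>2 \<le> (\<Sum>k\<in>I. (cmod (c k - fourier_coeff z k))\<^sup>2) + M * (real N powr (- \<mu>))\<^sup>2"
    by (intro LIMSEQ_le_const2[OF lim]) blast
  then show ?thesis by (simp add: g_def[abs_def])
qed

lemma L2_norm_le_coeff_bounded:
  assumes z: "square_integrable z" and M: "coeff_bounded \<mu> M (fourier_coeff z)" and \<mu>: "\<mu> \<ge> 1"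
  shows "L2_norm z \<le> sqrt M" and "AE x in I01. cmod (z x) \<le> sqrt 5 * sqrt M"
proof -
  note * = absolutely_summable_fourier_series[OF z coeff_bounded_sum_norm[OF M \<mu>]]
  have "(L2_norm z)\<^sup>2 \<le> M"
    by (rule LIMSEQ_le_const2[OF *(2)]) (auto intro: coeff_bounded_l2[OF M \<mu>])
  then show "L2_norm z \<le> sqrt M" by (rule real_le_rsqrt)
  show "AE x in I01. cmod (z x) \<le> sqrt 5 * sqrt M" by (rule *(1))
qed

text \<open>With E = f - z and F = g - u the difference of the products is E F + E u + z F.
  Cauchy-Schwarz bounds the integral of each term, and X \<le> 2 K turns the quadratic one into 2 K
  X; hence 4 = 2 + 1 + 1.\<close>

lemma norm_fourier_coeff_mult_diff_le:
  assumes sq: "square_integrable f" "square_integrable g" "square_integrable z" "square_integrable u"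
    and X: "L2_norm (\<lambda>x. f x - z x) \<le> X" "L2_norm (\<lambda>x. g x - u x) \<le> X" "X \<le> 2 * K"
    and K: "L2_norm z \<le> K" "L2_norm u \<le> K"
  shows "cmod (fourier_coeff (\<lambda>x. f x * g x) k - fourier_coeff (\<lambda>x. z x * u x) k) \<le> 4 * K * X"
proof -
  define E where "E x = f x - z x" for x
  define F where "F x = g x - u x" for x
  have E: "square_integrable E" and F: "square_integrable F"
    unfolding E_def F_def by (intro square_integrable_diff sq)+
  have X0: "0 \<le> X" using X(1) L2_norm_nonneg order_trans by blast
  have K0: "0 \<le> K" using K(1) L2_norm_nonneg order_trans by blast
  have EX: "L2_norm E \<le> X" and FX: "L2_norm F \<le> X" using X by (simp_all add: E_def[abs_def] F_def[abs_def])
  have ints: "integrable I01 (\<lambda>x. f x * g x)" "integrable I01 (\<lambda>x. z x * u x)"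
    "integrable I01 (\<lambda>x. E x * F x)" "integrable I01 (\<lambda>x. E x * u x)" "integrable I01 (\<lambda>x. z x * F x)"
    by (intro integrable_mult_square_integrable sq E F)+
  have "fourier_coeff (\<lambda>x. f x * g x) k - fourier_coeff (\<lambda>x. z x * u x) k =
      fourier_coeff (\<lambda>x. f x * g x - z x * u x) k"
    using ints by (simp add: fourier_coeff_diff)
  also have "cmod \<dots> \<le> (LINT x|I01. cmod (f x * g x - z x * u x))"
    using ints by (intro norm_fourier_coeff_le Bochner_Integration.integrable_diff)
  also have "\<dots> \<le> (LINT x|I01. cmod (E x * F x) + cmod (E x * u x) + cmod (z x * F x))"
  proof (rule integral_mono)
    show "integrable I01 (\<lambda>x. cmod (f x * g x - z x * u x))"
      using ints by (intro integrable_norm Bochner_Integration.integrable_diff)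
    show "integrable I01 (\<lambda>x. cmod (E x * F x) + cmod (E x * u x) + cmod (z x * F x))"
      using ints by (intro Bochner_Integration.integrable_add integrable_norm)
    show "cmod (f x * g x - z x * u x) \<le> cmod (E x * F x) + cmod (E x * u x) + cmod (z x * F x)" for x
    proof -
      have "f x * g x - z x * u x = E x * F x + E x * u x + z x * F x"
        by (simp add: E_def F_def algebra_simps)
      then show ?thesis
        using norm_triangle_ineq[of "E x * F x + E x * u x" "z x * F x"]
          norm_triangle_ineq[of "E x * F x" "E x * u x"] by simp
    qed
  qed
  also have "\<dots> = (LINT x|I01. cmod (E x * F x)) + (LINT x|I01. cmod (E x * u x)) + (LINT x|I01. cmod (z x * F x))"
    using ints integrable_norm[OF ints(3)] integrable_norm[OF ints(4)] integrable_norm[OF ints(5)]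
    by simp
  also have "\<dots> \<le> L2_norm E * L2_norm F + L2_norm E * L2_norm u + L2_norm z * L2_norm F"
    by (intro add_mono integral_mult_le_L2_norm sq E F)
  also have "\<dots> \<le> (2 * K) * X + X * K + K * X"
    using EX FX X K X0 K0 by (intro add_mono mult_mono L2_norm_nonneg order_trans[OF EX X(3)]) auto
  finally show ?thesis by simp
qed

section \<open>The energy estimate\<close>

text \<open>Under \<open>v * B = A\<close> the coupling terms combine to -i A (F cnj E + E cnj F),
  which is i times a real number and has no real part. The second nonlinear term is left as it is,
  to be estimated together with its weight.\<close>

lemma linear_part_cancels:
  fixes E F P Q :: complex and A B v r1 r2 :: real
  assumes "v * B = A"
  shows "Re ((\<i> * of_real r1 * P - \<i> * of_real A * F) * cnj E) + v * Re ((\<i> * of_real r2 * Q - \<i> * of_real B * E) * cnj F)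
    \<le> cmod E * (\<bar>r1\<bar> * cmod P) + v * Re (\<i> * of_real r2 * Q * cnj F)"
proof -
  have "Re ((\<i> * of_real r1 * P - \<i> * of_real A * F) * cnj E) + v * Re ((\<i> * of_real r2 * Q - \<i> * of_real B * E) * cnj F)
    = Re (\<i> * of_real r1 * P * cnj E) + v * Re (\<i> * of_real r2 * Q * cnj F)"
    unfolding assms[symmetric] by (simp add: algebra_simps)
  moreover have "Re (\<i> * of_real r1 * P * cnj E) \<le> cmod E * (\<bar>r1\<bar> * cmod P)"
    using complex_Re_le_cmod[of "\<i> * of_real r1 * P * cnj E"] by (simp add: norm_mult mult_ac)
  ultimately show ?thesis by linarith
qed

lemma rhs_diff:
  fixes F1 F2 G1 G2 :: complex and r X Y :: real
  shows "(\<i> / of_real r * of_real X * F1 - \<i> * of_real Y * G1) - (\<i> / of_real r * of_real X * F2 - \<i> * of_real Y * G2)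
    = \<i> * of_real (X / r) * (F1 - F2) - \<i> * of_real Y * (G1 - G2)"
  by (simp add: algebra_simps diff_divide_distrib)

text \<open>Both parameter cases share this setting and are told apart only by
  \<open>\<beta>_le\<close>. \<open>M\<close> bounds the squared Sobolev norms of the exact solution
  uniformly in time, \<open>s\<close> bounds the weight from below, and \<open>R\<close> measures
  the smoothing of the nonlinear terms.\<close>

locale bfd_setting =
  fixes \<gamma> a b c d T \<mu> M s R :: real and \<zeta> u :: "real \<Rightarrow> real \<Rightarrow> complex"
    and w :: "int \<Rightarrow> real" and \<alpha> \<beta> :: "int \<Rightarrow> real"
  assumes \<gamma>: "0 < \<gamma>" "\<gamma> < 1" and b: "b > 0" and d: "d > 0" and c: "c \<le> 0"
    and \<mu>: "\<mu> \<ge> 1" and T: "T > 0" and s: "s > 0" and R: "R > 0"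
  defines "w \<equiv> \<lambda>k. energy_weight \<gamma> a b c d (2 * pi * of_int k)"
    and "\<alpha> \<equiv> \<lambda>k. (2 * pi * of_int k) / (1 + b * (2 * pi * of_int k)\<^sup>2)"
    and "\<beta> \<equiv> \<lambda>k. (2 * pi * of_int k) / (1 + d * (2 * pi * of_int k)\<^sup>2)"
  assumes w_ge: "\<And>k. s \<le> w k"
    and \<alpha>_le: "\<And>k. (\<alpha> k)\<^sup>2 \<le> R / (1 + (of_int k)\<^sup>2)"
    and \<beta>_le: "(\<forall>k. w k * (\<beta> k)\<^sup>2 \<le> R / (1 + (of_int k)\<^sup>2)) \<or>
      (\<forall>k. w k * (\<beta> k)\<^sup>2 \<le> R \<and> s * (1 + (of_int k)\<^sup>2) \<le> w k)"
    and sq: "\<And>t. t \<in> {0..T} \<Longrightarrow> square_integrable (\<zeta> t)" "\<And>t. t \<in> {0..T} \<Longrightarrow> square_integrable (u t)"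
    and M: "\<And>t. t \<in> {0..T} \<Longrightarrow> coeff_bounded \<mu> M (fourier_coeff (\<zeta> t))"
      "\<And>t. t \<in> {0..T} \<Longrightarrow> coeff_bounded \<mu> M (fourier_coeff (u t))"
    and exact: "\<And>k t. t \<in> {0..T} \<Longrightarrow>
        ((\<lambda>r. fourier_coeff (\<zeta> r) k) has_vector_derivative bfd_rhs1 \<gamma> a b (\<zeta> t) (u t) k) (at t within {0..T})"
      "\<And>k t. t \<in> {0..T} \<Longrightarrow>
        ((\<lambda>r. fourier_coeff (u r) k) has_vector_derivative bfd_rhs2 \<gamma> c d (\<zeta> t) (u t) k) (at t within {0..T})"
begin

definition modes :: "nat \<Rightarrow> int set" where
  "modes N = {- int N..int N}"

definition \<delta> :: "nat \<Rightarrow> real" where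
  "\<delta> N = real N powr (- \<mu>)"

text \<open>Takes coefficient families instead of functions, so that it also applies to a modified
  system before its solution is known to be a Galerkin approximation.\<close>

definition err :: "nat \<Rightarrow> (int \<Rightarrow> complex) \<Rightarrow> (int \<Rightarrow> complex) \<Rightarrow> real \<Rightarrow> real" where
  "err N p q t = (\<Sum>k\<in>modes N. (cmod (p k - fourier_coeff (\<zeta> t) k))\<^sup>2 + w k * (cmod (q k - fourier_coeff (u t) k))\<^sup>2)"

text \<open>One constant for three roles: \<open>sqrt M\<close> bounds the exact solution in L2,
  \<open>1 / sqrt s\<close> converts the weighted error of u into an L2 error, and 1 does so for the
  unweighted error of \<zeta>.\<close>

definition K\<^sub>0 :: real where
  "K\<^sub>0 = 1 + sqrt M + 1 / sqrt s"

text \<open>\<open>sqrt (5 * R)\<close> comes from summing the squared smoothing factors,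
  \<open>4 * K\<^sub>0\<^sup>2\<close> from the estimate of products, and the division by \<gamma>
  from the coefficients of the nonlinear terms.\<close>

definition K :: real where
  "K = sqrt (5 * R) / \<gamma> * (4 * K\<^sub>0\<^sup>2)"

lemma finite_modes [simp]: "finite (modes N)"
  by (simp add: modes_def)

lemma w_pos: "w k > 0"
  using w_ge[of k] s by linarith

lemma M_nonneg: "M \<ge> 0"
  using M(1)[of 0] T unfolding coeff_bounded_def by (auto dest: spec[of _ "{}"])

lemma K0_bounds: "1 \<le> K\<^sub>0" "sqrt M \<le> K\<^sub>0" "1 / sqrt s \<le> K\<^sub>0" "sqrt M + 1 / sqrt s \<le> K\<^sub>0"
  using M_nonneg s by (auto simp: K\<^sub>0_def)

lemma K_nonneg: "K \<ge> 0"
  using R \<gamma> by (simp add: K_def)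

lemma \<delta>_bounds: "0 \<le> \<delta> N" "N \<ge> 1 \<Longrightarrow> \<delta> N \<le> 1"
  using \<mu> powr_mono[of "- \<mu>" 0 "real N"] by (auto simp: \<delta>_def)

lemma err_nonneg: "err N p q t \<ge> 0"
  unfolding err_def by (intro sum_nonneg add_nonneg_nonneg mult_nonneg_nonneg) (auto intro: less_imp_le w_pos)

lemma sum_err_le:
  "(\<Sum>k\<in>modes N. (cmod (p k - fourier_coeff (\<zeta> t) k))\<^sup>2) \<le> err N p q t"
  "(\<Sum>k\<in>modes N. w k * (cmod (q k - fourier_coeff (u t) k))\<^sup>2) \<le> err N p q t"
  "(\<Sum>k\<in>modes N. (cmod (q k - fourier_coeff (u t) k))\<^sup>2) \<le> err N p q t / s"
proof -
  have pos: "0 \<le> w k * (cmod z)\<^sup>2" for k z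
    using w_pos[of k] by simp
  show "(\<Sum>k\<in>modes N. (cmod (p k - fourier_coeff (\<zeta> t) k))\<^sup>2) \<le> err N p q t"
    unfolding err_def by (intro sum_mono) (use pos in auto)
  show *: "(\<Sum>k\<in>modes N. w k * (cmod (q k - fourier_coeff (u t) k))\<^sup>2) \<le> err N p q t"
    unfolding err_def by (intro sum_mono) auto
  have "s * (\<Sum>k\<in>modes N. (cmod (q k - fourier_coeff (u t) k))\<^sup>2) \<le>
      (\<Sum>k\<in>modes N. w k * (cmod (q k - fourier_coeff (u t) k))\<^sup>2)"
    unfolding sum_distrib_left by (intro sum_mono mult_right_mono w_ge) auto
  then show "(\<Sum>k\<in>modes N. (cmod (q k - fourier_coeff (u t) k))\<^sup>2) \<le> err N p q t / s"
    using * s by (simp add: field_simps)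
qed

text \<open>The energy controls the modes of S_N with factor 1 or 1 / s, and the tail of the exact
  solution contributes the multiple of \<open>\<delta> N\<close>.\<close>

lemma L2_error_le:
  assumes N: "N \<ge> 1" and t: "t \<in> {0..T}"
  shows "L2_norm (\<lambda>x. trig_poly (modes N) p x - \<zeta> t x) \<le> K\<^sub>0 * (sqrt (err N p q t) + \<delta> N)"
    and "L2_norm (\<lambda>x. trig_poly (modes N) q x - u t x) \<le> K\<^sub>0 * (sqrt (err N p q t) + \<delta> N)"
proof -
  define e where "e = err N p q t"
  have e: "e \<ge> 0" by (simp add: e_def err_nonneg)
  have D: "\<delta> N \<ge> 0" by (rule \<delta>_bounds)
  have final: "L \<le> K\<^sub>0 * (sqrt e + \<delta> N)" if "L\<^sup>2 \<le> r * e + M * (\<delta> N)\<^sup>2" "r \<ge> 0" "sqrt r \<le> K\<^sub>0" for L r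
  proof -
    have "L \<le> sqrt (r * e + M * (\<delta> N)\<^sup>2)" using that(1) by (rule real_le_rsqrt)
    also have "\<dots> \<le> sqrt (r * e) + sqrt (M * (\<delta> N)\<^sup>2)"
      using that e M_nonneg by (intro sqrt_add_le_add_sqrt) auto
    also have "\<dots> = sqrt r * sqrt e + sqrt M * \<delta> N" using D by (simp add: real_sqrt_mult)
    also have "\<dots> \<le> K\<^sub>0 * sqrt e + K\<^sub>0 * \<delta> N"
      using that K0_bounds e D by (intro add_mono mult_right_mono) auto
    finally show ?thesis by (simp add: distrib_left)
  qed
  show "L2_norm (\<lambda>x. trig_poly (modes N) p x - \<zeta> t x) \<le> K\<^sub>0 * (sqrt (err N p q t) + \<delta> N)"
    unfolding e_def[symmetric]
  proof (rule final[of _ 1])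
    show "(L2_norm (\<lambda>x. trig_poly (modes N) p x - \<zeta> t x))\<^sup>2 \<le> 1 * e + M * (\<delta> N)\<^sup>2"
      using L2_norm_trig_poly_diff_le[OF sq(1)[OF t] M(1)[OF t] \<mu> N modes_def, of p] sum_err_le(1)[where N = N and t = t and p = p and q = q]
      by (simp add: e_def \<delta>_def)
  qed (use K0_bounds in auto)
  show "L2_norm (\<lambda>x. trig_poly (modes N) q x - u t x) \<le> K\<^sub>0 * (sqrt (err N p q t) + \<delta> N)"
    unfolding e_def[symmetric]
  proof (rule final[of _ "1 / s"])
    show "(L2_norm (\<lambda>x. trig_poly (modes N) q x - u t x))\<^sup>2 \<le> 1 / s * e + M * (\<delta> N)\<^sup>2"
      using L2_norm_trig_poly_diff_le[OF sq(2)[OF t] M(2)[OF t] \<mu> N modes_def, of q] sum_err_le(3)[where p = p and q = q and N = N and t = t]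
      by (simp add: e_def \<delta>_def)
  qed (use K0_bounds s in \<open>auto simp: real_sqrt_divide\<close>)
qed

lemma exact_bounds:
  assumes t: "t \<in> {0..T}"
  shows "L2_norm (\<zeta> t) \<le> K\<^sub>0" "L2_norm (u t) \<le> K\<^sub>0"
  using L2_norm_le_coeff_bounded(1)[OF sq(1)[OF t] M(1)[OF t] \<mu>]
    L2_norm_le_coeff_bounded(1)[OF sq(2)[OF t] M(2)[OF t] \<mu>] K0_bounds by auto

lemma sqrt_sum_smoothing_le:
  assumes v: "\<And>k. v k \<le> R / (1 + (of_int k)\<^sup>2)" and z: "\<And>k. cmod (z k) \<le> X" and F: "finite F"
  shows "sqrt (\<Sum>k\<in>F. v k * (cmod (z k))\<^sup>2) \<le> sqrt (5 * R) * X"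
proof -
  have X: "0 \<le> X" using z norm_ge_zero order_trans by blast
  have "(\<Sum>k\<in>F. v k * (cmod (z k))\<^sup>2) \<le> (\<Sum>k\<in>F. (R / (1 + (of_int k)\<^sup>2)) * X\<^sup>2)"
    using v z R by (intro sum_mono mult_mono power_mono) (auto intro: add_nonneg_nonneg)
  also have "\<dots> = R * X\<^sup>2 * (\<Sum>k\<in>F. 1 / (1 + (real_of_int k)\<^sup>2))"
    by (simp add: sum_distrib_left mult_ac)
  also have "\<dots> \<le> R * X\<^sup>2 * 5"
    using sum_inverse_square_le[OF F] R by (intro mult_left_mono) auto
  finally have "sqrt (\<Sum>k\<in>F. v k * (cmod (z k))\<^sup>2) \<le> sqrt (5 * R * X\<^sup>2)"
    by (simp add: mult_ac)
  then show ?thesis using X by (simp add: real_sqrt_mult)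
qed

lemma nonlinear_bounds:
  fixes p q :: "int \<Rightarrow> complex"
  assumes N: "N \<ge> 1" and t: "t \<in> {0..T}" and small: "err N p q t \<le> 1"
  defines "f \<equiv> trig_poly (modes N) p" and "g \<equiv> trig_poly (modes N) q"
  shows "sqrt (\<Sum>k\<in>modes N. (\<alpha> k)\<^sup>2 * (cmod (fourier_coeff (\<lambda>x. f x * g x) k - fourier_coeff (\<lambda>x. \<zeta> t x * u t x) k))\<^sup>2)
      \<le> sqrt (5 * R) * (4 * K\<^sub>0\<^sup>2) * (sqrt (err N p q t) + \<delta> N)"
    and "sqrt (\<Sum>k\<in>modes N. w k * (\<beta> k)\<^sup>2 * (cmod (fourier_coeff (\<lambda>x. (g x)\<^sup>2) k - fourier_coeff (\<lambda>x. (u t x)\<^sup>2) k))\<^sup>2)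
      \<le> sqrt (5 * R) * (4 * K\<^sub>0\<^sup>2) * (sqrt (err N p q t) + \<delta> N)"
proof -
  define y where "y = sqrt (err N p q t) + \<delta> N"
  have "sqrt (err N p q t) \<le> 1" "0 \<le> sqrt (err N p q t)" using small by (simp_all add: err_nonneg)
  \<comment> \<open>Both summands are at most 1; this supplies the condition X \<le> 2 K of the
    product estimate.\<close>
  then have y: "0 \<le> y" "y \<le> 2"
    unfolding y_def using \<delta>_bounds(1)[of N] \<delta>_bounds(2)[OF N] by linarith+
  have f: "square_integrable f" and g: "square_integrable g"
    by (simp_all add: f_def g_def square_integrable_trig_poly)
  have E: "L2_norm (\<lambda>x. f x - \<zeta> t x) \<le> K\<^sub>0 * y" and F: "L2_norm (\<lambda>x. g x - u t x) \<le> K\<^sub>0 * y"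
    using L2_error_le(1)[OF N t, where p = p and q = q] L2_error_le(2)[OF N t, where p = p and q = q]
    by (simp_all add: f_def g_def y_def)
  have K0y: "K\<^sub>0 * y \<le> 2 * K\<^sub>0" using y K0_bounds by (simp add: mult.commute mult_left_mono)
  have p_le: "cmod (fourier_coeff (\<lambda>x. f x * g x) k - fourier_coeff (\<lambda>x. \<zeta> t x * u t x) k) \<le> 4 * K\<^sub>0\<^sup>2 * y" for k
    using norm_fourier_coeff_mult_diff_le[OF f g sq[OF t] E F K0y exact_bounds[OF t], of k]
    by (simp add: power2_eq_square mult_ac)
  have q_le: "cmod (fourier_coeff (\<lambda>x. (g x)\<^sup>2) k - fourier_coeff (\<lambda>x. (u t x)\<^sup>2) k) \<le> 4 * K\<^sub>0\<^sup>2 * y" for k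
    using norm_fourier_coeff_mult_diff_le[OF g g sq(2)[OF t] sq(2)[OF t] F F K0y exact_bounds(2)[OF t] exact_bounds(2)[OF t], of k]
    by (simp add: power2_eq_square mult_ac)
  show "sqrt (\<Sum>k\<in>modes N. (\<alpha> k)\<^sup>2 * (cmod (fourier_coeff (\<lambda>x. f x * g x) k - fourier_coeff (\<lambda>x. \<zeta> t x * u t x) k))\<^sup>2)
      \<le> sqrt (5 * R) * (4 * K\<^sub>0\<^sup>2) * (sqrt (err N p q t) + \<delta> N)"
    using sqrt_sum_smoothing_le[OF \<alpha>_le p_le finite_modes[of N]] by (simp add: y_def mult.assoc)
  from \<beta>_le show "sqrt (\<Sum>k\<in>modes N. w k * (\<beta> k)\<^sup>2 * (cmod (fourier_coeff (\<lambda>x. (g x)\<^sup>2) k - fourier_coeff (\<lambda>x. (u t x)\<^sup>2) k))\<^sup>2)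
      \<le> sqrt (5 * R) * (4 * K\<^sub>0\<^sup>2) * (sqrt (err N p q t) + \<delta> N)"
  proof
    assume "\<forall>k. w k * (\<beta> k)\<^sup>2 \<le> R / (1 + (of_int k)\<^sup>2)"
    then show ?thesis
      using sqrt_sum_smoothing_le[OF _ q_le finite_modes[of N], of "\<lambda>k. w k * (\<beta> k)\<^sup>2"] by (simp add: y_def mult.assoc)
  next
    assume *: "\<forall>k. w k * (\<beta> k)\<^sup>2 \<le> R \<and> s * (1 + (of_int k)\<^sup>2) \<le> w k"
    define D where "D k = q k - fourier_coeff (u t) k" for k
    \<comment> \<open>Here the energy dominates the H^1 norm of the error of u on these modes, so
      its smallness bounds g uniformly.\<close>
    have "s * (\<Sum>k\<in>modes N. (1 + (of_int k)\<^sup>2) * (cmod (D k))\<^sup>2) \<le> (\<Sum>k\<in>modes N. w k * (cmod (D k))\<^sup>2)"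
      unfolding sum_distrib_left mult.assoc[symmetric] using * by (intro sum_mono mult_right_mono) auto
    also have "\<dots> \<le> 1" using sum_err_le(2)[where N = N and q = q and p = p and t = t] small by (simp add: D_def)
    finally have "(\<Sum>k\<in>modes N. (1 + (of_int k)\<^sup>2) * (cmod (D k))\<^sup>2) \<le> 1 / s"
      using s by (simp add: field_simps)
    then have D: "(\<Sum>k\<in>modes N. cmod (D k)) \<le> sqrt 5 * sqrt (1 / s)"
      by (rule weighted_sum_norm_le[OF finite_modes])
    have gb: "cmod (g x) \<le> sqrt 5 * sqrt (1 / s) + sqrt 5 * sqrt M" for x
    proof -
      have "cmod (g x) \<le> (\<Sum>k\<in>modes N. cmod (q k))" unfolding g_def by (rule norm_trig_poly_le)
      also have "\<dots> \<le> (\<Sum>k\<in>modes N. cmod (D k) + cmod (fourier_coeff (u t) k))"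
        unfolding D_def by (intro sum_mono) (metis diff_add_cancel norm_triangle_ineq)
      finally show ?thesis
        using D coeff_bounded_sum_norm[OF M(2)[OF t] \<mu> finite_modes[of N]] by (simp add: sum.distrib)
    qed
    have gu: "AE x in I01. cmod (g x + u t x) \<le> 2 * sqrt 5 * K\<^sub>0"
      using L2_norm_le_coeff_bounded(2)[OF sq(2)[OF t] M(2)[OF t] \<mu>]
    proof eventually_elim
      case (elim x)
      have "cmod (g x + u t x) \<le> sqrt 5 * (sqrt M + 1 / sqrt s) + sqrt 5 * sqrt M"
        using elim gb[of x] norm_triangle_ineq[of "g x" "u t x"] by (simp add: real_sqrt_divide algebra_simps)
      also have "\<dots> \<le> sqrt 5 * K\<^sub>0 + sqrt 5 * K\<^sub>0"
        using K0_bounds by (intro add_mono mult_left_mono) auto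
      finally show ?case by (simp add: mult_ac)
    qed
    \<comment> \<open>Factoring g^2 - u^2 leaves one factor small in L2 and one bounded almost
      everywhere. Bessel's inequality for \<open>h\<close> then replaces the missing summability of
      the weights.\<close>
    define h where "h x = (g x - u t x) * (g x + u t x)" for x
    have gd: "square_integrable (\<lambda>x. g x - u t x)" by (intro square_integrable_diff g sq t)
    have gm: "(\<lambda>x. g x + u t x) \<in> borel_measurable I01"
      using square_integrable_add[OF g sq(2)[OF t]] by (rule square_integrable_measurable)
    have h: "square_integrable h"
      unfolding h_def[abs_def] by (rule square_integrable_bounded_mult[OF gd gm gu])
    have h_norm: "(L2_norm h)\<^sup>2 \<le> (2 * sqrt 5 * K\<^sub>0 * (K\<^sub>0 * y))\<^sup>2"
    proof -
      have "(L2_norm h)\<^sup>2 \<le> (LINT x|I01. (2 * sqrt 5 * K\<^sub>0)\<^sup>2 * (cmod (g x - u t x))\<^sup>2)"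
        unfolding L2_norm_power2
      proof (rule integral_mono_AE)
        show "integrable I01 (\<lambda>x. (cmod (h x))\<^sup>2)" using h by (simp add: square_integrable_def)
        show "integrable I01 (\<lambda>x. (2 * sqrt 5 * K\<^sub>0)\<^sup>2 * (cmod (g x - u t x))\<^sup>2)"
          using gd by (simp add: square_integrable_def)
        show "AE x in I01. (cmod (h x))\<^sup>2 \<le> (2 * sqrt 5 * K\<^sub>0)\<^sup>2 * (cmod (g x - u t x))\<^sup>2"
          using gu
        proof eventually_elim
          case (elim x)
          then have "(cmod (g x + u t x))\<^sup>2 * (cmod (g x - u t x))\<^sup>2 \<le> (2 * sqrt 5 * K\<^sub>0)\<^sup>2 * (cmod (g x - u t x))\<^sup>2"
            by (intro mult_right_mono power_mono) auto
          then show ?case by (simp add: h_def norm_mult power_mult_distrib mult.commute)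
        qed
      qed
      also have "\<dots> = (2 * sqrt 5 * K\<^sub>0)\<^sup>2 * (L2_norm (\<lambda>x. g x - u t x))\<^sup>2"
        by (simp add: L2_norm_power2)
      also have "\<dots> \<le> (2 * sqrt 5 * K\<^sub>0)\<^sup>2 * (K\<^sub>0 * y)\<^sup>2"
        using F by (intro mult_left_mono power_mono L2_norm_nonneg) auto
      finally show ?thesis by (simp add: power_mult_distrib)
    qed
    have coeff: "fourier_coeff (\<lambda>x. (g x)\<^sup>2) k - fourier_coeff (\<lambda>x. (u t x)\<^sup>2) k = fourier_coeff h k" for k
      using integrable_mult_square_integrable[OF g g] integrable_mult_square_integrable[OF sq(2)[OF t] sq(2)[OF t]]
      by (subst fourier_coeff_diff[symmetric]) (auto simp: h_def[abs_def] power2_eq_square algebra_simps)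
    have "(\<Sum>k\<in>modes N. w k * (\<beta> k)\<^sup>2 * (cmod (fourier_coeff h k))\<^sup>2) \<le> (\<Sum>k\<in>modes N. R * (cmod (fourier_coeff h k))\<^sup>2)"
      using * by (intro sum_mono mult_right_mono) auto
    also have "\<dots> \<le> R * (2 * sqrt 5 * K\<^sub>0 * (K\<^sub>0 * y))\<^sup>2"
      unfolding sum_distrib_left[symmetric]
      using R bessel_inequality[OF h finite_modes[of N]] h_norm by (intro mult_left_mono) auto
    \<comment> \<open>The factor 20 is enlarged to 80 so that both cases end with the same
      bound.\<close>
    also have "\<dots> \<le> 5 * R * (4 * K\<^sub>0\<^sup>2 * y)\<^sup>2"
    proof -
      have "(2 * sqrt 5 * K\<^sub>0 * (K\<^sub>0 * y))\<^sup>2 = 20 * (K\<^sub>0\<^sup>2 * y)\<^sup>2"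
        by (simp add: power_mult_distrib power2_eq_square)
      also have "\<dots> \<le> 80 * (K\<^sub>0\<^sup>2 * y)\<^sup>2" by (intro mult_right_mono) auto
      also have "\<dots> = 5 * (4 * K\<^sub>0\<^sup>2 * y)\<^sup>2" by (simp add: power_mult_distrib)
      finally show ?thesis using R by simp
    qed
    finally have "sqrt (\<Sum>k\<in>modes N. w k * (\<beta> k)\<^sup>2 * (cmod (fourier_coeff h k))\<^sup>2) \<le> sqrt (5 * R * (4 * K\<^sub>0\<^sup>2 * y)\<^sup>2)"
      by (rule real_sqrt_le_mono)
    also have "\<dots> = sqrt (5 * R) * (4 * K\<^sub>0\<^sup>2 * y)"
      using y by (simp only: real_sqrt_mult real_sqrt_abs abs_of_nonneg[of "4 * K\<^sub>0\<^sup>2 * y"] mult_nonneg_nonneg zero_le_power2 zero_le_numeral)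
    finally show ?thesis unfolding coeff by (simp only: y_def mult.assoc)
  qed
qed

section \<open>Growth of the error energy\<close>

text \<open>The time derivative of \<open>err\<close> along curves with velocities p' and q', with
  the equations of the exact solution inserted.\<close>

definition err_deriv ::
  "nat \<Rightarrow> (int \<Rightarrow> complex) \<Rightarrow> (int \<Rightarrow> complex) \<Rightarrow> (int \<Rightarrow> complex) \<Rightarrow> (int \<Rightarrow> complex) \<Rightarrow> real \<Rightarrow> real" where
  "err_deriv N p q p' q' t = (\<Sum>k\<in>modes N.
     2 * Re ((p' k - bfd_rhs1 \<gamma> a b (\<zeta> t) (u t) k) * cnj (p k - fourier_coeff (\<zeta> t) k)) +
     w k * (2 * Re ((q' k - bfd_rhs2 \<gamma> c d (\<zeta> t) (u t) k) * cnj (q k - fourier_coeff (u t) k))))"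

text \<open>The relation \<open>v * B = A\<close> required by \<open>linear_part_cancels\<close>;
  the denominators are positive because b, d > 0, c \<le> 0 and \<gamma> < 1.\<close>

lemma weight_symbol:
  "w k * (2 * pi * of_int k * ((1 - \<gamma>) * (1 - c * (2 * pi * of_int k)\<^sup>2)) / (1 + d * (2 * pi * of_int k)\<^sup>2))
    = \<alpha> k * bfd_symbol \<gamma> a (2 * pi * of_int k)"
proof -
  define \<kappa> where "\<kappa> = 2 * pi * real_of_int k"
  have "1 + b * \<kappa>\<^sup>2 > 0" "1 + d * \<kappa>\<^sup>2 > 0" "1 - c * \<kappa>\<^sup>2 > 0"
    using b d mult_nonpos_nonneg[OF c zero_le_power2[of \<kappa>]] by (auto intro: add_pos_nonneg)
  then have "energy_weight \<gamma> a b c d \<kappa> * (\<kappa> * ((1 - \<gamma>) * (1 - c * \<kappa>\<^sup>2)) / (1 + d * \<kappa>\<^sup>2)) =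
      \<kappa> / (1 + b * \<kappa>\<^sup>2) * bfd_symbol \<gamma> a \<kappa>"
    using \<gamma> unfolding energy_weight_def by (simp add: divide_simps)
  then show ?thesis by (simp add: w_def \<alpha>_def \<kappa>_def)
qed


text \<open>Since the linear terms cancel mode by mode, the growth is a sum of products of errors
  with nonlinear differences. Cauchy-Schwarz over the modes bounds it by a multiple of y (y +
  \<delta>), where y is the root of the energy.\<close>

lemma err_deriv_le:
  assumes N: "N \<ge> 1" and t: "t \<in> {0..T}" and small: "err N p q t \<le> 1"
    and rhs: "\<And>k. k \<in> modes N \<Longrightarrow> p' k = bfd_rhs1 \<gamma> a b (trig_poly (modes N) p) (trig_poly (modes N) q) k"
      "\<And>k. k \<in> modes N \<Longrightarrow> q' k = bfd_rhs2 \<gamma> c d (trig_poly (modes N) p) (trig_poly (modes N) q) k"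
  shows "err_deriv N p q p' q' t \<le> 6 * K * (err N p q t + (\<delta> N)\<^sup>2)"
proof -
  define f where "f = trig_poly (modes N) p"
  define g where "g = trig_poly (modes N) q"
  define P where "P k = fourier_coeff (\<lambda>x. f x * g x) k - fourier_coeff (\<lambda>x. \<zeta> t x * u t x) k" for k
  define Q where "Q k = fourier_coeff (\<lambda>x. (g x)\<^sup>2) k - fourier_coeff (\<lambda>x. (u t x)\<^sup>2) k" for k
  define E where "E k = p k - fourier_coeff (\<zeta> t) k" for k
  define F where "F k = q k - fourier_coeff (u t) k" for k
  define y where "y = sqrt (err N p q t)"
  have y: "y \<ge> 0" by (simp add: y_def err_nonneg)
  define B where "B k = 2 * pi * of_int k * ((1 - \<gamma>) * (1 - c * (2 * pi * of_int k)\<^sup>2)) / (1 + d * (2 * pi * of_int k)\<^sup>2)" for k :: int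
  have double: "2 * x + v * (2 * y) \<le> 2 / \<gamma> * X" if "x + v * y \<le> X / \<gamma>" for x y v X :: real
  proof -
    have "2 * x + v * (2 * y) = 2 * (x + v * y)" by (simp add: algebra_simps)
    also have "\<dots> \<le> 2 * (X / \<gamma>)" using that by simp
    finally show ?thesis by simp
  qed
  have term_le: "2 * Re ((p' k - bfd_rhs1 \<gamma> a b (\<zeta> t) (u t) k) * cnj (E k)) +
     w k * (2 * Re ((q' k - bfd_rhs2 \<gamma> c d (\<zeta> t) (u t) k) * cnj (F k))) \<le>
     2 / \<gamma> * (cmod (E k) * (\<bar>\<alpha> k\<bar> * cmod (P k)) + (sqrt (w k) * cmod (F k)) * (sqrt (w k) * \<bar>\<beta> k\<bar> * cmod (Q k)))"
    if k: "k \<in> modes N" for k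
  proof -
    have fk: "fourier_coeff f k = p k" and gk: "fourier_coeff g k = q k"
      using k by (simp_all add: f_def g_def fourier_coeff_trig_poly)
    have 1: "p' k - bfd_rhs1 \<gamma> a b (\<zeta> t) (u t) k =
      \<i> * of_real (\<alpha> k / \<gamma>) * P k - \<i> * of_real (\<alpha> k * bfd_symbol \<gamma> a (2 * pi * of_int k)) * F k"
      unfolding rhs(1)[OF k] f_def[symmetric] g_def[symmetric] bfd_rhs1_def Let_def gk P_def F_def \<alpha>_def
      by (rule rhs_diff)
    have two: "2 * complex_of_real \<gamma> = of_real (2 * \<gamma>)" by simp
    have 2: "q' k - bfd_rhs2 \<gamma> c d (\<zeta> t) (u t) k =
      \<i> * of_real (\<beta> k / (2 * \<gamma>)) * Q k - \<i> * of_real (B k) * E k"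
      unfolding rhs(2)[OF k] f_def[symmetric] g_def[symmetric] bfd_rhs2_def Let_def fk Q_def E_def \<beta>_def B_def two
      by (rule rhs_diff)
    have "Re ((p' k - bfd_rhs1 \<gamma> a b (\<zeta> t) (u t) k) * cnj (E k)) + w k * Re ((q' k - bfd_rhs2 \<gamma> c d (\<zeta> t) (u t) k) * cnj (F k))
      \<le> cmod (E k) * (\<bar>\<alpha> k / \<gamma>\<bar> * cmod (P k)) + w k * Re (\<i> * of_real (\<beta> k / (2 * \<gamma>)) * Q k * cnj (F k))"
      unfolding 1 2 by (rule linear_part_cancels) (unfold B_def, rule weight_symbol)
    also have "\<dots> \<le> cmod (E k) * (\<bar>\<alpha> k / \<gamma>\<bar> * cmod (P k)) + w k * (\<bar>\<beta> k\<bar> / \<gamma> * cmod (Q k) * cmod (F k))"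
    proof (intro add_left_mono mult_left_mono)
      have "Re (\<i> * of_real (\<beta> k / (2 * \<gamma>)) * Q k * cnj (F k)) \<le> \<bar>\<beta> k\<bar> / (2 * \<gamma>) * cmod (Q k) * cmod (F k)"
        using complex_Re_le_cmod[of "\<i> * of_real (\<beta> k / (2 * \<gamma>)) * Q k * cnj (F k)"] \<gamma>
        by (simp add: norm_mult norm_divide)
      \<comment> \<open>Weakened from 1 / (2 \<gamma>) so that both equations carry the same
        factor.\<close>
      also have "\<dots> \<le> \<bar>\<beta> k\<bar> / \<gamma> * cmod (Q k) * cmod (F k)"
        using \<gamma> by (intro mult_right_mono divide_left_mono) auto
      finally show "Re (\<i> * of_real (\<beta> k / (2 * \<gamma>)) * Q k * cnj (F k)) \<le> \<bar>\<beta> k\<bar> / \<gamma> * cmod (Q k) * cmod (F k)" .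
    qed (use w_pos[of k] in simp)
    also have "\<dots> = (cmod (E k) * (\<bar>\<alpha> k\<bar> * cmod (P k)) + w k * (\<bar>\<beta> k\<bar> * cmod (Q k) * cmod (F k))) / \<gamma>"
      using \<gamma> by (simp add: add_divide_distrib)
    \<comment> \<open>One root of the weight goes to the error, where it forms the energy, the other
      to the nonlinear term, where it meets the smoothing factor.\<close>
    also have "w k * (\<bar>\<beta> k\<bar> * cmod (Q k) * cmod (F k)) =
        (sqrt (w k) * cmod (F k)) * (sqrt (w k) * \<bar>\<beta> k\<bar> * cmod (Q k))"
    proof -
      have "w k * (\<bar>\<beta> k\<bar> * cmod (Q k) * cmod (F k)) = (sqrt (w k) * sqrt (w k)) * (\<bar>\<beta> k\<bar> * cmod (Q k) * cmod (F k))"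
        using w_pos[of k] by simp
      then show ?thesis by (simp only: mult_ac)
    qed
    finally have le: "Re ((p' k - bfd_rhs1 \<gamma> a b (\<zeta> t) (u t) k) * cnj (E k)) + w k * Re ((q' k - bfd_rhs2 \<gamma> c d (\<zeta> t) (u t) k) * cnj (F k))
      \<le> (cmod (E k) * (\<bar>\<alpha> k\<bar> * cmod (P k)) + (sqrt (w k) * cmod (F k)) * (sqrt (w k) * \<bar>\<beta> k\<bar> * cmod (Q k))) / \<gamma>" .
    show ?thesis by (rule double[OF le])
  qed
  have E2: "sqrt (\<Sum>k\<in>modes N. (cmod (E k))\<^sup>2) \<le> y"
    unfolding y_def E_def by (intro real_sqrt_le_mono sum_err_le)
  have F2: "sqrt (\<Sum>k\<in>modes N. (sqrt (w k) * cmod (F k))\<^sup>2) \<le> y"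
    using real_sqrt_le_mono[OF sum_err_le(2)[where N = N and p = p and q = q and t = t]] w_pos
    by (simp add: y_def F_def power_mult_distrib less_imp_le)
  have P2: "sqrt (\<Sum>k\<in>modes N. (\<bar>\<alpha> k\<bar> * cmod (P k))\<^sup>2) \<le> \<gamma> * K * (y + \<delta> N)"
    using nonlinear_bounds(1)[OF N t small, folded f_def g_def, folded P_def y_def] \<gamma>
    by (simp add: power_mult_distrib K_def)
  have Q2: "sqrt (\<Sum>k\<in>modes N. (sqrt (w k) * \<bar>\<beta> k\<bar> * cmod (Q k))\<^sup>2) \<le> \<gamma> * K * (y + \<delta> N)"
    using nonlinear_bounds(2)[OF N t small, folded f_def g_def, folded Q_def y_def] \<gamma> w_pos
    by (simp add: power_mult_distrib K_def less_imp_le)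
  have "err_deriv N p q p' q' t \<le> (\<Sum>k\<in>modes N.
     2 / \<gamma> * (cmod (E k) * (\<bar>\<alpha> k\<bar> * cmod (P k)) + (sqrt (w k) * cmod (F k)) * (sqrt (w k) * \<bar>\<beta> k\<bar> * cmod (Q k))))"
    unfolding err_deriv_def E_def[symmetric] F_def[symmetric] by (intro sum_mono term_le)
  also have "\<dots> = 2 / \<gamma> * ((\<Sum>k\<in>modes N. cmod (E k) * (\<bar>\<alpha> k\<bar> * cmod (P k))) +
      (\<Sum>k\<in>modes N. (sqrt (w k) * cmod (F k)) * (sqrt (w k) * \<bar>\<beta> k\<bar> * cmod (Q k))))"
    by (simp only: sum_distrib_left[symmetric] sum.distrib)
  also have "\<dots> \<le> 2 / \<gamma> * (y * (\<gamma> * K * (y + \<delta> N)) + y * (\<gamma> * K * (y + \<delta> N)))"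
  proof (intro mult_left_mono add_mono)
    have "(\<Sum>k\<in>modes N. cmod (E k) * (\<bar>\<alpha> k\<bar> * cmod (P k))) \<le>
        sqrt (\<Sum>k\<in>modes N. (cmod (E k))\<^sup>2) * sqrt (\<Sum>k\<in>modes N. (\<bar>\<alpha> k\<bar> * cmod (P k))\<^sup>2)"
      by (rule Cauchy_Schwarz_sum_sqrt)
    also have "\<dots> \<le> y * (\<gamma> * K * (y + \<delta> N))"
      by (rule mult_mono[OF E2 P2 y]) (simp add: sum_nonneg)
    finally show "(\<Sum>k\<in>modes N. cmod (E k) * (\<bar>\<alpha> k\<bar> * cmod (P k))) \<le> y * (\<gamma> * K * (y + \<delta> N))" .
    have "(\<Sum>k\<in>modes N. (sqrt (w k) * cmod (F k)) * (sqrt (w k) * \<bar>\<beta> k\<bar> * cmod (Q k))) \<le>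
        sqrt (\<Sum>k\<in>modes N. (sqrt (w k) * cmod (F k))\<^sup>2) * sqrt (\<Sum>k\<in>modes N. (sqrt (w k) * \<bar>\<beta> k\<bar> * cmod (Q k))\<^sup>2)"
      by (rule Cauchy_Schwarz_sum_sqrt)
    also have "\<dots> \<le> y * (\<gamma> * K * (y + \<delta> N))"
      by (rule mult_mono[OF F2 Q2 y]) (simp add: sum_nonneg)
    finally show "(\<Sum>k\<in>modes N. (sqrt (w k) * cmod (F k)) * (sqrt (w k) * \<bar>\<beta> k\<bar> * cmod (Q k))) \<le> y * (\<gamma> * K * (y + \<delta> N))" .
  qed (use \<gamma> in simp)
  also have "\<dots> = K * (4 * y\<^sup>2 + 2 * (2 * y * \<delta> N))"
    using \<gamma> by (simp add: power2_eq_square algebra_simps)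
  \<comment> \<open>From 2 y \<delta> \<le> y^2 + \<delta>^2 comes 6 y^2 + 2 \<delta>^2, rounded up
    to the common factor 6.\<close>
  also have "\<dots> \<le> K * (4 * y\<^sup>2 + 2 * (y\<^sup>2 + (\<delta> N)\<^sup>2))"
    using sum_squares_bound[of y "\<delta> N"] K_nonneg by (intro mult_left_mono) auto
  also have "\<dots> \<le> K * (6 * (y\<^sup>2 + (\<delta> N)\<^sup>2))"
    using K_nonneg by (intro mult_left_mono) auto
  also have "y\<^sup>2 = err N p q t" by (simp add: y_def err_nonneg)
  finally show ?thesis by (simp add: algebra_simps)
qed

text \<open>The right-hand side is only required to be the Galerkin one while the error is small, which
  covers the system with projected unknowns.\<close>

lemma a_priori_estimate:
  fixes p q p' q' :: "real \<Rightarrow> int \<Rightarrow> complex"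
  assumes N: "N \<ge> 1" and large: "(\<delta> N)\<^sup>2 * exp (6 * K * T) < 1 + (\<delta> N)\<^sup>2"
    and init: "\<And>k. k \<in> modes N \<Longrightarrow> p 0 k = fourier_coeff (\<zeta> 0) k" "\<And>k. k \<in> modes N \<Longrightarrow> q 0 k = fourier_coeff (u 0) k"
    and deriv: "\<And>k t. k \<in> modes N \<Longrightarrow> t \<in> {0..T} \<Longrightarrow> ((\<lambda>r. p r k) has_vector_derivative p' t k) (at t within {0..T})"
      "\<And>k t. k \<in> modes N \<Longrightarrow> t \<in> {0..T} \<Longrightarrow> ((\<lambda>r. q r k) has_vector_derivative q' t k) (at t within {0..T})"
    and rhs: "\<And>k t. t \<in> {0..T} \<Longrightarrow> err N (p t) (q t) t \<le> 1 \<Longrightarrow> k \<in> modes N \<Longrightarrow>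
        p' t k = bfd_rhs1 \<gamma> a b (trig_poly (modes N) (p t)) (trig_poly (modes N) (q t)) k"
      "\<And>k t. t \<in> {0..T} \<Longrightarrow> err N (p t) (q t) t \<le> 1 \<Longrightarrow> k \<in> modes N \<Longrightarrow>
        q' t k = bfd_rhs2 \<gamma> c d (trig_poly (modes N) (p t)) (trig_poly (modes N) (q t)) k"
    and t: "t \<in> {0..T}"
  shows "err N (p t) (q t) t + (\<delta> N)\<^sup>2 \<le> (\<delta> N)\<^sup>2 * exp (6 * K * T)"
proof (rule gronwall_continuation[where t = t and E = "\<lambda>t. err N (p t) (q t) t" and E' = "\<lambda>t. err_deriv N (p t) (q t) (p' t) (q' t) t" and S = T])
  show "((\<lambda>t. err N (p t) (q t) t) has_real_derivative err_deriv N (p t) (q t) (p' t) (q' t) t) (at t within {0..T})"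
    if t: "t \<in> {0..T}" for t
  proof -
    have "((\<lambda>t. \<Sum>k\<in>modes N. (cmod (p t k - fourier_coeff (\<zeta> t) k))\<^sup>2 + w k * (cmod (q t k - fourier_coeff (u t) k))\<^sup>2)
      has_real_derivative err_deriv N (p t) (q t) (p' t) (q' t) t) (at t within {0..T})"
      unfolding err_deriv_def
      by (intro DERIV_sum DERIV_add DERIV_cmult has_real_derivative_cmod_power2 has_vector_derivative_diff deriv exact t)
    then show ?thesis by (simp add: err_def)
  qed
  show "err_deriv N (p t) (q t) (p' t) (q' t) t \<le> 6 * K * (err N (p t) (q t) t + (\<delta> N)\<^sup>2)"
    if "t \<in> {0..T}" "err N (p t) (q t) t \<le> 1" for t
    using that by (intro err_deriv_le N rhs)
  show "err N (p 0) (q 0) 0 = 0" using init by (simp add: err_def)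
qed (use large t K_nonneg in auto)

text \<open>The square root of the energy bound turns exp (6 K T) into exp (3 K T), the added 1 is
  the tail of the exact solution, and the factor 2 counts the two unknowns.\<close>

lemma L2_error_bound:
  assumes N: "N \<ge> 1" and t: "t \<in> {0..T}" and e: "err N p q t + (\<delta> N)\<^sup>2 \<le> (\<delta> N)\<^sup>2 * exp (6 * K * T)"
  shows "L2_norm (\<lambda>x. trig_poly (modes N) p x - \<zeta> t x) + L2_norm (\<lambda>x. trig_poly (modes N) q x - u t x)
    \<le> 2 * K\<^sub>0 * (exp (3 * K * T) + 1) * \<delta> N"
proof -
  have "err N p q t \<le> (\<delta> N)\<^sup>2 * exp (6 * K * T)"
    using e zero_le_power2[of "\<delta> N"] by linarith
  also have "exp (6 * K * T) = (exp (3 * K * T))\<^sup>2" by (simp add: exp_double[symmetric])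
  finally have "sqrt (err N p q t) \<le> sqrt ((\<delta> N * exp (3 * K * T))\<^sup>2)"
    by (intro real_sqrt_le_mono) (simp add: power_mult_distrib)
  then have "sqrt (err N p q t) \<le> \<delta> N * exp (3 * K * T)" using \<delta>_bounds(1) by simp
  then have "K\<^sub>0 * (sqrt (err N p q t) + \<delta> N) \<le> K\<^sub>0 * (\<delta> N * exp (3 * K * T) + \<delta> N)"
    using K0_bounds by (intro mult_left_mono add_right_mono) auto
  then show ?thesis
    using L2_error_le(1)[OF N t, where p = p and q = q] L2_error_le(2)[OF N t, where p = p and q = q]
    by (simp add: algebra_simps)
qed

section \<open>Galerkin solutions: error bound and existence\<close>

lemma galerkin_error:
  assumes N: "N \<ge> 1" and large: "(\<delta> N)\<^sup>2 * exp (6 * K * T) < 1 + (\<delta> N)\<^sup>2"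
    and init: "\<And>k. fourier_coeff (\<zeta> 0) k = fourier_coeff (\<lambda>x. complex_of_real (\<zeta>\<^sub>0 x)) k"
      "\<And>k. fourier_coeff (u 0) k = fourier_coeff (\<lambda>x. complex_of_real (u\<^sub>0 x)) k"
    and gal: "galerkin_solution \<gamma> a b c d T N \<zeta>\<^sub>0 u\<^sub>0 \<zeta>\<^sub>N u\<^sub>N" and t: "t \<in> {0..T}"
  shows "L2_norm (\<lambda>x. \<zeta>\<^sub>N t x - \<zeta> t x) + L2_norm (\<lambda>x. u\<^sub>N t x - u t x)
    \<le> 2 * K\<^sub>0 * (exp (3 * K * T) + 1) * \<delta> N"
proof -
  \<comment> \<open>Elements of S_N are recovered from their coefficients, so the Galerkin equations
    become a system for coefficient families, as \<open>a_priori_estimate\<close> expects.\<close>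
  have self: "trig_poly (modes N) (fourier_coeff f) = f" if "f \<in> trig_space N" for f
  proof -
    obtain e where e: "f = trig_poly (modes N) e"
      using \<open>f \<in> trig_space N\<close> unfolding trig_space_iff modes_def by blast
    have "trig_poly (modes N) (fourier_coeff f) = trig_poly (modes N) e"
      by (rule trig_poly_cong) (simp add: e fourier_coeff_trig_poly)
    then show ?thesis by (simp add: e)
  qed
  have mem: "\<zeta>\<^sub>N t \<in> trig_space N" "u\<^sub>N t \<in> trig_space N" if "t \<in> {0..T}" for t
    using gal that by (auto simp: galerkin_solution_def)
  have gal_modes: "bfd_modes \<gamma> a b c d T (modes N) (\<lambda>x. complex_of_real (\<zeta>\<^sub>0 x)) (\<lambda>x. complex_of_real (u\<^sub>0 x)) \<zeta>\<^sub>N u\<^sub>N"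
    using gal by (simp add: galerkin_solution_def modes_def)
  have "err N (fourier_coeff (\<zeta>\<^sub>N t)) (fourier_coeff (u\<^sub>N t)) t + (\<delta> N)\<^sup>2 \<le> (\<delta> N)\<^sup>2 * exp (6 * K * T)"
    by (rule a_priori_estimate[OF N large, where p' = "\<lambda>t. bfd_rhs1 \<gamma> a b (\<zeta>\<^sub>N t) (u\<^sub>N t)"
          and q' = "\<lambda>t. bfd_rhs2 \<gamma> c d (\<zeta>\<^sub>N t) (u\<^sub>N t)" and p = "\<lambda>t. fourier_coeff (\<zeta>\<^sub>N t)" and q = "\<lambda>t. fourier_coeff (u\<^sub>N t)"])
      (use gal_modes t in \<open>auto simp: bfd_modes_iff init self mem\<close>)
  from L2_error_bound[OF N t this] show ?thesis
    by (simp only: self[OF mem(1)[OF t]] self[OF mem(2)[OF t]])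
qed

lemma galerkin_exists:
  assumes N: "N \<ge> 1" and large: "(\<delta> N)\<^sup>2 * exp (6 * K * T) < 1 + (\<delta> N)\<^sup>2"
    and init: "\<And>k. fourier_coeff (\<zeta> 0) k = fourier_coeff (\<lambda>x. complex_of_real (\<zeta>\<^sub>0 x)) k"
      "\<And>k. fourier_coeff (u 0) k = fourier_coeff (\<lambda>x. complex_of_real (u\<^sub>0 x)) k"
  shows "\<exists>\<zeta>\<^sub>N u\<^sub>N. galerkin_solution \<gamma> a b c d T N \<zeta>\<^sub>0 u\<^sub>0 \<zeta>\<^sub>N u\<^sub>N"
proof -
  \<comment> \<open>While the error energy is at most 1, each coefficient of either unknown has
    modulus at most \<open>2 * K\<^sub>0\<close>: one \<open>K\<^sub>0\<close> for the exact
    coefficient and one for the difference. The norm of a pair is at most the sum of its two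
    moduli.\<close>
  define \<rho> where "\<rho> = 2 * K\<^sub>0 + 2 * K\<^sub>0"
  have \<rho>: "\<rho> \<ge> 0" using K0_bounds by (simp add: \<rho>_def)
  define clip where "clip = closest_point (cball (0 :: complex \<times> complex) \<rho>)"
  define cp where "cp v j = fst (clip (v j))" for v :: "int \<Rightarrow> complex \<times> complex" and j
  define cq where "cq v j = snd (clip (v j))" for v :: "int \<Rightarrow> complex \<times> complex" and j
  have cp: "bounded_lipschitz (\<lambda>v. cp v j)" for j
    unfolding cp_def clip_def using \<rho> by (intro bounded_lipschitz_closest_point) (auto simp: norm_fst_le)
  have cq: "bounded_lipschitz (\<lambda>v. cq v j)" for j
    unfolding cq_def clip_def using \<rho> by (intro bounded_lipschitz_closest_point) (auto simp: norm_snd_le)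
  define f where "f v = trig_poly (modes N) (cp v)" for v
  define g where "g v = trig_poly (modes N) (cq v)" for v
  \<comment> \<open>The unknowns are clipped before the right-hand side is evaluated, which makes
    its quadratic terms bounded Lipschitz functionals.\<close>
  define H where "H k v = (bfd_rhs1 \<gamma> a b (f v) (g v) k, bfd_rhs2 \<gamma> c d (f v) (g v) k)" for k v
  have H1: "bounded_lipschitz (\<lambda>v. bfd_rhs1 \<gamma> a b (f v) (g v) k)" if k: "k \<in> modes N" for k
    using k unfolding bfd_rhs1_def Let_def f_def g_def
    by (simp only: fourier_coeff_trig_poly[OF finite_modes] if_True)
      (intro bounded_lipschitz_diff bounded_lipschitz_mult bounded_lipschitz_const
        bounded_lipschitz_fourier_coeff_mult finite_modes cp cq)
  have H2: "bounded_lipschitz (\<lambda>v. bfd_rhs2 \<gamma> c d (f v) (g v) k)" if k: "k \<in> modes N" for k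
    using k unfolding bfd_rhs2_def Let_def f_def g_def power2_eq_square[of "trig_poly _ _ _"]
    by (simp only: fourier_coeff_trig_poly[OF finite_modes] if_True)
      (intro bounded_lipschitz_diff bounded_lipschitz_mult bounded_lipschitz_const
        bounded_lipschitz_fourier_coeff_mult finite_modes cp cq)
  have "\<exists>x. \<forall>k\<in>modes N. x 0 k = (fourier_coeff (\<zeta> 0) k, fourier_coeff (u 0) k) \<and>
      (\<forall>t\<in>{0..T}. ((\<lambda>r. x r k) has_vector_derivative H k (x t)) (at t within {0..T}))"
    unfolding H_def using T H1 H2 by (intro lipschitz_ode_system_global bounded_lipschitz_Pair) auto
  then obtain x where x0: "\<And>k. k \<in> modes N \<Longrightarrow> x 0 k = (fourier_coeff (\<zeta> 0) k, fourier_coeff (u 0) k)"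
    and x: "\<And>k t. k \<in> modes N \<Longrightarrow> t \<in> {0..T} \<Longrightarrow> ((\<lambda>r. x r k) has_vector_derivative H k (x t)) (at t within {0..T})"
    by blast
  define p where "p t k = fst (x t k)" for t k
  define q where "q t k = snd (x t k)" for t k
  define \<zeta>\<^sub>N where "\<zeta>\<^sub>N t = trig_poly (modes N) (p t)" for t
  define u\<^sub>N where "u\<^sub>N t = trig_poly (modes N) (q t)" for t
  have dp: "((\<lambda>r. p r k) has_vector_derivative bfd_rhs1 \<gamma> a b (f (x t)) (g (x t)) k) (at t within {0..T})"
    and dq: "((\<lambda>r. q r k) has_vector_derivative bfd_rhs2 \<gamma> c d (f (x t)) (g (x t)) k) (at t within {0..T})"
    if "k \<in> modes N" "t \<in> {0..T}" for k t
    using bounded_linear.has_vector_derivative[OF bounded_linear_fst x[OF that]]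
      bounded_linear.has_vector_derivative[OF bounded_linear_snd x[OF that]]
    by (simp_all add: p_def q_def H_def)
  \<comment> \<open>Proved only under \<open>err \<le> 1\<close>, which is exactly the range in
    which \<open>a_priori_estimate\<close> asks for the Galerkin right-hand side, so the argument is
    not circular.\<close>
  have unclipped: "f (x t) = \<zeta>\<^sub>N t \<and> g (x t) = u\<^sub>N t" if t: "t \<in> {0..T}" and small: "err N (p t) (q t) t \<le> 1" for t
  proof -
    have "clip (x t k) = x t k" if k: "k \<in> modes N" for k
    proof -
      have "(cmod (fourier_coeff (\<zeta> t) k))\<^sup>2 \<le> M" "(cmod (fourier_coeff (u t) k))\<^sup>2 \<le> M"
        using coeff_bounded_l2[OF M(1)[OF t] \<mu>, of "{k}"] coeff_bounded_l2[OF M(2)[OF t] \<mu>, of "{k}"] by simp_all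
      then have z: "cmod (fourier_coeff (\<zeta> t) k) \<le> K\<^sub>0" "cmod (fourier_coeff (u t) k) \<le> K\<^sub>0"
        using real_le_rsqrt K0_bounds(2) order_trans by blast+
      have "(cmod (p t k - fourier_coeff (\<zeta> t) k))\<^sup>2 \<le> (\<Sum>k\<in>modes N. (cmod (p t k - fourier_coeff (\<zeta> t) k))\<^sup>2)"
        using k by (intro member_le_sum) auto
      also have "\<dots> \<le> 1" using sum_err_le(1)[where N = N and p = "p t" and q = "q t" and t = t] small by linarith
      finally have 1: "cmod (p t k - fourier_coeff (\<zeta> t) k) \<le> K\<^sub>0"
        using K0_bounds(1) by (simp add: power_le_one_iff abs_square_le_1)
      have "(cmod (q t k - fourier_coeff (u t) k))\<^sup>2 \<le> (\<Sum>k\<in>modes N. (cmod (q t k - fourier_coeff (u t) k))\<^sup>2)"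
        using k by (intro member_le_sum) auto
      also have "\<dots> \<le> err N (p t) (q t) t / s" by (rule sum_err_le(3))
      also have "\<dots> \<le> 1 / s" using small s by (intro divide_right_mono) auto
      finally have "cmod (q t k - fourier_coeff (u t) k) \<le> sqrt (1 / s)" by (rule real_le_rsqrt)
      then have 2: "cmod (q t k - fourier_coeff (u t) k) \<le> K\<^sub>0"
        using K0_bounds(3) by (simp add: real_sqrt_divide)
      have "norm (x t k) \<le> cmod (p t k) + cmod (q t k)"
        using norm_Pair_le[of "p t k" "q t k"] by (simp add: p_def q_def)
      also have "\<dots> \<le> \<rho>"
        using 1 2 z norm_triangle_ineq[of "p t k - fourier_coeff (\<zeta> t) k" "fourier_coeff (\<zeta> t) k"]
          norm_triangle_ineq[of "q t k - fourier_coeff (u t) k" "fourier_coeff (u t) k"]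
        by (simp add: \<rho>_def)
      finally show ?thesis by (simp add: clip_def closest_point_self dist_norm)
    qed
    then show ?thesis
      unfolding f_def g_def \<zeta>\<^sub>N_def u\<^sub>N_def by (auto intro!: trig_poly_cong simp: cp_def cq_def p_def q_def)
  qed
  have "err N (p t) (q t) t + (\<delta> N)\<^sup>2 \<le> (\<delta> N)\<^sup>2 * exp (6 * K * T)" if t: "t \<in> {0..T}" for t
    by (rule a_priori_estimate[OF N large, where p' = "\<lambda>t. bfd_rhs1 \<gamma> a b (f (x t)) (g (x t))"
          and q' = "\<lambda>t. bfd_rhs2 \<gamma> c d (f (x t)) (g (x t))" and p = p and q = q])
      (use t dp dq unclipped in \<open>auto simp: p_def q_def x0 \<zeta>\<^sub>N_def u\<^sub>N_def\<close>)
  \<comment> \<open>By \<open>large\<close> the estimate keeps the energy below 1 on the whole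
    interval, so the clipping is inactive throughout.\<close>
  then have small: "err N (p t) (q t) t \<le> 1" if "t \<in> {0..T}" for t
    using large that by fastforce
  have coeff: "fourier_coeff (\<zeta>\<^sub>N t) k = p t k" "fourier_coeff (u\<^sub>N t) k = q t k" if "k \<in> modes N" for k t
    using that by (simp_all add: \<zeta>\<^sub>N_def u\<^sub>N_def fourier_coeff_trig_poly)
  have "galerkin_solution \<gamma> a b c d T N \<zeta>\<^sub>0 u\<^sub>0 \<zeta>\<^sub>N u\<^sub>N"
    unfolding galerkin_solution_def
  proof (intro conjI ballI)
    show "\<zeta>\<^sub>N t \<in> trig_space N" "u\<^sub>N t \<in> trig_space N" for t
      by (auto simp: trig_space_iff \<zeta>\<^sub>N_def u\<^sub>N_def modes_def)
    have "bfd_modes \<gamma> a b c d T (modes N) (\<lambda>x. complex_of_real (\<zeta>\<^sub>0 x)) (\<lambda>x. complex_of_real (u\<^sub>0 x)) \<zeta>\<^sub>N u\<^sub>N"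
      unfolding bfd_modes_iff
      using dp dq unclipped small by (auto simp: coeff p_def q_def x0 init)
    then show "bfd_modes \<gamma> a b c d T {- int N..int N} (\<lambda>x. complex_of_real (\<zeta>\<^sub>0 x)) (\<lambda>x. complex_of_real (u\<^sub>0 x)) \<zeta>\<^sub>N u\<^sub>N"
      by (simp add: modes_def)
  qed
  then show ?thesis by blast
qed

lemma large_N:
  "\<exists>N\<^sub>0\<ge>1. \<forall>N\<ge>N\<^sub>0. (\<delta> N)\<^sup>2 * exp (6 * K * T) < 1 + (\<delta> N)\<^sup>2"
proof (intro exI conjI allI impI)
  \<comment> \<open>Since \<delta>^2 \<le> \<delta> \<le> 1 / N, every N beyond exp (6 K T) makes
    the product \<delta>^2 exp (6 K T) less than 1.\<close>
  define N\<^sub>0 where "N\<^sub>0 = nat \<lceil>exp (6 * K * T)\<rceil> + 1"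
  show "N\<^sub>0 \<ge> 1" by (simp add: N\<^sub>0_def)
  fix N assume N: "N \<ge> N\<^sub>0"
  then have N1: "N \<ge> 1" by (simp add: N\<^sub>0_def)
  have "exp (6 * K * T) < real N" using N unfolding N\<^sub>0_def by linarith
  have "\<delta> N \<le> real N powr (- 1)" unfolding \<delta>_def using N1 \<mu> by (intro powr_mono) auto
  then have "\<delta> N \<le> 1 / real N" using N1 by (simp add: powr_minus divide_inverse)
  moreover have "(\<delta> N)\<^sup>2 \<le> \<delta> N" using \<delta>_bounds[of N] N1 by (simp add: power2_eq_square mult_left_le)
  ultimately have "(\<delta> N)\<^sup>2 * exp (6 * K * T) \<le> (1 / real N) * exp (6 * K * T)"
    by (intro mult_right_mono) auto
  also have "\<dots> < 1" using \<open>exp (6 * K * T) < real N\<close> N1 by (simp add: field_simps)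
  finally show "(\<delta> N)\<^sup>2 * exp (6 * K * T) < 1 + (\<delta> N)\<^sup>2"
    using zero_le_power2[of "\<delta> N"] by linarith
qed

end

section \<open>Verification of the setting and conclusion\<close>

theorem proposition2p3:
  fixes \<alpha>\<^sub>1 \<alpha>\<^sub>2 \<beta> \<gamma> a b c d T \<mu> :: real
    and \<zeta>\<^sub>0 u\<^sub>0 :: "real \<Rightarrow> real"
    and \<zeta> u :: "real \<Rightarrow> real \<Rightarrow> real"
  assumes "\<alpha>\<^sub>1 \<ge> 0" and "\<alpha>\<^sub>2 \<le> 1" and "\<beta> \<ge> 0"
    and "a = (1 - \<alpha>\<^sub>1 - 3 * \<beta>) / 3"
    and "b = \<alpha>\<^sub>1 / 3"
    and "c = \<beta> * \<alpha>\<^sub>2"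
    and "d = \<beta> * (1 - \<alpha>\<^sub>2)"
    and "0 < \<gamma>" and "\<gamma> < 1" and "T > 0"
    and "b > 0" and "d > 0"
    and "(a < 0 \<and> c = 0) \<or> (a = 0 \<and> c < 0)"
    and "\<mu> \<ge> 1"
    and "(\<lambda>x. complex_of_real (\<zeta>\<^sub>0 x)) \<in> sobolev \<mu>"
    and "(\<lambda>x. complex_of_real (u\<^sub>0 x)) \<in> sobolev \<mu>"
    and "unique_bfd_solution \<gamma> a b c d T \<mu> \<zeta>\<^sub>0 u\<^sub>0 \<zeta> u"
  shows "\<exists>N\<^sub>0\<ge>1. \<exists>C::real. \<forall>N::nat. N \<ge> N\<^sub>0 \<longrightarrow>
    (\<exists>\<zeta>\<^sub>N u\<^sub>N. galerkin_solution \<gamma> a b c d T N \<zeta>\<^sub>0 u\<^sub>0 \<zeta>\<^sub>N u\<^sub>N) \<and>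
    (\<forall>\<zeta>\<^sub>N u\<^sub>N. galerkin_solution \<gamma> a b c d T N \<zeta>\<^sub>0 u\<^sub>0 \<zeta>\<^sub>N u\<^sub>N \<longrightarrow>
       (\<forall>t\<in>{0..T}. L2_norm (\<lambda>x. \<zeta>\<^sub>N t x - complex_of_real (\<zeta> t x))
                   + L2_norm (\<lambda>x. u\<^sub>N t x - complex_of_real (u t x)) \<le> C * real N powr (- \<mu>)))"
proof -
  note \<gamma> = assms(8,9) and T = assms(10) and bd = assms(11,12) and ac = assms(13) and \<mu> = assms(14)
  define z where "z t x = complex_of_real (\<zeta> t x)" for t x
  define v where "v t x = complex_of_real (u t x)" for t x
  have zC: "z \<in> C_sobolev T \<mu>" and vC: "v \<in> C_sobolev T \<mu>"
    and modes: "bfd_modes \<gamma> a b c d T UNIV (\<lambda>x. complex_of_real (\<zeta>\<^sub>0 x)) (\<lambda>x. complex_of_real (u\<^sub>0 x)) z v"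
    using assms(17) by (auto simp: unique_bfd_solution_def bfd_solution_def z_def[abs_def] v_def[abs_def])
  obtain M1 where M1: "\<And>t. t \<in> {0..T} \<Longrightarrow> coeff_bounded \<mu> M1 (fourier_coeff (z t))"
    using C_sobolev_bounded[OF zC] by blast
  obtain M2 where M2: "\<And>t. t \<in> {0..T} \<Longrightarrow> coeff_bounded \<mu> M2 (fourier_coeff (v t))"
    using C_sobolev_bounded[OF vC] by blast
  obtain s R where s: "s > 0" and R: "R > 0"
    and w1: "\<And>\<kappa>. \<kappa> = 0 \<or> \<bar>\<kappa>\<bar> \<ge> 1 \<Longrightarrow> s \<le> energy_weight \<gamma> a b c d \<kappa>"
    and w2: "\<And>\<kappa>. (\<kappa> / (1 + b * \<kappa>\<^sup>2))\<^sup>2 \<le> R / (1 + \<kappa>\<^sup>2)"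
    and w3: "(\<forall>\<kappa>. \<kappa> = 0 \<or> \<bar>\<kappa>\<bar> \<ge> 1 \<longrightarrow>
        energy_weight \<gamma> a b c d \<kappa> * (\<kappa> / (1 + d * \<kappa>\<^sup>2))\<^sup>2 \<le> R / (1 + \<kappa>\<^sup>2)) \<or>
     (\<forall>\<kappa>. \<kappa> = 0 \<or> \<bar>\<kappa>\<bar> \<ge> 1 \<longrightarrow>
        energy_weight \<gamma> a b c d \<kappa> * (\<kappa> / (1 + d * \<kappa>\<^sup>2))\<^sup>2 \<le> R \<and>
        s * (1 + \<kappa>\<^sup>2) \<le> energy_weight \<gamma> a b c d \<kappa>)"
    using energy_weight_estimates[OF \<gamma> bd ac] by blast
  have Mz: "coeff_bounded \<mu> (max M1 M2) (fourier_coeff (z t))" and Mv: "coeff_bounded \<mu> (max M1 M2) (fourier_coeff (v t))"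
    and sq: "square_integrable (z t)" "square_integrable (v t)" if "t \<in> {0..T}" for t
    using coeff_bounded_mono[OF M1[OF that]] coeff_bounded_mono[OF M2[OF that]] zC vC that
    by (auto simp: C_sobolev_def intro!: sobolev_square_integrable[of _ \<mu>])
  have c: "c \<le> 0" using ac by auto
  \<comment> \<open>The symbol estimates are stated in \<kappa> = 2 pi k, the Sobolev weights in k;
    since 2 pi \<ge> 1, the passage from one to the other only weakens the bounds.\<close>
  have R_le: "R / (1 + (2 * pi * of_int k)\<^sup>2) \<le> R / (1 + (real_of_int k)\<^sup>2)" for k
    using R wave_number_bounds(2)[of k] by (intro divide_left_mono) (auto intro!: mult_pos_pos add_pos_nonneg)
  have s_le: "s * (1 + (real_of_int k)\<^sup>2) \<le> s * (1 + (2 * pi * of_int k)\<^sup>2)" for k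
    using s wave_number_bounds(2)[of k] by (intro mult_left_mono) auto
  interpret bfd_setting \<gamma> a b c d T \<mu> "max M1 M2" s R z v
    "\<lambda>k. energy_weight \<gamma> a b c d (2 * pi * of_int k)"
    "\<lambda>k. (2 * pi * of_int k) / (1 + b * (2 * pi * of_int k)\<^sup>2)"
    "\<lambda>k. (2 * pi * of_int k) / (1 + d * (2 * pi * of_int k)\<^sup>2)"
  proof unfold_locales
    fix k :: int
    show "((2 * pi * of_int k) / (1 + b * (2 * pi * of_int k)\<^sup>2))\<^sup>2 \<le> R / (1 + (real_of_int k)\<^sup>2)"
      using w2[of "2 * pi * of_int k"] R_le[of k] by linarith
  next
    from w3 show "(\<forall>k::int. energy_weight \<gamma> a b c d (2 * pi * of_int k) * ((2 * pi * of_int k) / (1 + d * (2 * pi * of_int k)\<^sup>2))\<^sup>2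
          \<le> R / (1 + (of_int k)\<^sup>2)) \<or>
      (\<forall>k::int. energy_weight \<gamma> a b c d (2 * pi * of_int k) * ((2 * pi * of_int k) / (1 + d * (2 * pi * of_int k)\<^sup>2))\<^sup>2 \<le> R \<and>
          s * (1 + (of_int k)\<^sup>2) \<le> energy_weight \<gamma> a b c d (2 * pi * of_int k))"
    proof
      assume "\<forall>\<kappa>. \<kappa> = 0 \<or> \<bar>\<kappa>\<bar> \<ge> 1 \<longrightarrow>
        energy_weight \<gamma> a b c d \<kappa> * (\<kappa> / (1 + d * \<kappa>\<^sup>2))\<^sup>2 \<le> R / (1 + \<kappa>\<^sup>2)"
      then show ?thesis using wave_number_bounds(1) R_le order_trans by blast
    next
      assume "\<forall>\<kappa>. \<kappa> = 0 \<or> \<bar>\<kappa>\<bar> \<ge> 1 \<longrightarrow>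
        energy_weight \<gamma> a b c d \<kappa> * (\<kappa> / (1 + d * \<kappa>\<^sup>2))\<^sup>2 \<le> R \<and>
        s * (1 + \<kappa>\<^sup>2) \<le> energy_weight \<gamma> a b c d \<kappa>"
      then show ?thesis using wave_number_bounds(1) s_le order_trans by blast
    qed
  qed (use \<gamma> T bd c \<mu> s R w1 wave_number_bounds(1) modes Mz Mv sq in \<open>auto simp: bfd_modes_iff\<close>)
  have init: "fourier_coeff (z 0) k = fourier_coeff (\<lambda>x. complex_of_real (\<zeta>\<^sub>0 x)) k"
    "fourier_coeff (v 0) k = fourier_coeff (\<lambda>x. complex_of_real (u\<^sub>0 x)) k" for k
    using modes by (auto simp: bfd_modes_iff)
  obtain N\<^sub>0 where N\<^sub>0: "N\<^sub>0 \<ge> 1" "\<And>N. N \<ge> N\<^sub>0 \<Longrightarrow> (\<delta> N)\<^sup>2 * exp (6 * K * T) < 1 + (\<delta> N)\<^sup>2"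
    using large_N by blast
  show ?thesis
  proof (intro exI[of _ N\<^sub>0] exI[of _ "2 * K\<^sub>0 * (exp (3 * K * T) + 1)"] conjI allI impI ballI)
    fix N assume N: "N \<ge> N\<^sub>0"
    then have N1: "N \<ge> 1" using N\<^sub>0(1) by simp
    show "\<exists>\<zeta>\<^sub>N u\<^sub>N. galerkin_solution \<gamma> a b c d T N \<zeta>\<^sub>0 u\<^sub>0 \<zeta>\<^sub>N u\<^sub>N"
      by (rule galerkin_exists[OF N1 N\<^sub>0(2)[OF N] init])
    fix \<zeta>\<^sub>N u\<^sub>N t
    assume gal: "galerkin_solution \<gamma> a b c d T N \<zeta>\<^sub>0 u\<^sub>0 \<zeta>\<^sub>N u\<^sub>N" and t: "t \<in> {0..T}"
    show "L2_norm (\<lambda>x. \<zeta>\<^sub>N t x - complex_of_real (\<zeta> t x)) + L2_norm (\<lambda>x. u\<^sub>N t x - complex_of_real (u t x))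
        \<le> 2 * K\<^sub>0 * (exp (3 * K * T) + 1) * real N powr (- \<mu>)"
      using galerkin_error[OF N1 N\<^sub>0(2)[OF N] init gal t] by (simp add: z_def v_def \<delta>_def)
  qed (rule N\<^sub>0(1))
qed

end
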